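(* Let $\theta:\mathbb{R}^m\to(-\infty,\infty]$ be convex piecewise linear, let $\bar w\in\mathbb{R}^d$ be fixed, let $\Phi:\mathbb{R}^n\times\mathbb{R}^d\to\mathbb{R}^m$ be $\mathcal{C}^2$-smooth around $(\bar x,\bar w)$, let $f:\mathbb{R}^n\times\mathbb{R}^d\to\mathbb{R}^n$, and let $$S(v):=\{x\in\mathbb{R}^n:\ v\in f(x,\bar w)+\partial_x(\theta\circ\Phi)(x,\bar w)\},\qquad v\in\mathbb{R}^n.$$ Let $(\bar v,\bar x)\in\operatorname{gph}S$, let $f$ be strictly differentiable at $(\bar x,\bar w)$ with respect to $x$, put $\bar z:=\Phi(\bar x,\bar w)\in\operatorname{dom}\theta$, and assume that the nondegeneracy condition ND holds at $(\bar x,\bar w)$. Denote $\bar p:=\bar v-f(\bar x,\bar w)\in\partial_x(\theta\circ\Phi)(\bar x,\bar w)$ and take $\bar y\in\partial\theta(\bar z)$ such that $\nabla_x\Phi(\bar x,\bar w)^*\bar y=\bar p$. Then $S$ is Lipschitz-like around $(\bar v,\bar x)$ if and only if $u=0$ is the only vector $u\in\mathbb{R}^n$ satisfying $$0\in\nabla_xf(\bar x,\bar w)^*u+\nabla^2_{xx}\langle\bar y,\Phi\rangle(\bar x,\bar w)u+\nabla_x\Phi(\bar x,\bar w)^*\partial^2\theta(\bar z,\bar y)(\nabla_x\Phi(\bar x,\bar w)u).$$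
   Context: **Convex piecewise linear.** $\theta$ is convex piecewise linear if, for some $a_i\in\mathbb{R}^m,\alpha_i\in\mathbb{R}$ ($i\in T_1=\{1,\dots,l\}$), $d_i\in\mathbb{R}^m,\beta_i\in\mathbb{R}$ ($i\in T_2=\{1,\dots,p\}$), $\operatorname{dom}\theta=\{z:\langle d_i,z\rangle\le\beta_i,\ i\in T_2\}\ne\emptyset$, $\theta(z)=\max_{i\in T_1}\{\langle a_i,z\rangle-\alpha_i\}$ on $\operatorname{dom}\theta$, and $\theta=\infty$ elsewhere. $\partial\theta$ is the subdifferential of convex analysis. **Standing assumption.** $0\in\operatorname{aff}\partial\theta(\bar z)$. **Normal cone, subdifferentials.** For a set $\Omega$ and $\bar q\in\Omega$, $N(\bar q;\Omega)$ is the limiting (Mordukhovich) normal cone: all limits $v=\lim v_k$ with $q_k\to\bar q$, $q_k\in\Omega$, $\limsup_{q\to q_k,\,q\in\Omega}\langle v_k,q-q_k\rangle/\|q-q_k\|\le0$. For $\varphi:\mathbb{R}^n\to(-\infty,\infty]$, $\partial\varphi(x):=\{v:(v,-1)\in N((x,\varphi(x));\operatorname{epi}\varphi)\}$; $\partial_x(\theta\circ\Phi)(x,\bar w)$ is the subdifferential at $x$ of $\theta(\Phi(\cdot,\bar w))$. The second-order subdifferential is $\partial^2\theta(\bar z,\bar y)(u):=\{q:(q,-u)\in N((\bar z,\bar y);\operatorname{gph}\partial\theta)\}$. **Explicit formula for $\partial^2\theta$ (known).** With $K(z):=\{i\in T_1:\langle a_i,z\rangle-\alpha_i=\max_j(\langle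 a_j,z\rangle-\alpha_j)\}$, $I(z):=\{i\in T_2:\langle d_i,z\rangle=\beta_i\}$, one has $q\in\partial^2\theta(\bar z,\bar y)(u)$ iff there are $P_1\subset Q_1\subset K(\bar z)$, $P_2\subset Q_2\subset I(\bar z)$ with $\bar y\in\operatorname{conv}\{a_i:i\in P_1\}+\operatorname{cone}\{d_i:i\in P_2\}$ and some $z\in\operatorname{dom}\theta$ with $K(z)=Q_1$, $I(z)=Q_2$, such that $q\in\operatorname{span}\{a_i-a_j:i,j\in P_1\}+\operatorname{cone}\{a_i-a_j:(i,j)\in(Q_1\setminus P_1)\times P_1\}+\operatorname{span}\{d_i:i\in P_2\}+\operatorname{cone}\{d_i:i\in Q_2\setminus P_2\}$ and $-u$ satisfies $\langle a_i-a_j,-u\rangle=0$ for $i,j\in P_1$, $\langle a_i-a_j,-u\rangle\le0$ for $(i,j)\in(Q_1\setminus P_1)\times P_1$, $\langle d_i,-u\rangle=0$ for $i\in P_2$, $\langle d_i,-u\rangle\le0$ for $i\in Q_2\setminus P_2$. **Nondegeneracy condition ND** at $(\bar x,\bar w)$: $S(\bar z)\cap\ker\nabla_x\Phi(\bar x,\bar w)^*=\{0\}$ (equivalently $\nabla_x\Phi(\bar x,\bar w)\mathbb{R}^n+S(\bar z)^\perp=\mathbb{R}^m$), where $S(\bar z)$ is the linear subspace of $\mathbb{R}^m$ parallel to $\operatorname{aff}\partial\theta(\bar z)$ (not to be confused with the solution map $S$). **Notation.** $\langle\bar y,\Phi\rangle(x,w):=\langle\bar y,\Phi(x,w)\rangle$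 and $\nabla^2_{xx}$ is the Hessian in $x$. "Strictly differentiable at $(\bar x,\bar w)$ with respect to $x$" means that $f(\cdot,\bar w)$ is strictly differentiable at $\bar x$. **Lipschitz-like (Aubin) property.** $S$ is Lipschitz-like around $(\bar v,\bar x)\in\operatorname{gph}S$ if there are neighborhoods $U$ of $\bar v$, $O$ of $\bar x$ and $\ell>0$ with $S(v_1)\cap O\subset S(v_2)+\ell\|v_1-v_2\|\mathbb{B}$ for all $v_1,v_2\in U$, where $\mathbb{B}$ is the closed unit ball. *)

theory Defs
  imports "HOL-Analysis.Analysis"
begin

section \<open>Extended-real-valued functions\<close>

definition edom :: "('a \<Rightarrow> ereal) \<Rightarrow> 'a set" where
  "edom \<phi> = {x. \<phi> x < \<infinity>}"

definition epi :: "('a \<Rightarrow> ereal) \<Rightarrow> ('a \<times> real) set" where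
  "epi \<phi> = {(x, t). \<phi> x \<le> ereal t}"

text \<open>The case \<open>p = 0\<close>, i.e. no constraint, is allowed; it is the same as one trivial constraint
  with \<open>d 1 = 0\<close> and \<open>\<beta> 1 = 0\<close>.\<close>

definition convex_piecewise_linear :: "('a::real_inner \<Rightarrow> ereal) \<Rightarrow> bool" where
  "convex_piecewise_linear \<theta> \<longleftrightarrow>
     (\<exists>(l::nat) (p::nat) (a::nat \<Rightarrow> 'a) (\<alpha>::nat \<Rightarrow> real) (d::nat \<Rightarrow> 'a) (\<beta>::nat \<Rightarrow> real).
        l \<ge> 1 \<and>
        edom \<theta> = {z. \<forall>i\<in>{1..p}. d i \<bullet> z \<le> \<beta> i} \<and>
        edom \<theta> \<noteq> {} \<and>
        (\<forall>z\<in>edom \<theta>. \<theta> z = ereal (Max ((\<lambda>i. a i \<bullet> z - \<alpha> i) ` {1..l}))) \<and>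
        (\<forall>z. z \<notin> edom \<theta> \<longrightarrow> \<theta> z = \<infinity>))"

section \<open>Normal cones and subdifferentials\<close>

text \<open>At an isolated point of \<open>\<Omega>\<close> the filter is trivial and the \<open>Limsup\<close> is \<open>-\<infinity>\<close>, so that every
  vector is regular normal there.\<close>

definition regular_normal_cone :: "'a::real_inner set \<Rightarrow> 'a \<Rightarrow> 'a set" where
  "regular_normal_cone \<Omega> q =
     {v. Limsup (at q within \<Omega>) (\<lambda>q'. ereal (v \<bullet> (q' - q) / norm (q' - q))) \<le> 0}"

definition limiting_normal_cone :: "'a::real_inner set \<Rightarrow> 'a \<Rightarrow> 'a set" where
  "limiting_normal_cone \<Omega> q =
     {v. q \<in> \<Omega> \<and>
         (\<exists>(Q::nat \<Rightarrow> 'a) (V::nat \<Rightarrow> 'a).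
            (\<forall>k. Q k \<in> \<Omega> \<and> V k \<in> regular_normal_cone \<Omega> (Q k)) \<and>
            Q \<longlonglongrightarrow> q \<and> V \<longlonglongrightarrow> v)}"

text \<open>Both subdifferentials are empty at points where the function is not finite.\<close>

definition limiting_subdiff :: "('a::real_inner \<Rightarrow> ereal) \<Rightarrow> 'a \<Rightarrow> 'a set" where
  "limiting_subdiff \<phi> x =
     {v. \<bar>\<phi> x\<bar> \<noteq> \<infinity> \<and> (v, -1) \<in> limiting_normal_cone (epi \<phi>) (x, real_of_ereal (\<phi> x))}"

definition convex_subdiff :: "('a::real_inner \<Rightarrow> ereal) \<Rightarrow> 'a \<Rightarrow> 'a set" where
  "convex_subdiff \<theta> z =
     {y. \<bar>\<theta> z\<bar> \<noteq> \<infinity> \<and> (\<forall>z'. \<theta> z + ereal (y \<bullet> (z' - z)) \<le> \<theta> z')}"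

definition graph_of :: "('a \<Rightarrow> 'b set) \<Rightarrow> ('a \<times> 'b) set" where
  "graph_of F = {(x, y). y \<in> F x}"

definition second_subdiff ::
    "('a::real_inner \<Rightarrow> ereal) \<Rightarrow> 'a \<Rightarrow> 'a \<Rightarrow> 'a \<Rightarrow> 'a set" where
  "second_subdiff \<theta> z y u =
     {q. (q, - u) \<in> limiting_normal_cone (graph_of (convex_subdiff \<theta>)) (z, y)}"

section \<open>Smoothness and partial derivatives\<close>

definition C2_around :: "('a::real_normed_vector \<Rightarrow> 'b::real_normed_vector) \<Rightarrow> 'a \<Rightarrow> bool" where
  "C2_around F p \<longleftrightarrow>
     (\<exists>U (F' :: 'a \<Rightarrow> 'a \<Rightarrow>\<^sub>L 'b) (F'' :: 'a \<Rightarrow> 'a \<Rightarrow>\<^sub>L ('a \<Rightarrow>\<^sub>L 'b)).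
        open U \<and> p \<in> U \<and>
        (\<forall>q\<in>U. (F has_derivative blinfun_apply (F' q)) (at q)) \<and>
        (\<forall>q\<in>U. (F' has_derivative blinfun_apply (F'' q)) (at q)) \<and>
        continuous_on U F'')"

definition strictly_differentiable_at ::
    "('a::real_normed_vector \<Rightarrow> 'b::real_normed_vector) \<Rightarrow> 'a \<Rightarrow> bool" where
  "strictly_differentiable_at h x \<longleftrightarrow>
     (\<exists>A. bounded_linear A \<and>
        ((\<lambda>(x1, x2). (h x1 - h x2 - A (x1 - x2)) /\<^sub>R norm (x1 - x2)) \<longlongrightarrow> 0)
          (at (x, x) within {(x1, x2). x1 \<noteq> x2}))"

definition partial_x ::
    "('a::real_normed_vector \<times> 'c \<Rightarrow> 'b::real_normed_vector) \<Rightarrow> 'a \<Rightarrow> 'c \<Rightarrow> 'a \<Rightarrow> 'b" where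
  "partial_x F x w = frechet_derivative (\<lambda>x'. F (x', w)) (at x)"

definition gradient :: "('a::real_inner \<Rightarrow> real) \<Rightarrow> 'a \<Rightarrow> 'a" where
  "gradient g x = (THE D. GDERIV g x :> D)"

definition hessian_xx :: "('a::real_inner \<times> 'c \<Rightarrow> real) \<Rightarrow> 'a \<Rightarrow> 'c \<Rightarrow> 'a \<Rightarrow> 'a" where
  "hessian_xx G x w = frechet_derivative (gradient (\<lambda>x'. G (x', w))) (at x)"

section \<open>Nondegeneracy, the solution map and the Aubin property\<close>

text \<open>Meaningful for nonempty \<open>A\<close>, where the subspace exists and is unique by
  \<open>affine_parallel_subspace\<close>.\<close>

definition direction_space :: "'a::real_vector set \<Rightarrow> 'a set" where
  "direction_space A = (THE L. subspace L \<and> affine_parallel (affine hull A) L)"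

definition nondegenerate ::
    "('b::euclidean_space \<Rightarrow> ereal) \<Rightarrow> ('a::euclidean_space \<times> 'c \<Rightarrow> 'b) \<Rightarrow> 'a \<Rightarrow> 'c \<Rightarrow> bool" where
  "nondegenerate \<theta> \<Phi> x w \<longleftrightarrow>
     direction_space (convex_subdiff \<theta> (\<Phi> (x, w)))
       \<inter> {y. adjoint (partial_x \<Phi> x w) y = 0} = {0}"

definition solution_map ::
    "('b \<Rightarrow> ereal) \<Rightarrow> ('a::real_inner \<times> 'c \<Rightarrow> 'b) \<Rightarrow> ('a \<times> 'c \<Rightarrow> 'a) \<Rightarrow> 'c \<Rightarrow> 'a \<Rightarrow> 'a set" where
  "solution_map \<theta> \<Phi> f w v =
     {x. v \<in> f (x, w) +o limiting_subdiff (\<lambda>x'. \<theta> (\<Phi> (x', w))) x}"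

definition lipschitz_like ::
    "('a::real_normed_vector \<Rightarrow> 'b::real_normed_vector set) \<Rightarrow> 'a \<Rightarrow> 'b \<Rightarrow> bool" where
  "lipschitz_like S v x \<longleftrightarrow>
     (\<exists>U W (L::real). open U \<and> v \<in> U \<and> open W \<and> x \<in> W \<and> L > 0 \<and>
        (\<forall>v1\<in>U. \<forall>v2\<in>U.
           S v1 \<inter> W \<subseteq> S v2 + (\<lambda>b. (L * norm (v1 - v2)) *\<^sub>R b) ` cball 0 1))"

end

theory Submission
  imports Defs
begin

text \<open>
  Near \<open>zbar\<close> the function \<open>\<theta>\<close> does not change along directions orthogonal to \<open>S = aff (\<partial>\<theta>(zbar))\<close>,
  a subspace by the standing assumption, and nondegeneracy says that \<open>\<Phi>(\<cdot>, wbar)\<close> is a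
  submersion modulo the orthogonal complement of \<open>S\<close>. Hence the subgradients of the composition at \<open>x\<close> near
  \<open>xbar\<close> are the vectors \<open>\<nabla>\<Phi>(x)\<^sup>* y\<close> with \<open>y \<in> \<partial>\<theta>(\<Phi>(x))\<close>,
  where \<open>y \<in> S\<close> is unique and depends in a Lipschitz way on \<open>x\<close> and the subgradient. The graph of the
  inverse of the solution map is therefore the image of the pullback of \<open>gph \<partial>\<theta>\<close> under the
  strictly differentiable, bi-Lipschitz map \<open>(x, y) \<mapsto> (x, f x + \<nabla>\<Phi>(x)\<^sup>* y)\<close>, and
  limiting normals can be transported along both maps; this is the exact coderivative formula behind the
  displayed generalized equation. The Aubin property is then characterised by Mordukhovich's criterion for a
  locally closed graph. All arguments about normals use a formulation with \<open>\<epsilon>\<close>-normals at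
  nearby points, which is equivalent to the limiting one on locally closed sets.
\<close>

section \<open>Strict derivatives\<close>

text \<open>Two obstacles shape the proof. First, \<open>f\<close> is strictly differentiable at the
  reference point only. At neighbouring points it may have no derivative, so a regular normal there
  has no exact counterpart under the change of variables. What survives is an inequality with the
  derivative at the reference point and an error proportional to the increment. Approximate normals
  are tailored to this: the vector is fixed, the base point and the slope error vary, and the
  linearization error is absorbed by the latter. Exact normals are recovered by projection, and only
  on the closed graph of the subdifferential of \<theta>. Second, the derivative of \<Phi> need not
  be onto, so a point near \<open>\<Phi> (x, wbar)\<close> can be reached only up to a vector
  orthogonal to S. Each lifting argument therefore ends in the right fibre modulo the orthogonal
  complement of S, and the local invariance of \<theta> along that complement closes the gap. The
  same fibres produce multipliers: a vector that is an approximate normal along them must lie in the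
  range of the adjoint on S.\<close>

lemma norm_Pair_le_add: "norm (a, b) \<le> norm a + norm b"
  by (metis norm_Pair sqrt_sum_squares_le_sum norm_ge_zero)

text \<open>The limit over pairs of points, multiplied out so that coinciding points need no
  exception. Only differences of values near \<open>p\<close> are constrained; \<open>F\<close> may
  fail to be differentiable at every other point.\<close>

definition strict_derivative ::
    "('a::real_normed_vector \<Rightarrow> 'b::real_normed_vector) \<Rightarrow> ('a \<Rightarrow> 'b) \<Rightarrow> 'a \<Rightarrow> bool" where
  "strict_derivative F A p \<longleftrightarrow> bounded_linear A \<and>
     (\<forall>\<epsilon>>0. \<exists>r>0. \<forall>x\<in>ball p r. \<forall>x'\<in>ball p r. norm (F x - F x' - A (x - x')) \<le> \<epsilon> * norm (x - x'))"

lemma strict_derivativeD: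
  assumes "strict_derivative F A p" "\<epsilon> > 0"
  obtains r where "r > 0"
    "\<And>x x'. \<lbrakk>x \<in> ball p r; x' \<in> ball p r\<rbrakk> \<Longrightarrow> norm (F x - F x' - A (x - x')) \<le> \<epsilon> * norm (x - x')"
  using assms unfolding strict_derivative_def by blast

lemma strict_derivative_bounded_linear: "strict_derivative F A p \<Longrightarrow> bounded_linear A"
  by (simp add: strict_derivative_def)

lemma strict_derivative_has_derivative:
  assumes "strict_derivative F A p"
  shows "(F has_derivative A) (at p)"
  unfolding has_derivative_at_alt
proof (intro conjI allI impI)
  show "bounded_linear A" by (rule strict_derivative_bounded_linear[OF assms])
  fix e :: real assume "e > 0"
  from strict_derivativeD[OF assms this] obtain r where r: "r > 0"
    "\<And>x x'. \<lbrakk>x \<in> ball p r; x' \<in> ball p r\<rbrakk> \<Longrightarrow> norm (F x - F x' - A (x - x')) \<le> e * norm (x - x')"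
    by blast
  have "\<forall>y. norm (y - p) < r \<longrightarrow> norm (F y - F p - A (y - p)) \<le> e * norm (y - p)"
    using r by (auto simp: dist_norm norm_minus_commute)
  then show "\<exists>d>0. \<forall>y. norm (y - p) < d \<longrightarrow> norm (F y - F p - A (y - p)) \<le> e * norm (y - p)"
    using r(1) by blast
qed

lemma strict_derivative_lipschitz:
  assumes "strict_derivative F A p"
  obtains r L where "r > 0" "L > 0"
    "\<And>x x'. \<lbrakk>x \<in> ball p r; x' \<in> ball p r\<rbrakk> \<Longrightarrow> norm (F x - F x') \<le> L * norm (x - x')"
proof -
  interpret A: bounded_linear A by (rule strict_derivative_bounded_linear[OF assms])
  obtain K where K: "K > 0" "\<And>x. norm (A x) \<le> norm x * K" using A.pos_bounded by blast
  obtain r where r: "r > 0"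
    "\<And>x x'. \<lbrakk>x \<in> ball p r; x' \<in> ball p r\<rbrakk> \<Longrightarrow> norm (F x - F x' - A (x - x')) \<le> 1 * norm (x - x')"
    using strict_derivativeD[OF assms, of 1] by auto
  have "norm (F x - F x') \<le> (1 + K) * norm (x - x')" if "x \<in> ball p r" "x' \<in> ball p r" for x x'
  proof -
    have "norm (F x - F x') \<le> norm (F x - F x' - A (x - x')) + norm (A (x - x'))"
      by (metis add.commute diff_add_cancel norm_triangle_ineq)
    then show ?thesis using r(2)[OF that] K(2)[of "x - x'"] by (simp add: algebra_simps)
  qed
  then show thesis using that[of r "1 + K"] r(1) K(1) by auto
qed

lemma strictly_differentiable_at_imp:
  assumes "strictly_differentiable_at h x"
  obtains A where "strict_derivative h A x"
proof -
  obtain A where A: "bounded_linear A"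
    and lim: "((\<lambda>(x1, x2). (h x1 - h x2 - A (x1 - x2)) /\<^sub>R norm (x1 - x2)) \<longlongrightarrow> 0)
          (at (x, x) within {(x1, x2). x1 \<noteq> x2})"
    using assms unfolding strictly_differentiable_at_def by blast
  have "\<exists>r>0. \<forall>x1\<in>ball x r. \<forall>x2\<in>ball x r. norm (h x1 - h x2 - A (x1 - x2)) \<le> \<epsilon> * norm (x1 - x2)"
    if e: "\<epsilon> > 0" for \<epsilon>
  proof -
    obtain d where d: "d > 0" "\<And>x1 x2. \<lbrakk>x1 \<noteq> x2; dist (x1, x2) (x, x) < d\<rbrakk>
        \<Longrightarrow> norm ((h x1 - h x2 - A (x1 - x2)) /\<^sub>R norm (x1 - x2)) < \<epsilon>"
      using tendstoD[OF lim e] unfolding eventually_at by (force simp: dist_norm)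
    \<comment> \<open>Half the radius, because the distance of the pair from \<open>(x, x)\<close>
      is at most the sum of the two distances.\<close>
    have "norm (h x1 - h x2 - A (x1 - x2)) \<le> \<epsilon> * norm (x1 - x2)"
      if b: "x1 \<in> ball x (d/2)" "x2 \<in> ball x (d/2)" for x1 x2
    proof (cases "x1 = x2")
      case True then show ?thesis using A by (simp add: linear_simps)
    next
      case False
      have "dist (x1, x2) (x, x) \<le> dist x1 x + dist x2 x"
        by (simp add: dist_Pair_Pair sqrt_sum_squares_le_sum)
      also have "\<dots> < d" using b by (simp add: dist_commute)
      finally have "norm ((h x1 - h x2 - A (x1 - x2)) /\<^sub>R norm (x1 - x2)) < \<epsilon>"
        using d(2) False by blast
      then show ?thesis using False by (simp add: divide_simps)
    qed
    then show ?thesis using d(1) by (intro exI[of _ "d/2"]) auto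
  qed
  then have "strict_derivative h A x" using A unfolding strict_derivative_def by blast
  then show thesis by (rule that)
qed

text \<open>The mean value inequality bounds the linearization error on a ball by the oscillation of
  \<open>F'\<close> there, which continuity at \<open>p\<close> makes small.\<close>

lemma continuous_derivative_imp_strict:
  fixes F' :: "'a::real_normed_vector \<Rightarrow> 'a \<Rightarrow>\<^sub>L 'b::real_normed_vector"
  assumes U: "open U" "p \<in> U" and der: "\<And>q. q \<in> U \<Longrightarrow> (F has_derivative blinfun_apply (F' q)) (at q)"
    and cont: "isCont F' p"
  shows "strict_derivative F (blinfun_apply (F' p)) p"
  unfolding strict_derivative_def
proof (intro conjI allI impI)
  show "bounded_linear (blinfun_apply (F' p))" by (rule blinfun.bounded_linear_right)
  fix \<epsilon> :: real assume "\<epsilon> > 0"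
  then obtain d where d: "d > 0" "\<And>q. dist q p < d \<Longrightarrow> dist (F' q) (F' p) < \<epsilon>"
    using cont unfolding continuous_at_eps_delta by blast
  obtain e where e: "e > 0" "ball p e \<subseteq> U" using U open_contains_ball by blast
  define r where "r = min d e"
  have r: "r > 0" "ball p r \<subseteq> U" "ball p r \<subseteq> ball p d" using d e by (auto simp: r_def)
  have "norm (F x - F x' - F' p (x - x')) \<le> \<epsilon> * norm (x - x')"
    if x: "x \<in> ball p r" "x' \<in> ball p r" for x x'
  proof -
    have "norm (F x - F x' - F' p (x - x')) \<le> norm (x - x') * \<epsilon>"
    proof (rule differentiable_bound_linearization[where S = "ball p r" and f' = "\<lambda>q. blinfun_apply (F' q)"])
      show "x' + t *\<^sub>R (x - x') \<in> ball p r" if "t \<in> {0..1}" for t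
      proof -
        have "(1 - t) *\<^sub>R x' + t *\<^sub>R x \<in> ball p r"
          using convexD[OF convex_ball x(2) x(1)] that by auto
        then show ?thesis by (simp add: algebra_simps)
      qed
      show "(F has_derivative blinfun_apply (F' q)) (at q within ball p r)" if "q \<in> ball p r" for q
        using der r(2) that by (meson has_derivative_at_withinI subsetD)
      show "onorm (blinfun_apply (F' q) - blinfun_apply (F' p)) \<le> \<epsilon>" if "q \<in> ball p r" for q
      proof -
        have "blinfun_apply (F' q) - blinfun_apply (F' p) = blinfun_apply (F' q - F' p)"
          by (auto simp: blinfun.diff_left)
        then show ?thesis using d(2)[of q] subsetD[OF r(3) that]
          by (simp add: norm_blinfun.rep_eq[symmetric] dist_norm[symmetric] dist_commute)
      qed
      show "p \<in> ball p r" using r by simp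
    qed
    then show ?thesis by (simp add: mult.commute)
  qed
  then show "\<exists>r>0. \<forall>x\<in>ball p r. \<forall>x'\<in>ball p r. norm (F x - F x' - F' p (x - x')) \<le> \<epsilon> * norm (x - x')"
    using r(1) by blast
qed

text \<open>The mixed second difference of \<open>F\<close> over the parallelogram with sides
  \<open>t *\<^sub>R h\<close> and \<open>t *\<^sub>R k\<close> is symmetric in \<open>h\<close> and
  \<open>k\<close>, and up to an error of order \<epsilon> t^2 it equals t^2 times either side of
  the claim.\<close>

lemma second_derivative_symmetric:
  fixes F' :: "'a::real_normed_vector \<Rightarrow> 'a \<Rightarrow>\<^sub>L 'b::real_normed_vector"
  assumes U: "open U" "p \<in> U" and der: "\<And>q. q \<in> U \<Longrightarrow> (F has_derivative blinfun_apply (F' q)) (at q)"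
    and F'': "strict_derivative F' F'' p"
  shows "blinfun_apply (F'' h) k = blinfun_apply (F'' k) h"
proof -
  interpret F'': bounded_linear F'' by (rule strict_derivative_bounded_linear[OF F''])
  have key: "\<exists>s>0. \<forall>t. 0 < t \<and> t < s \<longrightarrow>
      norm (F (p + t *\<^sub>R k + t *\<^sub>R h) - F (p + t *\<^sub>R k) - (F (p + t *\<^sub>R h) - F p) - t\<^sup>2 *\<^sub>R F'' h k)
        \<le> \<epsilon> * t\<^sup>2 * (norm h * norm k)" if e: "\<epsilon> > 0" for \<epsilon> and h k :: 'a
  proof -
    obtain r where r: "r > 0"
      "\<And>x x'. \<lbrakk>x \<in> ball p r; x' \<in> ball p r\<rbrakk> \<Longrightarrow> norm (F' x - F' x' - F'' (x - x')) \<le> \<epsilon> * norm (x - x')"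
      using strict_derivativeD[OF F'' e] by blast
    obtain e where e: "e > 0" "ball p e \<subseteq> U" using U open_contains_ball by blast
    define R where "R = min r e"
    have R: "R > 0" "ball p R \<subseteq> ball p r" "ball p R \<subseteq> U" using r e by (auto simp: R_def)
    \<comment> \<open>For \<open>t < s\<close> the whole parallelogram stays in
      \<open>ball p R\<close>.\<close>
    define s where "s = R / (norm h + norm k + 1)"
    have s: "s > 0" using R by (simp add: s_def add_nonneg_pos)
    have "norm (F (p + t *\<^sub>R k + t *\<^sub>R h) - F (p + t *\<^sub>R k) - (F (p + t *\<^sub>R h) - F p) - t\<^sup>2 *\<^sub>R F'' h k)
        \<le> \<epsilon> * t\<^sup>2 * (norm h * norm k)" if t: "0 < t" "t < s" for t
    proof -
      have tR: "t * (norm h + norm k + 1) < R"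
        using t(2) unfolding s_def by (simp add: pos_less_divide_eq add_nonneg_pos)
      \<comment> \<open>With the linear term subtracted, the derivative of \<open>G\<close> is the
        linearization error of \<open>F'\<close> between \<open>x\<close> and
        \<open>x + t *\<^sub>R h\<close>. The mean value inequality along \<open>k\<close> then
        supplies the second factor \<open>t\<close>.\<close>
      define G where "G = (\<lambda>x. F (x + t *\<^sub>R h) - F x - F'' (t *\<^sub>R h) x)"
      define S where "S = closed_segment p (p + t *\<^sub>R k)"
      have S: "q \<in> ball p R" "q + t *\<^sub>R h \<in> ball p R" if "q \<in> S" for q
      proof -
        have "norm (q - p) \<le> t * norm k"
          using that segment_bound(1)[of q p "p + t *\<^sub>R k"] t by (simp add: S_def)
        moreover have "norm (q + t *\<^sub>R h - p) \<le> norm (q - p) + t * norm h"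
          using norm_triangle_ineq[of "q - p" "t *\<^sub>R h"] t by (simp add: algebra_simps)
        moreover have "0 \<le> t * norm h" using t by simp
        moreover have "t * norm h + t * norm k + t < R" using tR by (simp add: distrib_left)
        ultimately show "q \<in> ball p R" "q + t *\<^sub>R h \<in> ball p R"
          using t(1) unfolding mem_ball dist_norm norm_minus_commute[of p] by linarith+
      qed
      have "norm (G (p + t *\<^sub>R k) - G p) \<le> (\<epsilon> * (t * norm h)) * norm (p + t *\<^sub>R k - p)"
      proof (rule differentiable_bound[where S = S and f' = "\<lambda>x. blinfun_apply (F' (x + t *\<^sub>R h) - F' x - F'' (t *\<^sub>R h))"])
        show "convex S" by (simp add: S_def)
        fix x assume x: "x \<in> S"
        have F1: "(F has_derivative blinfun_apply (F' x)) (at x)" using der S(1)[OF x] R(3) by blast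
        have F2: "(F has_derivative blinfun_apply (F' (x + t *\<^sub>R h))) (at (x + t *\<^sub>R h))"
          using der S(2)[OF x] R(3) by blast
        have F3: "((\<lambda>x. F (x + t *\<^sub>R h)) has_derivative blinfun_apply (F' (x + t *\<^sub>R h))) (at x)"
          by (rule has_derivative_compose[of "\<lambda>x. x + t *\<^sub>R h" "\<lambda>x. x" x UNIV, OF _ F2])
             (auto intro!: derivative_eq_intros)
        show "(G has_derivative blinfun_apply (F' (x + t *\<^sub>R h) - F' x - F'' (t *\<^sub>R h))) (at x within S)"
          unfolding G_def
          by (rule has_derivative_at_withinI)
             (auto intro!: derivative_eq_intros F1 F3 simp: blinfun.diff_left)
        have "norm (F' (x + t *\<^sub>R h) - F' x - F'' (x + t *\<^sub>R h - x)) \<le> \<epsilon> * norm (x + t *\<^sub>R h - x)"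
          using r(2) S[OF x] R(2) by blast
        then show "onorm (blinfun_apply (F' (x + t *\<^sub>R h) - F' x - F'' (t *\<^sub>R h))) \<le> \<epsilon> * (t * norm h)"
          using t by (simp add: norm_blinfun.rep_eq)
      qed (auto simp: S_def)
      moreover have "G (p + t *\<^sub>R k) - G p = F (p + t *\<^sub>R k + t *\<^sub>R h) - F (p + t *\<^sub>R k) - (F (p + t *\<^sub>R h) - F p) - t\<^sup>2 *\<^sub>R F'' h k"
        by (simp add: G_def F''.scaleR blinfun.scaleR_left blinfun.scaleR_right blinfun.add_right power2_eq_square algebra_simps)
      ultimately show ?thesis using t by (simp add: power2_eq_square ac_simps)
    qed
    then show ?thesis using s by blast
  qed
  have "norm (F'' h k - F'' k h) \<le> 2 * (norm h * norm k) * \<epsilon>" if e: "\<epsilon> > 0" for \<epsilon>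
  proof -
    obtain s1 s2 where s: "s1 > 0" "s2 > 0" 
      and b1: "\<And>t. 0 < t \<Longrightarrow> t < s1 \<Longrightarrow>
      norm (F (p + t *\<^sub>R k + t *\<^sub>R h) - F (p + t *\<^sub>R k) - (F (p + t *\<^sub>R h) - F p) - t\<^sup>2 *\<^sub>R F'' h k)
        \<le> \<epsilon> * t\<^sup>2 * (norm h * norm k)"
      and b2: "\<And>t. 0 < t \<Longrightarrow> t < s2 \<Longrightarrow>
      norm (F (p + t *\<^sub>R h + t *\<^sub>R k) - F (p + t *\<^sub>R h) - (F (p + t *\<^sub>R k) - F p) - t\<^sup>2 *\<^sub>R F'' k h)
        \<le> \<epsilon> * t\<^sup>2 * (norm k * norm h)"
      using key[OF e, of k h] key[OF e, of h k] by metis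
    define t where "t = min s1 s2 / 2"
    have t: "0 < t" "t < s1" "t < s2" using s by (auto simp: t_def)
    have "t\<^sup>2 *\<^sub>R (F'' h k - F'' k h) = 
       (F (p + t *\<^sub>R h + t *\<^sub>R k) - F (p + t *\<^sub>R h) - (F (p + t *\<^sub>R k) - F p) - t\<^sup>2 *\<^sub>R F'' k h)
      - (F (p + t *\<^sub>R k + t *\<^sub>R h) - F (p + t *\<^sub>R k) - (F (p + t *\<^sub>R h) - F p) - t\<^sup>2 *\<^sub>R F'' h k)"
      by (simp add: algebra_simps)
    then have "norm (t\<^sup>2 *\<^sub>R (F'' h k - F'' k h)) \<le> \<epsilon> * t\<^sup>2 * (norm k * norm h) + \<epsilon> * t\<^sup>2 * (norm h * norm k)"
      using b1[OF t(1,2)] b2[OF t(1,3)] norm_triangle_ineq4 by (smt (verit))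
    also have "\<dots> = t\<^sup>2 * (2 * (norm h * norm k) * \<epsilon>)" by (simp add: algebra_simps)
    finally have "t\<^sup>2 * norm (F'' h k - F'' k h) \<le> t\<^sup>2 * (2 * (norm h * norm k) * \<epsilon>)" by simp
    then show ?thesis using t by (simp add: mult_le_cancel_left)
  qed
  then have "norm (F'' h k - F'' k h) \<le> 0"
  proof -
    assume *: "\<And>\<epsilon>. \<epsilon> > 0 \<Longrightarrow> norm (F'' h k - F'' k h) \<le> 2 * (norm h * norm k) * \<epsilon>"
    have "norm (F'' h k - F'' k h) \<le> 0 + e" if "e > 0" for e
    proof -
      define c where "c = 2 * (norm h * norm k) + 1"
      have c: "c > 0" by (simp add: c_def add_nonneg_pos)
      have "norm (F'' h k - F'' k h) \<le> (c - 1) * (e / c)"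
        using *[of "e / c"] c that by (simp add: c_def)
      also have "\<dots> \<le> c * (e / c)" using c that by (intro mult_right_mono) auto
      finally show ?thesis using c by simp
    qed
    then show ?thesis by (rule field_le_epsilon)
  qed
  then show ?thesis by simp
qed

section \<open>Calculus rules for strict derivatives\<close>

lemma strict_derivative_of_linear: "bounded_linear T \<Longrightarrow> strict_derivative T T p"
  unfolding strict_derivative_def by (auto simp: linear_simps intro!: exI[of _ 1])

lemma strict_derivative_affine_compose:
  assumes F: "strict_derivative F T (g p)" and G: "bounded_linear G" and g: "\<And>x x'. g x - g x' = G (x - x')"
  shows "strict_derivative (\<lambda>x. F (g x)) (\<lambda>h. T (G h)) p"
  unfolding strict_derivative_def
proof (intro conjI allI impI)
  show "bounded_linear (\<lambda>h. T (G h))"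
    by (rule bounded_linear_compose[OF strict_derivative_bounded_linear[OF F] G])
  obtain K where K: "K > 0" "\<And>h. norm (G h) \<le> norm h * K" using bounded_linear.pos_bounded[OF G] by blast
  fix \<epsilon> :: real assume "\<epsilon> > 0"
  then have "\<epsilon> / K > 0" using K(1) by simp
  then obtain r where r: "r > 0" "\<And>x x'. \<lbrakk>x \<in> ball (g p) r; x' \<in> ball (g p) r\<rbrakk>
      \<Longrightarrow> norm (F x - F x' - T (x - x')) \<le> \<epsilon> / K * norm (x - x')"
    using strict_derivativeD[OF F] by blast
  have "norm (F (g x) - F (g x') - T (G (x - x'))) \<le> \<epsilon> * norm (x - x')"
    if x: "x \<in> ball p (r / K)" "x' \<in> ball p (r / K)" for x x'
  proof -
    have b: "g y \<in> ball (g p) r" if "y \<in> ball p (r / K)" for y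
    proof -
      have "norm (g p - g y) \<le> norm (p - y) * K" unfolding g by (rule K(2))
      also have "\<dots> < r" using that K(1) by (simp add: dist_norm pos_less_divide_eq)
      finally show ?thesis by (simp add: dist_norm)
    qed
    have "norm (F (g x) - F (g x') - T (G (x - x'))) \<le> \<epsilon> / K * norm (g x - g x')"
      using r(2)[OF b[OF x(1)] b[OF x(2)]] by (simp add: g)
    also have "\<dots> \<le> \<epsilon> / K * (norm (x - x') * K)"
      unfolding g using \<open>\<epsilon> / K > 0\<close> by (intro mult_left_mono K(2)) simp
    also have "\<dots> = \<epsilon> * norm (x - x')" using K(1) by simp
    finally show ?thesis .
  qed
  then show "\<exists>r>0. \<forall>x\<in>ball p r. \<forall>x'\<in>ball p r.
      norm (F (g x) - F (g x') - T (G (x - x'))) \<le> \<epsilon> * norm (x - x')"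
    using r(1) K(1) by (intro exI[of _ "r / K"]) auto
qed

lemma strict_derivative_add:
  assumes F: "strict_derivative F T p" and G: "strict_derivative G U p"
  shows "strict_derivative (\<lambda>x. F x + G x) (\<lambda>h. T h + U h) p"
  unfolding strict_derivative_def
proof (intro conjI allI impI)
  show "bounded_linear (\<lambda>h. T h + U h)"
    by (rule bounded_linear_add[OF strict_derivative_bounded_linear[OF F] strict_derivative_bounded_linear[OF G]])
  fix \<epsilon> :: real assume "\<epsilon> > 0"
  then have e: "\<epsilon> / 2 > 0" by simp
  obtain r where r: "r > 0" "\<And>x x'. \<lbrakk>x \<in> ball p r; x' \<in> ball p r\<rbrakk> \<Longrightarrow> norm (F x - F x' - T (x - x')) \<le> \<epsilon> / 2 * norm (x - x')"
    by (rule strict_derivativeD[OF F e]) (rule that)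
  obtain s where s: "s > 0" "\<And>x x'. \<lbrakk>x \<in> ball p s; x' \<in> ball p s\<rbrakk> \<Longrightarrow> norm (G x - G x' - U (x - x')) \<le> \<epsilon> / 2 * norm (x - x')"
    by (rule strict_derivativeD[OF G e]) (rule that)
  have "norm (F x + G x - (F x' + G x') - (T (x - x') + U (x - x'))) \<le> \<epsilon> * norm (x - x')"
    if x: "x \<in> ball p (min r s)" "x' \<in> ball p (min r s)" for x x'
  proof -
    have eq: "F x + G x - (F x' + G x') - (T (x - x') + U (x - x')) =
        (F x - F x' - T (x - x')) + (G x - G x' - U (x - x'))" by simp
    have 1: "norm (F x - F x' - T (x - x')) \<le> \<epsilon> / 2 * norm (x - x')"
      by (rule r(2)) (use x in auto)
    have 2: "norm (G x - G x' - U (x - x')) \<le> \<epsilon> / 2 * norm (x - x')"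
      by (rule s(2)) (use x in auto)
    show ?thesis
      unfolding eq using norm_triangle_ineq[of "F x - F x' - T (x - x')" "G x - G x' - U (x - x')"] 1 2
      by linarith
  qed
  then show "\<exists>r>0. \<forall>x\<in>ball p r. \<forall>x'\<in>ball p r.
      norm (F x + G x - (F x' + G x') - (T (x - x') + U (x - x'))) \<le> \<epsilon> * norm (x - x')"
    using r(1) s(1) by (intro exI[of _ "min r s"]) auto
qed

lemma strict_derivative_bilinear:
  assumes b: "bounded_bilinear b" and F: "strict_derivative F T p" and G: "strict_derivative G U p"
  shows "strict_derivative (\<lambda>x. b (F x) (G x)) (\<lambda>h. b (F p) (U h) + b (T h) (G p)) p"
  unfolding strict_derivative_def
proof (intro conjI allI impI)
  interpret b: bounded_bilinear b by (rule b)
  note linT = strict_derivative_bounded_linear[OF F] and linU = strict_derivative_bounded_linear[OF G]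
  show "bounded_linear (\<lambda>h. b (F p) (U h) + b (T h) (G p))"
    by (intro bounded_linear_add bounded_linear_compose[OF b.bounded_linear_right linU]
        bounded_linear_compose[OF b.bounded_linear_left linT])
  obtain K where K: "K > 0" "\<And>u v. norm (b u v) \<le> norm u * norm v * K" using b.pos_bounded by blast
  obtain KT where KT: "KT > 0" "\<And>h. norm (T h) \<le> norm h * KT" using bounded_linear.pos_bounded[OF linT] by blast
  obtain r1 LF where r1: "r1 > 0" and LF: "LF > 0"
    and lipF: "\<And>x x'. \<lbrakk>x \<in> ball p r1; x' \<in> ball p r1\<rbrakk> \<Longrightarrow> norm (F x - F x') \<le> LF * norm (x - x')"
    by (rule strict_derivative_lipschitz[OF F]) (rule that)
  obtain r2 LG where r2: "r2 > 0" and LG: "LG > 0"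
    and lipG: "\<And>x x'. \<lbrakk>x \<in> ball p r2; x' \<in> ball p r2\<rbrakk> \<Longrightarrow> norm (G x - G x') \<le> LG * norm (x - x')"
    by (rule strict_derivative_lipschitz[OF G]) (rule that)
  fix \<epsilon> :: real assume e: "\<epsilon> > 0"
  \<comment> \<open>\<open>P - K\<close> is the sum of the coefficients of the four error terms
    below; the additional \<open>K\<close> keeps \<open>P\<close> positive.\<close>
  define P where "P = K * ((norm (G p) + LG) + KT * LG + LF * LG + norm (F p) + 1)"
  have P: "P > 0" unfolding P_def using K(1) KT(1) LF LG by (intro mult_pos_pos add_nonneg_pos add_nonneg_nonneg) auto
  define \<epsilon>1 where "\<epsilon>1 = \<epsilon> / P"
  have e1: "\<epsilon>1 > 0" "\<epsilon>1 * P = \<epsilon>" using e P by (simp_all add: \<epsilon>1_def)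
  obtain r3 where r3: "r3 > 0" "\<And>x x'. \<lbrakk>x \<in> ball p r3; x' \<in> ball p r3\<rbrakk> \<Longrightarrow> norm (F x - F x' - T (x - x')) \<le> \<epsilon>1 * norm (x - x')"
    by (rule strict_derivativeD[OF F e1(1)]) (rule that)
  obtain r4 where r4: "r4 > 0" "\<And>x x'. \<lbrakk>x \<in> ball p r4; x' \<in> ball p r4\<rbrakk> \<Longrightarrow> norm (G x - G x' - U (x - x')) \<le> \<epsilon>1 * norm (x - x')"
    by (rule strict_derivativeD[OF G e1(1)]) (rule that)
  define r where "r = min (min (min r1 r2) (min r3 r4)) (min 1 \<epsilon>1)"
  have r: "r > 0" "r \<le> 1" "r \<le> \<epsilon>1" using r1 r2 r3(1) r4(1) e1 by (auto simp: r_def)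
  have rb: "y \<in> ball p r1" "y \<in> ball p r2" "y \<in> ball p r3" "y \<in> ball p r4" if "y \<in> ball p r" for y
    using that by (auto simp: r_def)
  have "norm (b (F x) (G x) - b (F x') (G x') - (b (F p) (U (x - x')) + b (T (x - x')) (G p))) \<le> \<epsilon> * norm (x - x')"
    if x: "x \<in> ball p r" "x' \<in> ball p r" for x x'
  proof -
    define N where "N = norm (x - x')"
    have N: "N \<ge> 0" by (simp add: N_def)
    have pb: "p \<in> ball p r1" "p \<in> ball p r2" using r1 r2 by auto
    have xp: "norm (x - p) \<le> \<epsilon>1" "norm (x - p) \<le> 1" "norm (x' - p) \<le> \<epsilon>1"
      using x r by (auto simp: dist_norm norm_minus_commute)
    have Gp: "norm (G x - G p) \<le> LG * norm (x - p)" by (rule lipG[OF rb(2)[OF x(1)] pb(2)])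
    have Gp1: "norm (G x - G p) \<le> LG * \<epsilon>1" using mult_left_mono[OF xp(1) less_imp_le[OF LG]] Gp by linarith
    have Gp2: "norm (G x - G p) \<le> LG" using mult_left_mono[OF xp(2) less_imp_le[OF LG]] Gp by linarith
    have Gx: "norm (G x) \<le> norm (G p) + LG"
      using Gp2 norm_triangle_ineq[of "G p" "G x - G p"] by simp
    have Fp: "norm (F x' - F p) \<le> LF * \<epsilon>1"
      using lipF[OF rb(1)[OF x(2)] pb(1)] mult_left_mono[OF xp(3) less_imp_le[OF LF]] by linarith
    have t1: "norm (b (F x - F x' - T (x - x')) (G x)) \<le> (\<epsilon>1 * N) * (norm (G p) + LG) * K"
      by (rule order_trans[OF K(2)], intro mult_right_mono mult_mono)
         (use r3(2)[OF rb(3)[OF x(1)] rb(3)[OF x(2)]] Gx K(1) e1 N in \<open>auto simp: N_def\<close>)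
    have t2: "norm (b (T (x - x')) (G x - G p)) \<le> (N * KT) * (LG * \<epsilon>1) * K"
      by (rule order_trans[OF K(2)], intro mult_right_mono mult_mono)
         (use KT(2)[of "x - x'"] KT(1) Gp1 K(1) N in \<open>auto simp: N_def\<close>)
    have t3: "norm (b (F x' - F p) (G x - G x')) \<le> (LF * \<epsilon>1) * (LG * N) * K"
      by (rule order_trans[OF K(2)], intro mult_right_mono mult_mono)
         (use Fp lipG[OF rb(2)[OF x(1)] rb(2)[OF x(2)]] LF e1 K(1) in \<open>auto simp: N_def\<close>)
    have t4: "norm (b (F p) (G x - G x' - U (x - x'))) \<le> norm (F p) * (\<epsilon>1 * N) * K"
      by (rule order_trans[OF K(2)], intro mult_right_mono mult_mono)
         (use r4(2)[OF rb(4)[OF x(1)] rb(4)[OF x(2)]] K(1) in \<open>auto simp: N_def\<close>)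
    \<comment> \<open>The first and the last term contain the linearization errors of
      \<open>F\<close> and \<open>G\<close>; each of the middle two has a factor that is small
      because \<open>x\<close> and \<open>x'\<close> lie within \<open>\<epsilon>1\<close> of
      \<open>p\<close>.\<close>
    have "b (F x) (G x) - b (F x') (G x') - (b (F p) (U (x - x')) + b (T (x - x')) (G p)) =
        b (F x - F x' - T (x - x')) (G x) + b (T (x - x')) (G x - G p)
        + b (F x' - F p) (G x - G x') + b (F p) (G x - G x' - U (x - x'))"
      by (simp add: b.diff_left b.diff_right)
    then have "norm (b (F x) (G x) - b (F x') (G x') - (b (F p) (U (x - x')) + b (T (x - x')) (G p))) \<le>
        (\<epsilon>1 * N) * (norm (G p) + LG) * K + (N * KT) * (LG * \<epsilon>1) * K + (LF * \<epsilon>1) * (LG * N) * K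
        + norm (F p) * (\<epsilon>1 * N) * K"
      using norm_add_rule_thm[OF norm_add_rule_thm[OF norm_add_rule_thm[OF t1 t2] t3] t4] by simp
    also have "\<dots> = \<epsilon>1 * N * (P - K)" by (simp add: P_def algebra_simps)
    also have "\<dots> \<le> \<epsilon>1 * N * P" using K(1) e1 N by (intro mult_left_mono) auto
    also have "\<dots> = \<epsilon> * N" using e1(2) by (simp add: ac_simps)
    finally show ?thesis by (simp add: N_def)
  qed
  then show "\<exists>r>0. \<forall>x\<in>ball p r. \<forall>x'\<in>ball p r.
      norm (b (F x) (G x) - b (F x') (G x') - (b (F p) (U (x - x')) + b (T (x - x')) (G p))) \<le> \<epsilon> * norm (x - x')"
    using r(1) by blast
qed

lemma strict_derivative_Pair:
  assumes F: "strict_derivative F T p" and G: "strict_derivative G U p"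
  shows "strict_derivative (\<lambda>x. (F x, G x)) (\<lambda>h. (T h, U h)) p"
  unfolding strict_derivative_def
proof (intro conjI allI impI)
  show "bounded_linear (\<lambda>h. (T h, U h))"
    by (rule bounded_linear_Pair[OF strict_derivative_bounded_linear[OF F] strict_derivative_bounded_linear[OF G]])
  fix \<epsilon> :: real assume "\<epsilon> > 0"
  then have e: "\<epsilon> / 2 > 0" by simp
  obtain r where r: "r > 0" "\<And>x x'. \<lbrakk>x \<in> ball p r; x' \<in> ball p r\<rbrakk> \<Longrightarrow> norm (F x - F x' - T (x - x')) \<le> \<epsilon> / 2 * norm (x - x')"
    by (rule strict_derivativeD[OF F e]) (rule that)
  obtain s where s: "s > 0" "\<And>x x'. \<lbrakk>x \<in> ball p s; x' \<in> ball p s\<rbrakk> \<Longrightarrow> norm (G x - G x' - U (x - x')) \<le> \<epsilon> / 2 * norm (x - x')"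
    by (rule strict_derivativeD[OF G e]) (rule that)
  have "norm ((F x, G x) - (F x', G x') - (T (x - x'), U (x - x'))) \<le> \<epsilon> * norm (x - x')"
    if x: "x \<in> ball p (min r s)" "x' \<in> ball p (min r s)" for x x'
  proof -
    have 1: "norm (F x - F x' - T (x - x')) \<le> \<epsilon> / 2 * norm (x - x')"
      by (rule r(2)) (use x in auto)
    have 2: "norm (G x - G x' - U (x - x')) \<le> \<epsilon> / 2 * norm (x - x')"
      by (rule s(2)) (use x in auto)
    show ?thesis using 1 2 norm_Pair_le_add[of "F x - F x' - T (x - x')" "G x - G x' - U (x - x')"]
      by simp
  qed
  then show "\<exists>r>0. \<forall>x\<in>ball p r. \<forall>x'\<in>ball p r.
      norm ((F x, G x) - (F x', G x') - (T (x - x'), U (x - x'))) \<le> \<epsilon> * norm (x - x')"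
    using r(1) s(1) by (intro exI[of _ "min r s"]) auto
qed

section \<open>Adjoints and partial derivatives\<close>

lemma norm_adjoint_blinfun_le:
  fixes X :: "'a::euclidean_space \<Rightarrow>\<^sub>L 'b::euclidean_space"
  shows "norm (adjoint (blinfun_apply X) y) \<le> norm X * norm y"
proof (cases "adjoint (blinfun_apply X) y = 0")
  case False
  define w where "w = adjoint (blinfun_apply X) y"
  have "w \<bullet> w = blinfun_apply X w \<bullet> y"
    unfolding w_def by (rule adjoint_works) (simp add: blinfun.bounded_linear_right bounded_linear.linear)
  also have "\<dots> \<le> norm (blinfun_apply X w) * norm y" by (rule norm_cauchy_schwarz)
  also have "\<dots> \<le> norm X * norm w * norm y" by (intro mult_right_mono norm_blinfun) simp
  finally have "norm w * norm w \<le> (norm X * norm y) * norm w"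
    by (simp add: power2_norm_eq_inner[symmetric] power2_eq_square ac_simps)
  then show ?thesis using False by (simp add: w_def)
qed simp

text \<open>This lets the product rule differentiate \<open>adjoint (D x) y\<close> jointly in
  \<open>x\<close> and \<open>y\<close>.\<close>

lemma bounded_bilinear_adjoint:
  "bounded_bilinear (\<lambda>(X :: 'a::euclidean_space \<Rightarrow>\<^sub>L 'b::euclidean_space) y. adjoint (blinfun_apply X) y)"
proof
  fix X X' :: "'a \<Rightarrow>\<^sub>L 'b" and y y' and r :: real
  have adj: "x \<bullet> adjoint (blinfun_apply X) y = X x \<bullet> y" for X :: "'a \<Rightarrow>\<^sub>L 'b" and x y
    by (rule adjoint_works) (simp add: blinfun.bounded_linear_right bounded_linear.linear)
  show "adjoint (X + X') y = adjoint X y + adjoint X' y"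
    by (rule vector_eq_ldot[THEN iffD1]) (simp add: adj inner_add_right blinfun.add_left inner_add_left)
  show "adjoint X (y + y') = adjoint X y + adjoint X y'"
    by (rule vector_eq_ldot[THEN iffD1]) (simp add: adj inner_add_right)
  show "adjoint (r *\<^sub>R X) y = r *\<^sub>R adjoint X y"
    by (rule vector_eq_ldot[THEN iffD1]) (simp add: adj blinfun.scaleR_left)
  show "adjoint X (r *\<^sub>R y) = r *\<^sub>R adjoint X y"
    by (rule vector_eq_ldot[THEN iffD1]) (simp add: adj)
  show "\<exists>K. \<forall>(X :: 'a \<Rightarrow>\<^sub>L 'b) y. norm (adjoint (blinfun_apply X) y) \<le> norm X * norm y * K"
    by (rule exI[of _ 1]) (simp add: norm_adjoint_blinfun_le)
qed

text \<open>Two different demands are met: a strict derivative \<open>D x\<close> at every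
  \<open>x\<close> of a ball, because the first-order chain rule is applied at all these points, and
  a strict derivative \<open>H\<close> of \<open>D\<close> at \<open>xbar\<close> alone, for the
  second-order term.\<close>

lemma C2_around_partial:
  fixes \<Phi> :: "('a::real_normed_vector \<times> 'c::real_normed_vector) \<Rightarrow> 'b::real_normed_vector"
  assumes "C2_around \<Phi> (xbar, w)"
  obtains \<rho> D H where "\<rho> > 0"
    "\<And>x. x \<in> ball xbar \<rho> \<Longrightarrow> strict_derivative (\<lambda>x. \<Phi> (x, w)) (blinfun_apply (D x)) x"
    "strict_derivative D H xbar" "\<And>h k. blinfun_apply (H h) k = blinfun_apply (H k) h"
proof -
  obtain U F' F'' where U: "open U" "(xbar, w) \<in> U"
    and F': "\<And>q. q \<in> U \<Longrightarrow> (\<Phi> has_derivative blinfun_apply (F' q)) (at q)"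
    and F'': "\<And>q. q \<in> U \<Longrightarrow> (F' has_derivative blinfun_apply (F'' q)) (at q)" and cont: "continuous_on U F''"
    using assms unfolding C2_around_def by blast
  have s1: "strict_derivative \<Phi> (blinfun_apply (F' q)) q" if "q \<in> U" for q
    using F' U(1) that has_derivative_continuous[OF F''[OF that]] by (intro continuous_derivative_imp_strict)
  have s2: "strict_derivative F' (blinfun_apply (F'' (xbar, w))) (xbar, w)"
    using F'' U cont by (intro continuous_derivative_imp_strict) (auto simp: continuous_on_eq_continuous_at)
  have G: "bounded_linear (\<lambda>h :: 'a. (h, 0 :: 'c))"
    by (intro bounded_linear_Pair bounded_linear_ident bounded_linear_zero)
  define E where "E = Blinfun (\<lambda>h :: 'a. (h, 0 :: 'c))"
  have E: "blinfun_apply E h = (h, 0)" for h unfolding E_def by (simp add: bounded_linear_Blinfun_apply[OF G])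
  obtain \<rho> where \<rho>: "\<rho> > 0" "ball (xbar, w) \<rho> \<subseteq> U" using U open_contains_ball by blast
  have inU: "(x, w) \<in> U" if "x \<in> ball xbar \<rho>" for x
    using that \<rho>(2) by (auto simp: dist_Pair_Pair)
  define D where "D = (\<lambda>x. F' (x, w) o\<^sub>L E)"
  define H where "H = (\<lambda>h. blinfun_apply (F'' (xbar, w)) (h, 0) o\<^sub>L E)"
  have "strict_derivative (\<lambda>x. \<Phi> (x, w)) (blinfun_apply (D x)) x" if "x \<in> ball xbar \<rho>" for x
    using strict_derivative_affine_compose[of \<Phi> _ "\<lambda>x. (x, w)" x, OF s1[OF inU[OF that]] G]
    by (simp add: D_def E[abs_def] blinfun_compose.rep_eq comp_def)
  moreover have "strict_derivative D H xbar"
  proof -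
    have "strict_derivative (\<lambda>x. F' (x, w)) (\<lambda>h. blinfun_apply (F'' (xbar, w)) (h, 0)) xbar"
      by (rule strict_derivative_affine_compose[of F' _ "\<lambda>x. (x, w)" xbar, OF s2 G]) simp
    moreover have "strict_derivative (\<lambda>_. E) (\<lambda>_. 0) xbar"
      unfolding strict_derivative_def by (auto intro: exI[of _ 1])
    ultimately show ?thesis
      using strict_derivative_bilinear[OF bounded_bilinear_blinfun_compose, of "\<lambda>x. F' (x, w)" _ xbar "\<lambda>_. E" "\<lambda>_. 0"]
      by (simp add: D_def H_def blinfun_compose_zero)
  qed
  moreover have "blinfun_apply (H h) k = blinfun_apply (H k) h" for h k
    using second_derivative_symmetric[OF U F' s2, of "(h, 0)" "(k, 0)"] by (simp add: H_def E)
  ultimately show thesis using that \<rho>(1) by blast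
qed

section \<open>Limiting normals as limits of approximate normals\<close>

text \<open>The vector \<open>n\<close> is the same for all base points, and one \<epsilon> bounds
  both the distance of the base point and the slope. Convergence of normals is thus traded for an
  error in the slope.\<close>

definition approx_normal_cone :: "'a::real_inner set \<Rightarrow> 'a \<Rightarrow> 'a set" where
  "approx_normal_cone \<Omega> q = {n. \<forall>\<epsilon>>0. \<exists>p\<in>\<Omega>. dist p q < \<epsilon> \<and>
     (\<exists>\<delta>>0. \<forall>p'\<in>\<Omega>. dist p' p < \<delta> \<longrightarrow> n \<bullet> (p' - p) \<le> \<epsilon> * norm (p' - p))}"

lemma approx_normal_coneD:
  assumes "n \<in> approx_normal_cone \<Omega> q" "\<epsilon> > 0"
  obtains p \<delta> where "p \<in> \<Omega>" "dist p q < \<epsilon>" "\<delta> > 0"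
    "\<And>p'. \<lbrakk>p' \<in> \<Omega>; dist p' p < \<delta>\<rbrakk> \<Longrightarrow> n \<bullet> (p' - p) \<le> \<epsilon> * norm (p' - p)"
  using assms unfolding approx_normal_cone_def by blast

lemma regular_normal_cone_iff:
  "v \<in> regular_normal_cone \<Omega> q \<longleftrightarrow>
     (\<forall>\<epsilon>>0. \<exists>\<delta>>0. \<forall>q'\<in>\<Omega>. dist q' q < \<delta> \<longrightarrow> v \<bullet> (q' - q) \<le> \<epsilon> * norm (q' - q))"
  (is "_ \<longleftrightarrow> ?R")
proof
  assume "v \<in> regular_normal_cone \<Omega> q"
  then have L: "Limsup (at q within \<Omega>) (\<lambda>q'. ereal (v \<bullet> (q' - q) / norm (q' - q))) \<le> 0"
    by (simp add: regular_normal_cone_def)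
  show ?R
  proof (intro allI impI)
    fix \<epsilon> :: real assume "\<epsilon> > 0"
    then have "\<forall>\<^sub>F q' in at q within \<Omega>. ereal (v \<bullet> (q' - q) / norm (q' - q)) < ereal \<epsilon>"
      using L unfolding Limsup_le_iff by (metis ereal_less(2))
    then obtain \<delta> where "\<delta> > 0"
      "\<forall>q'\<in>\<Omega>. q' \<noteq> q \<and> dist q' q < \<delta> \<longrightarrow> v \<bullet> (q' - q) / norm (q' - q) < \<epsilon>"
      unfolding eventually_at by auto
    then show "\<exists>\<delta>>0. \<forall>q'\<in>\<Omega>. dist q' q < \<delta> \<longrightarrow> v \<bullet> (q' - q) \<le> \<epsilon> * norm (q' - q)"
      by (intro exI[of _ \<delta>]) (force simp: divide_simps)
  qed
next
  assume R: ?R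
  have "Limsup (at q within \<Omega>) (\<lambda>q'. ereal (v \<bullet> (q' - q) / norm (q' - q))) \<le> 0"
    unfolding Limsup_le_iff
  proof (intro allI impI)
    fix y :: ereal assume "y > 0"
    then obtain e where e: "e > 0" "ereal e < y"
      by (metis ereal_dense2 ereal_less(2) less_ereal.simps(1) zero_ereal_def)
    then obtain \<delta> where "\<delta> > 0" "\<forall>q'\<in>\<Omega>. dist q' q < \<delta> \<longrightarrow> v \<bullet> (q' - q) \<le> e * norm (q' - q)"
      using R by blast
    then have "\<forall>\<^sub>F q' in at q within \<Omega>. v \<bullet> (q' - q) / norm (q' - q) \<le> e"
      unfolding eventually_at by (intro exI[of _ \<delta>]) (force simp: divide_simps)
    then show "\<forall>\<^sub>F q' in at q within \<Omega>. ereal (v \<bullet> (q' - q) / norm (q' - q)) < y"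
      by (rule eventually_mono) (use e in \<open>metis ereal_less_eq(3) le_less_trans\<close>)
  qed
  then show "v \<in> regular_normal_cone \<Omega> q"
    by (simp add: regular_normal_cone_def)
qed

text \<open>By Cauchy-Schwarz, replacing a nearby regular normal \<open>V k\<close> by its limit
  \<open>v\<close> costs at most \<open>norm (v - V k)\<close> in the slope.\<close>

lemma limiting_subset_approx_normal_cone: "limiting_normal_cone \<Omega> q \<subseteq> approx_normal_cone \<Omega> q"
proof
  fix v assume "v \<in> limiting_normal_cone \<Omega> q"
  then obtain Q V where Q: "\<And>k. Q k \<in> \<Omega>" and V: "\<And>k. V k \<in> regular_normal_cone \<Omega> (Q k)"
    and lim: "Q \<longlonglongrightarrow> q" "V \<longlonglongrightarrow> v"
    unfolding limiting_normal_cone_def by blast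
  show "v \<in> approx_normal_cone \<Omega> q"
    unfolding approx_normal_cone_def
  proof (intro CollectI allI impI)
    fix \<epsilon> :: real assume e: "\<epsilon> > 0"
    have "\<forall>\<^sub>F k in sequentially. dist (Q k) q < \<epsilon> \<and> dist (V k) v < \<epsilon> / 2"
      using lim e by (intro eventually_conj tendstoD) auto
    then obtain k where k: "dist (Q k) q < \<epsilon>" "dist (V k) v < \<epsilon> / 2"
      by (auto simp: eventually_sequentially)
    obtain \<delta> where d: "\<delta> > 0"
      "\<And>q'. \<lbrakk>q' \<in> \<Omega>; dist q' (Q k) < \<delta>\<rbrakk> \<Longrightarrow> V k \<bullet> (q' - Q k) \<le> \<epsilon> / 2 * norm (q' - Q k)"
      using V[of k] e unfolding regular_normal_cone_iff by (meson half_gt_zero)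
    have "v \<bullet> (q' - Q k) \<le> \<epsilon> * norm (q' - Q k)" if "q' \<in> \<Omega>" "dist q' (Q k) < \<delta>" for q'
    proof -
      have "(v - V k) \<bullet> (q' - Q k) \<le> norm (v - V k) * norm (q' - Q k)"
        by (rule norm_cauchy_schwarz)
      also have "\<dots> \<le> \<epsilon> / 2 * norm (q' - Q k)"
        using k(2) by (intro mult_right_mono) (auto simp: dist_norm norm_minus_commute)
      finally show ?thesis using d(2)[OF that] by (simp add: inner_diff_left)
    qed
    then show "\<exists>p\<in>\<Omega>. dist p q < \<epsilon> \<and>
       (\<exists>\<delta>>0. \<forall>p'\<in>\<Omega>. dist p' p < \<delta> \<longrightarrow> v \<bullet> (p' - p) \<le> \<epsilon> * norm (p' - p))"
      using Q[of k] k(1) d(1) by blast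
  qed
qed

text \<open>An approximate normal \<open>n\<close> at \<open>p\<close> is turned into a regular one at a nearby point by projecting
  \<open>p + t *\<^sub>R n\<close> onto \<open>\<Omega>\<close> for small \<open>t\<close>.\<close>

lemma approx_normal_near_regular:
  fixes \<Omega> :: "'a::euclidean_space set"
  assumes cl: "closed (\<Omega> \<inter> cball q r)" and p: "p \<in> \<Omega>" "dist p q < r"
    and e: "\<epsilon> > 0" and d: "\<delta> > 0" and n: "\<And>p'. \<lbrakk>p' \<in> \<Omega>; dist p' p < \<delta>\<rbrakk> \<Longrightarrow> n \<bullet> (p' - p) \<le> \<epsilon> * norm (p' - p)"
  obtains p' v where "p' \<in> \<Omega>" "dist p' p < \<epsilon>" "v \<in> regular_normal_cone \<Omega> p'" "norm (v - n) \<le> 2 * \<epsilon>"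
proof -
  define m where "m = min \<epsilon> (min \<delta> (r - dist p q))"
  have m: "m > 0" using e d p by (simp add: m_def)
  \<comment> \<open>Makes \<open>2 * (t * norm n)\<close> smaller than \<open>m\<close>, which
    bounds the distance of the projection \<open>p'\<close> from \<open>p\<close>.\<close>
  define t where "t = m / (2 * (norm n + 1))"
  have c: "norm n + 1 > 0" by (simp add: add_nonneg_pos)
  have t: "t > 0" using m c by (simp add: t_def)
  have "t * norm n < t * (norm n + 1)" using t by simp
  also have "\<dots> = m / 2" using c by (simp add: t_def divide_simps)
  finally have tn: "2 * (t * norm n) < m" by simp
  define x where "x = p + t *\<^sub>R n"
  have ne: "\<Omega> \<inter> cball q r \<noteq> {}" using p by (auto simp: dist_commute)
  obtain p' where p': "p' \<in> \<Omega>" "dist q p' \<le> r" "\<And>y. \<lbrakk>y \<in> \<Omega>; dist q y \<le> r\<rbrakk> \<Longrightarrow> dist x p' \<le> dist x y"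
    using distance_attains_inf[OF cl ne, of x] by (metis IntE IntI mem_cball)
  \<comment> \<open>The projection residual divided by \<open>t\<close>, as for proximal normals;
    its distance from \<open>n\<close> is \<open>norm (p' - p) / t\<close>.\<close>
  define v where "v = (x - p') /\<^sub>R t"
  have "dist x p' \<le> dist x p" using p'(3)[of p] p by (simp add: dist_commute)
  then have xp: "norm (x - p') \<le> t * norm n" using t by (simp add: dist_norm x_def)
  have "p' - p = t *\<^sub>R n - (x - p')" by (simp add: x_def)
  then have "norm (p' - p) \<le> norm (t *\<^sub>R n) + norm (x - p')"
    by (simp only: norm_triangle_ineq4)
  then have near: "norm (p' - p) < m" using xp t tn by simp
  then have pp: "dist p' p < m" by (simp add: dist_norm)
  \<comment> \<open>Comparing \<open>p'\<close> with \<open>p\<close> as candidates for the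
    projection leaves |p' - p|^2 bounded by 2 t times the product of \<open>n\<close> and
    \<open>p' - p\<close>. The inequality for the approximate normal then cancels one factor |p' -
    p|.\<close>
  have "(norm (x - p'))\<^sup>2 \<le> (t * norm n)\<^sup>2" using xp by (intro power_mono) auto
  moreover have eq: "x - p' = t *\<^sub>R n - (p' - p)" by (simp add: x_def)
  have "(norm (x - p'))\<^sup>2 = (t * norm n)\<^sup>2 - 2 * t * (n \<bullet> (p' - p)) + (norm (p' - p))\<^sup>2"
    unfolding eq power_mult_distrib power2_norm_eq_inner
    by (simp add: inner_diff_left inner_diff_right inner_commute power2_eq_square algebra_simps)
  ultimately have "(norm (p' - p))\<^sup>2 \<le> 2 * t * (n \<bullet> (p' - p))" by simp
  also have "\<dots> \<le> 2 * t * (\<epsilon> * norm (p' - p))"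
    using n[OF p'(1)] pp t by (intro mult_left_mono) (auto simp: m_def)
  finally have "norm (p' - p) * norm (p' - p) \<le> (2 * t * \<epsilon>) * norm (p' - p)"
    by (simp add: power2_eq_square)
  then have quad: "norm (p' - p) \<le> 2 * t * \<epsilon>"
    using t e by (cases "norm (p' - p) = 0") auto
  have "v - n = (p - p') /\<^sub>R t" using t by (simp add: v_def x_def algebra_simps)
  then have vn: "norm (v - n) \<le> 2 * \<epsilon>"
    using quad t by (simp add: norm_minus_commute divide_simps ac_simps)
  have "v \<in> regular_normal_cone \<Omega> p'"
    unfolding regular_normal_cone_iff
  proof (intro allI impI)
    fix \<eta> :: real assume eta: "\<eta> > 0"
    \<comment> \<open>Within \<open>r - dist p' q\<close> the ball constraint is inactive, so
      \<open>p'\<close> competes with all nearby points of \<open>\<Omega>\<close>; the bound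
      \<open>2 * t * \<eta>\<close> turns the quadratic term of the projection inequality into slope
      \<eta>.\<close>
    define s where "s = min (r - dist p' q) (2 * t * \<eta>)"
    have "dist p' q < r"
      using dist_triangle[of p' q p] pp by (simp add: m_def)
    then have s: "s > 0" using t eta by (simp add: s_def)
    have "v \<bullet> (q' - p') \<le> \<eta> * norm (q' - p')" if q': "q' \<in> \<Omega>" "dist q' p' < s" for q'
    proof -
      have "dist q q' \<le> r" using dist_triangle[of q q' p'] q'(2) by (simp add: s_def dist_commute)
      then have "norm (x - p') \<le> norm (x - q')" using p'(3) q'(1) by (simp add: dist_norm)
      then have "(norm (x - p'))\<^sup>2 \<le> (norm (x - q'))\<^sup>2" by (intro power_mono) auto
      moreover have "x - q' = (x - p') - (q' - p')" by simp
      then have "(norm (x - q'))\<^sup>2 = (norm (x - p'))\<^sup>2 - 2 * ((x - p') \<bullet> (q' - p')) + (norm (q' - p'))\<^sup>2"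
        by (simp only: power2_norm_eq_inner inner_diff_left inner_diff_right) (simp add: inner_commute)
      ultimately have "2 * ((x - p') \<bullet> (q' - p')) \<le> norm (q' - p') * norm (q' - p')"
        by (simp add: power2_eq_square)
      also have "\<dots> \<le> (2 * t * \<eta>) * norm (q' - p')"
        using q'(2) by (intro mult_right_mono) (auto simp: s_def dist_norm)
      finally show ?thesis using t by (simp add: v_def divide_simps ac_simps)
    qed
    then show "\<exists>\<delta>>0. \<forall>q'\<in>\<Omega>. dist q' p' < \<delta> \<longrightarrow> v \<bullet> (q' - p') \<le> \<eta> * norm (q' - p')"
      using s by blast
  qed
  moreover have "dist p' p < \<epsilon>" using pp by (simp add: m_def)
  ultimately show thesis using that p'(1) vn by blast
qed

lemma approx_eq_limiting_normal_cone:
  fixes \<Omega> :: "'a::euclidean_space set"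
  assumes r: "r > 0" and cl: "closed (\<Omega> \<inter> cball q r)" and q: "q \<in> \<Omega>"
  shows "approx_normal_cone \<Omega> q = limiting_normal_cone \<Omega> q"
proof (rule antisym[OF _ limiting_subset_approx_normal_cone], rule subsetI)
  fix n assume n: "n \<in> approx_normal_cone \<Omega> q"
  have "\<exists>Q V. Q \<in> \<Omega> \<and> V \<in> regular_normal_cone \<Omega> Q \<and> dist Q q < 2 * \<epsilon> \<and> dist V n \<le> 2 * \<epsilon>"
    if e: "\<epsilon> > 0" for \<epsilon>
  proof -
    \<comment> \<open>Capping at \<open>r\<close> puts the base point strictly inside the ball on
      which \<open>\<Omega>\<close> is closed.\<close>
    define \<eta> where "\<eta> = min \<epsilon> r"
    have eta: "\<eta> > 0" "\<eta> \<le> \<epsilon>" "\<eta> \<le> r" using e r by (auto simp: \<eta>_def)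
    obtain p \<delta> where p: "p \<in> \<Omega>" "dist p q < \<eta>" "\<delta> > 0"
      "\<And>p'. \<lbrakk>p' \<in> \<Omega>; dist p' p < \<delta>\<rbrakk> \<Longrightarrow> n \<bullet> (p' - p) \<le> \<eta> * norm (p' - p)"
      using approx_normal_coneD[OF n eta(1)] by blast
    obtain p' v where p': "p' \<in> \<Omega>" "dist p' p < \<eta>" "v \<in> regular_normal_cone \<Omega> p'" "norm (v - n) \<le> 2 * \<eta>"
      using approx_normal_near_regular[OF cl p(1) _ eta(1) p(3,4)] p(2) eta by auto
    have "dist p' q < 2 * \<epsilon>" using dist_triangle[of p' q p] p(2) p'(2) eta by simp
    then show ?thesis using p' eta by (intro exI[of _ p'] exI[of _ v]) (auto simp: dist_norm)
  qed
  then have "\<forall>k. \<exists>Q V. Q \<in> \<Omega> \<and> V \<in> regular_normal_cone \<Omega> Q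
      \<and> dist Q q < 2 * inverse (real (Suc k)) \<and> dist V n \<le> 2 * inverse (real (Suc k))"
    by simp
  then obtain Q V where QV: "\<And>k. Q k \<in> \<Omega> \<and> V k \<in> regular_normal_cone \<Omega> (Q k)
      \<and> dist (Q k) q < 2 * inverse (real (Suc k)) \<and> dist (V k) n \<le> 2 * inverse (real (Suc k))"
    by metis
  have lim0: "(\<lambda>k. 2 * inverse (real (Suc k))) \<longlonglongrightarrow> 0"
    using tendsto_mult_right_zero[OF LIMSEQ_inverse_real_of_nat] .
  have "Q \<longlonglongrightarrow> q" "V \<longlonglongrightarrow> n"
    using QV by (auto intro!: metric_tendsto_imp_tendsto[OF lim0] always_eventually simp: less_imp_le)
  then show "n \<in> limiting_normal_cone \<Omega> q"
    unfolding limiting_normal_cone_def using QV q by blast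
qed

text \<open>A base point strictly above the graph could be lowered, and that step has slope 1; so it
  lies on the graph. Testing the normal at points
  \<open>t0 + v \<bullet> (x' - x0) - \<epsilon> * norm (x' - x0)\<close> over \<open>x'\<close>
  then gives the minorant. Closeness of \<open>t0\<close> to \<open>t\<close> is part of the result,
  as \<open>g\<close> may be discontinuous.\<close>

lemma approx_normal_epi_subgradient:
  fixes g :: "'a::real_inner \<Rightarrow> ereal"
  assumes v: "(v, -1) \<in> approx_normal_cone (epi g) (x, t)" and e: "\<epsilon> > 0"
    and fin: "\<And>x. g x \<noteq> -\<infinity>"
  obtains x0 t0 \<delta> where "g x0 = ereal t0" "dist x0 x < \<epsilon>" "\<bar>t0 - t\<bar> < \<epsilon>" "\<delta> > 0"
    "\<And>x'. dist x' x0 < \<delta> \<Longrightarrow> ereal (t0 + v \<bullet> (x' - x0) - \<epsilon> * norm (x' - x0)) \<le> g x'"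
proof -
  \<comment> \<open>\<open>K\<close> bounds the length of the step to the test point relative to
    \<open>norm (x' - x0)\<close>. As \<open>\<eta> * K\<close> is half of \<epsilon>, a violated
    minorant would force \<open>x' = x0\<close>.\<close>
  define K where "K = 1 + norm v + \<epsilon>"
  have K: "K > 1" "K > \<epsilon>" using e by (auto simp: K_def add_nonneg_pos add_pos_nonneg)
  define \<eta> where "\<eta> = \<epsilon> / (2 * K)"
  have eta: "\<eta> > 0" "\<eta> < 1" "\<eta> < \<epsilon>" "\<eta> * K = \<epsilon> / 2"
    using e K by (auto simp: \<eta>_def divide_simps)
  obtain p \<delta> where p: "p \<in> epi g" "dist p (x, t) < \<eta>" "\<delta> > 0"
    "\<And>p'. \<lbrakk>p' \<in> epi g; dist p' p < \<delta>\<rbrakk> \<Longrightarrow> (v, -1) \<bullet> (p' - p) \<le> \<eta> * norm (p' - p)"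
    using approx_normal_coneD[OF v eta(1)] by blast
  obtain x0 t0 where p_eq: "p = (x0, t0)" by force
  have le: "g x0 \<le> ereal t0" using p(1) by (simp add: epi_def p_eq)
  have g0: "g x0 = ereal t0"
  proof (rule ccontr)
    assume "g x0 \<noteq> ereal t0"
    then obtain s where s: "g x0 = ereal s" "s < t0"
      using le fin[of x0] by (cases "g x0") auto
    define t' where "t' = max s (t0 - \<delta> / 2)"
    have t': "t' < t0" "s \<le> t'" "t0 - t' < \<delta>" using s p(3) by (auto simp: t'_def)
    have "(v, -1) \<bullet> ((x0, t') - p) \<le> \<eta> * norm ((x0, t') - p)"
      using t' s by (intro p(4)) (auto simp: epi_def p_eq dist_Pair_Pair dist_real_def)
    then have "t0 - t' \<le> \<eta> * (t0 - t')" using t' by (simp add: p_eq norm_Pair)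
    then show False using t' eta by simp
  qed
  have "dist x0 x < \<epsilon>" "\<bar>t0 - t\<bar> < \<epsilon>"
    using p(2) eta(3) dist_fst_le[of p "(x, t)"] dist_snd_le[of p "(x, t)"]
    by (auto simp: p_eq dist_real_def)
  moreover have "ereal (t0 + v \<bullet> (x' - x0) - \<epsilon> * norm (x' - x0)) \<le> g x'" if x': "dist x' x0 < \<delta> / K" for x'
  proof (rule ccontr)
    assume *: "\<not> ?thesis"
    define t' where "t' = t0 + v \<bullet> (x' - x0) - \<epsilon> * norm (x' - x0)"
    have "(x', t') \<in> epi g" using * by (simp add: epi_def t'_def)
    moreover have "\<bar>v \<bullet> (x' - x0)\<bar> \<le> norm v * norm (x' - x0)" by (rule Cauchy_Schwarz_ineq2)
    then have "\<bar>t' - t0\<bar> \<le> norm v * norm (x' - x0) + \<epsilon> * norm (x' - x0)"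
      using mult_nonneg_nonneg[OF less_imp_le[OF e] norm_ge_zero[of "x' - x0"]] unfolding t'_def by linarith
    then have n: "norm ((x', t') - p) \<le> K * norm (x' - x0)"
      using norm_Pair_le_add[of "x' - x0" "t' - t0"] by (simp add: p_eq K_def algebra_simps)
    moreover have "K * norm (x' - x0) < \<delta>" using x' K by (simp add: dist_norm divide_simps mult.commute)
    ultimately have "(v, -1) \<bullet> ((x', t') - p) \<le> \<eta> * norm ((x', t') - p)"
      by (intro p(4)) (auto simp: dist_norm)
    also have "\<dots> \<le> \<eta> * (K * norm (x' - x0))" using n eta by (intro mult_left_mono) auto
    also have "\<dots> = \<epsilon> / 2 * norm (x' - x0)" using eta(4) by (metis mult.assoc)
    finally have "\<epsilon> * norm (x' - x0) \<le> \<epsilon> / 2 * norm (x' - x0)" by (simp add: p_eq t'_def)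
    then have "x' = x0" using e by simp
    then show False using * g0 by simp
  qed
  moreover have "\<delta> / K > 0" using p(3) K by simp
  ultimately show thesis using that g0 by blast
qed

text \<open>By strict differentiability, \<open>n \<bullet> (\<Psi> p - \<Psi> p')\<close> and
  \<open>adjoint T n \<bullet> (p - p')\<close> differ by a small multiple of
  \<open>norm (p - p')\<close>. The Lipschitz bound of \<open>\<Psi>\<close> and
  \<open>lower\<close> make the norms of the two increments comparable on \<open>\<Lambda>\<close>,
  so slopes transfer both ways even if \<open>T\<close> is not injective.\<close>

lemma approx_normal_cone_image:
  fixes \<Psi> :: "'a::euclidean_space \<Rightarrow> 'b::euclidean_space"
  assumes \<Psi>: "strict_derivative \<Psi> T p0" and r: "r > 0" "s > 0" "c > 0" and p0: "p0 \<in> \<Lambda>"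
    and into: "\<And>p. \<lbrakk>p \<in> \<Lambda>; dist p p0 < r\<rbrakk> \<Longrightarrow> \<Psi> p \<in> M"
    and onto: "\<And>q. \<lbrakk>q \<in> M; dist q (\<Psi> p0) < s\<rbrakk> \<Longrightarrow> \<exists>p\<in>\<Lambda>. dist p p0 < r \<and> \<Psi> p = q"
    and lower: "\<And>p p'. \<lbrakk>p \<in> \<Lambda>; p' \<in> \<Lambda>; dist p p0 < r; dist p' p0 < r\<rbrakk> \<Longrightarrow> dist p p' \<le> c * dist (\<Psi> p) (\<Psi> p')"
  shows "n \<in> approx_normal_cone M (\<Psi> p0) \<longleftrightarrow> adjoint T n \<in> approx_normal_cone \<Lambda> p0"
proof -
  have lin: "linear T" using strict_derivative_bounded_linear[OF \<Psi>] by (rule bounded_linear.linear)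
  have adj: "adjoint T n \<bullet> p = n \<bullet> T p" for p
    using adjoint_works[OF lin, of p n] by (simp add: inner_commute)
  obtain r1 L where r1: "r1 > 0" and L: "L > 0"
    and lip: "\<And>p p'. \<lbrakk>p \<in> ball p0 r1; p' \<in> ball p0 r1\<rbrakk> \<Longrightarrow> norm (\<Psi> p - \<Psi> p') \<le> L * norm (p - p')"
    by (rule strict_derivative_lipschitz[OF \<Psi>]) (rule that)
  have lin_err: "\<bar>n \<bullet> (\<Psi> p - \<Psi> p') - adjoint T n \<bullet> (p - p')\<bar> \<le> norm n * (\<epsilon> * norm (p - p'))"
    if "norm (\<Psi> p - \<Psi> p' - T (p - p')) \<le> \<epsilon> * norm (p - p')" for p p' \<epsilon>
  proof -
    have "n \<bullet> (\<Psi> p - \<Psi> p') - adjoint T n \<bullet> (p - p') = n \<bullet> (\<Psi> p - \<Psi> p' - T (p - p'))"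
      by (simp add: adj inner_diff_right linear_diff[OF lin])
    also have "\<bar>\<dots>\<bar> \<le> norm n * norm (\<Psi> p - \<Psi> p' - T (p - p'))" by (rule Cauchy_Schwarz_ineq2)
    also have "\<dots> \<le> norm n * (\<epsilon> * norm (p - p'))" using that by (intro mult_left_mono) auto
    finally show ?thesis .
  qed
  show ?thesis
  proof
    assume n: "n \<in> approx_normal_cone M (\<Psi> p0)"
    show "adjoint T n \<in> approx_normal_cone \<Lambda> p0"
      unfolding approx_normal_cone_def
    proof (intro CollectI allI impI)
      fix e :: real assume e: "e > 0"
      \<comment> \<open>The slope at \<open>q1\<close> is multiplied by the Lipschitz constant
        \<open>L\<close>, the linearization error by \<open>norm n\<close>.\<close>
      define \<epsilon>1 where "\<epsilon>1 = e / (L + norm n)"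
      have Ln: "L + norm n > 0" using L by (simp add: add_pos_nonneg)
      have e1: "\<epsilon>1 > 0" "\<epsilon>1 * (L + norm n) = e" using e Ln by (simp_all add: \<epsilon>1_def)
      obtain r2 where r2: "r2 > 0" and str: "\<And>p p'. \<lbrakk>p \<in> ball p0 r2; p' \<in> ball p0 r2\<rbrakk>
          \<Longrightarrow> norm (\<Psi> p - \<Psi> p' - T (p - p')) \<le> \<epsilon>1 * norm (p - p')"
        by (rule strict_derivativeD[OF \<Psi> e1(1)]) (rule that)
      define \<rho> where "\<rho> = min (min r r1) r2"
      have \<rho>: "\<rho> > 0" "\<rho> \<le> r" "\<rho> \<le> r1" "\<rho> \<le> r2" using r r1 r2 by (auto simp: \<rho>_def)
      \<comment> \<open>The quotient by \<open>c\<close> controls the preimage \<open>p1\<close> of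
        the base point: \<open>lower\<close> gives \<open>dist p1 p0 < c * \<eta>\<close>.\<close>
      define \<eta> where "\<eta> = min (min \<epsilon>1 s) (min e (\<rho> / 2) / c)"
      have eta: "\<eta> > 0" "\<eta> \<le> \<epsilon>1" "\<eta> \<le> s" using e1(1) r e \<rho> by (auto simp: \<eta>_def)
      have "\<eta> \<le> min e (\<rho> / 2) / c" by (simp add: \<eta>_def)
      then have ceta: "c * \<eta> \<le> e" "c * \<eta> \<le> \<rho> / 2" using r(3) by (simp_all add: pos_le_divide_eq mult.commute)
      obtain q1 \<delta> where q1: "q1 \<in> M" "dist q1 (\<Psi> p0) < \<eta>" "\<delta> > 0"
        "\<And>q'. \<lbrakk>q' \<in> M; dist q' q1 < \<delta>\<rbrakk> \<Longrightarrow> n \<bullet> (q' - q1) \<le> \<eta> * norm (q' - q1)"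
        by (rule approx_normal_coneD[OF n eta(1)]) (rule that)
      obtain p1 where p1: "p1 \<in> \<Lambda>" "dist p1 p0 < r" "\<Psi> p1 = q1" using onto q1 eta by force
      have "dist p1 p0 \<le> c * dist q1 (\<Psi> p0)" using lower[OF p1(1) p0 p1(2)] r p1(3) by simp
      also have "\<dots> < c * \<eta>" using q1(2) r by simp
      finally have d1: "dist p1 p0 < e" "dist p1 p0 < \<rho> / 2" using ceta by simp_all
      have "adjoint T n \<bullet> (p - p1) \<le> e * norm (p - p1)"
        if p: "p \<in> \<Lambda>" "dist p p1 < min (\<rho> / 2) (\<delta> / L)" for p
      proof -
        have dp: "dist p p0 < \<rho>" using dist_triangle[of p p0 p1] p(2) d1(2) by simp
        have b: "p \<in> ball p0 r1" "p1 \<in> ball p0 r1" "p \<in> ball p0 r2" "p1 \<in> ball p0 r2"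
          using dp d1(2) \<rho> by (simp_all add: dist_commute)
        have lipp: "norm (\<Psi> p - q1) \<le> L * norm (p - p1)" using lip[OF b(1,2)] p1(3) by simp
        also have "\<dots> < \<delta>" using p(2) L by (simp add: dist_norm pos_less_divide_eq mult.commute)
        finally have "n \<bullet> (\<Psi> p - q1) \<le> \<eta> * norm (\<Psi> p - q1)"
          using q1(4)[OF into] p(1) dp \<rho>(2) by (simp add: dist_norm)
        also have "\<dots> \<le> \<epsilon>1 * (L * norm (p - p1))" using lipp eta e1 by (intro mult_mono) auto
        finally have "n \<bullet> (\<Psi> p - \<Psi> p1) \<le> \<epsilon>1 * (L * norm (p - p1))" by (simp add: p1(3))
        moreover have "adjoint T n \<bullet> (p - p1) \<le> n \<bullet> (\<Psi> p - \<Psi> p1) + norm n * (\<epsilon>1 * norm (p - p1))"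
          using lin_err[OF str[OF b(3,4)]] by linarith
        ultimately have "adjoint T n \<bullet> (p - p1) \<le> (\<epsilon>1 * (L + norm n)) * norm (p - p1)"
          by (simp add: algebra_simps)
        then show ?thesis by (simp add: e1)
      qed
      moreover have "min (\<rho> / 2) (\<delta> / L) > 0" using \<rho> q1(3) L by simp
      ultimately show "\<exists>p\<in>\<Lambda>. dist p p0 < e \<and>
          (\<exists>\<delta>>0. \<forall>p'\<in>\<Lambda>. dist p' p < \<delta> \<longrightarrow> adjoint T n \<bullet> (p' - p) \<le> e * norm (p' - p))"
        using p1(1) d1(1) by blast
    qed
  next
    assume n: "adjoint T n \<in> approx_normal_cone \<Lambda> p0"
    show "n \<in> approx_normal_cone M (\<Psi> p0)"
      unfolding approx_normal_cone_def
    proof (intro CollectI allI impI)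
      fix e :: real assume e: "e > 0"
      \<comment> \<open>Norms are now converted from the source to the image, so the factor is the
        constant \<open>c\<close> of \<open>lower\<close> instead of \<open>L\<close>.\<close>
      define K where "K = (1 + norm n) * c"
      have K: "K > 0" using r by (simp add: K_def add_pos_nonneg)
      define \<epsilon>1 where "\<epsilon>1 = e / K"
      have e1: "\<epsilon>1 > 0" "\<epsilon>1 * K = e" using e K by (simp_all add: \<epsilon>1_def)
      obtain r2 where r2: "r2 > 0" and str: "\<And>p p'. \<lbrakk>p \<in> ball p0 r2; p' \<in> ball p0 r2\<rbrakk>
          \<Longrightarrow> norm (\<Psi> p - \<Psi> p' - T (p - p')) \<le> \<epsilon>1 * norm (p - p')"
        by (rule strict_derivativeD[OF \<Psi> e1(1)]) (rule that)
      define \<rho> where "\<rho> = min (min r r1) r2"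
      have \<rho>: "\<rho> > 0" "\<rho> \<le> r" "\<rho> \<le> r1" "\<rho> \<le> r2" using r r1 r2 by (auto simp: \<rho>_def)
      define \<eta> where "\<eta> = min (min \<epsilon>1 (\<rho> / 2)) (min e (s / 2) / L)"
      have eta: "\<eta> > 0" "\<eta> \<le> \<epsilon>1" "\<eta> \<le> \<rho> / 2" using e1(1) r e \<rho> L by (auto simp: \<eta>_def simp del: le_divide_eq_numeral1)
      have "\<eta> \<le> min e (s / 2) / L" by (simp add: \<eta>_def)
      then have Leta: "L * \<eta> \<le> e" "L * \<eta> \<le> s / 2" using L by (simp_all add: pos_le_divide_eq mult.commute)
      obtain p1 \<delta> where p1: "p1 \<in> \<Lambda>" "dist p1 p0 < \<eta>" "\<delta> > 0"
        "\<And>p. \<lbrakk>p \<in> \<Lambda>; dist p p1 < \<delta>\<rbrakk> \<Longrightarrow> adjoint T n \<bullet> (p - p1) \<le> \<eta> * norm (p - p1)"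
        by (rule approx_normal_coneD[OF n eta(1)]) (rule that)
      have d1: "dist p1 p0 < r" using p1(2) eta \<rho> by simp
      have "norm (\<Psi> p1 - \<Psi> p0) \<le> L * norm (p1 - p0)"
        using p1(2) eta \<rho> r1 by (intro lip) (auto simp: dist_commute)
      also have "\<dots> < L * \<eta>" using p1(2) L by (simp add: dist_norm)
      finally have d2: "dist (\<Psi> p1) (\<Psi> p0) < e" "dist (\<Psi> p1) (\<Psi> p0) < s / 2"
        using Leta by (simp_all add: dist_norm)
      have "n \<bullet> (q - \<Psi> p1) \<le> e * norm (q - \<Psi> p1)"
        if q: "q \<in> M" "dist q (\<Psi> p1) < min (s / 2) (min \<delta> (\<rho> / 2) / c)" for q
      proof -
        have "dist q (\<Psi> p0) < s" using dist_triangle[of q "\<Psi> p0" "\<Psi> p1"] q(2) d2(2) by simp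
        then obtain p where p: "p \<in> \<Lambda>" "dist p p0 < r" "\<Psi> p = q" using onto q(1) by blast
        have low: "dist p p1 \<le> c * dist q (\<Psi> p1)" using lower[OF p(1) p1(1) p(2) d1] p(3) by simp
        have "dist q (\<Psi> p1) < min \<delta> (\<rho> / 2) / c" using q(2) by simp
        then have "c * dist q (\<Psi> p1) < min \<delta> (\<rho> / 2)" using r by (simp add: pos_less_divide_eq mult.commute)
        then have d3: "dist p p1 < \<delta>" "dist p p1 < \<rho> / 2" using low by simp_all
        have "dist p p0 < \<rho>" using dist_triangle[of p p0 p1] d3 p1(2) eta by simp
        then have b: "p \<in> ball p0 r2" "p1 \<in> ball p0 r2"
          using p1(2) eta \<rho> by (simp_all add: dist_commute)
        have "n \<bullet> (q - \<Psi> p1) \<le> adjoint T n \<bullet> (p - p1) + norm n * (\<epsilon>1 * norm (p - p1))"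
          using lin_err[OF str[OF b]] unfolding p(3) by linarith
        also have "adjoint T n \<bullet> (p - p1) \<le> \<eta> * norm (p - p1)" by (rule p1(4)[OF p(1) d3(1)])
        also have "\<eta> * norm (p - p1) \<le> \<epsilon>1 * norm (p - p1)" using eta by (intro mult_right_mono) auto
        finally have "n \<bullet> (q - \<Psi> p1) \<le> (\<epsilon>1 * (1 + norm n)) * norm (p - p1)" by (simp add: algebra_simps)
        also have "\<dots> \<le> (\<epsilon>1 * (1 + norm n)) * (c * norm (q - \<Psi> p1))"
          using low e1 by (intro mult_left_mono) (auto simp: dist_norm add_nonneg_nonneg)
        also have "\<dots> = (\<epsilon>1 * K) * norm (q - \<Psi> p1)" by (simp add: K_def)
        finally show ?thesis by (simp add: e1)
      qed
      moreover have "min (s / 2) (min \<delta> (\<rho> / 2) / c) > 0" using \<rho> p1(3) r by simp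
      moreover have "\<Psi> p1 \<in> M" by (rule into[OF p1(1) d1])
      ultimately show "\<exists>p\<in>M. dist p (\<Psi> p0) < e \<and>
          (\<exists>\<delta>>0. \<forall>p'\<in>M. dist p' p < \<delta> \<longrightarrow> n \<bullet> (p' - p) \<le> e * norm (p' - p))"
        using d2(1) by blast
    qed
  qed
qed

section \<open>Mordukhovich's criterion\<close>

text \<open>From 2 |a| |a + b| \<le> |a|^2 + |a + b|^2. It stands in for the derivative of the norm
  away from 0, with an explicit quadratic error.\<close>

lemma norm_le_linearization:
  fixes a b :: "'a::real_inner"
  assumes "a \<noteq> 0"
  shows "norm (a + b) \<le> norm a + (a \<bullet> b) / norm a + norm b * norm b / (2 * norm a)"
proof -
  have "2 * norm a * norm (a + b) \<le> norm a * norm a + norm (a + b) * norm (a + b)"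
    using sum_squares_bound[of "norm a" "norm (a + b)"] by (simp add: power2_eq_square)
  also have "norm (a + b) * norm (a + b) = norm a * norm a + 2 * (a \<bullet> b) + norm b * norm b"
    by (simp add: power2_norm_eq_inner[symmetric, unfolded power2_eq_square] inner_add_left inner_add_right inner_commute
       flip: power2_eq_square) 
       (simp add: power2_norm_eq_inner inner_add_left inner_add_right inner_commute)
  finally show ?thesis using assms by (simp add: divide_simps) (simp add: algebra_simps)
qed

text \<open>A move of \<open>v0\<close> against \<open>u\<close> by \<open>t\<close> is answered, by
  the Aubin property, with a move of \<open>x0\<close> by at most \<open>L * t\<close>. The vector
  \<open>(0, - u)\<close> sees only the first move, so its slope is at least
  \<open>norm u / (L + 1)\<close>.\<close>

lemma lipschitz_like_imp_approx_normal_trivial: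
  fixes S :: "'a::real_inner \<Rightarrow> 'b::real_inner set"
  defines "\<Omega> \<equiv> {(x, v). x \<in> S v}"
  assumes lip: "lipschitz_like S vbar xbar"
    and u: "(0, - u) \<in> approx_normal_cone \<Omega> (xbar, vbar)"
  shows "u = 0"
proof (rule ccontr)
  assume u0: "u \<noteq> 0"
  obtain U W L where UW: "open U" "vbar \<in> U" "open W" "xbar \<in> W" "L > 0"
    and sub: "\<And>v1 v2. v1 \<in> U \<Longrightarrow> v2 \<in> U \<Longrightarrow>
        S v1 \<inter> W \<subseteq> S v2 + (\<lambda>b. (L * norm (v1 - v2)) *\<^sub>R b) ` cball 0 1"
    using lip unfolding lipschitz_like_def by blast
  obtain e1 e2 where e1: "e1 > 0" "ball vbar e1 \<subseteq> U" and e2: "e2 > 0" "ball xbar e2 \<subseteq> W"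
    using UW open_contains_ball by metis
  \<comment> \<open>Half of that slope; \<open>e1 / 2\<close> leaves room for moving
    \<open>v0\<close> inside \<open>U\<close>.\<close>
  define \<epsilon> where "\<epsilon> = min (min (e1 / 2) e2) (norm u / (2 * (L + 1)))"
  have "\<epsilon> > 0" using e1 e2 UW u0 by (simp add: \<epsilon>_def)
  then obtain p \<delta> where p: "p \<in> \<Omega>" "dist p (xbar, vbar) < \<epsilon>" "\<delta> > 0"
    "\<And>p'. \<lbrakk>p' \<in> \<Omega>; dist p' p < \<delta>\<rbrakk> \<Longrightarrow> (0, - u) \<bullet> (p' - p) \<le> \<epsilon> * norm (p' - p)"
    using approx_normal_coneD[OF u] by blast
  obtain x0 v0 where p_eq: "p = (x0, v0)" by force
  have x0: "x0 \<in> S v0" "dist x0 xbar < \<epsilon>" "dist v0 vbar < \<epsilon>"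
    using p dist_fst_le[of p "(xbar, vbar)"] dist_snd_le[of p "(xbar, vbar)"]
    by (auto simp: p_eq \<Omega>_def)
  define t where "t = min (\<delta> / (2 * (L + 1))) (e1 / 2)"
  have t: "t > 0" using p(3) e1 UW by (simp add: t_def)
  have te: "t \<le> e1 / 2" unfolding t_def by (rule min.cobounded2)
  have "t * (L + 1) \<le> \<delta> / (2 * (L + 1)) * (L + 1)" using UW by (intro mult_right_mono) (auto simp: t_def)
  moreover have "\<delta> / (2 * (L + 1)) * (L + 1) = \<delta> / 2" using UW by (simp add: divide_simps)
  ultimately have tL: "t * (L + 1) < \<delta>" using p(3) by linarith
  define v where "v = v0 - (t / norm u) *\<^sub>R u"
  have nv: "norm (v0 - v) = t" using u0 t by (simp add: v_def)
  have "v0 \<in> U" using x0(3) e1 by (auto simp: \<epsilon>_def dist_commute)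
  moreover have "v \<in> U"
    using e1(2) dist_triangle[of v vbar v0] x0(3) nv te
    by (auto simp: \<epsilon>_def dist_commute dist_norm norm_minus_commute)
  moreover have "x0 \<in> W" using x0(2) e2 by (auto simp: \<epsilon>_def dist_commute)
  ultimately have "x0 \<in> S v + (\<lambda>b. (L * norm (v0 - v)) *\<^sub>R b) ` cball 0 1"
    using sub x0(1) by blast
  then obtain x b where x: "x \<in> S v" "norm b \<le> 1" "x0 = x + (L * t) *\<^sub>R b"
    unfolding set_plus_def nv by auto
  have nx: "norm (x - x0) \<le> L * t" using x UW t mult_left_mono[OF x(2), of "L * t"] by simp
  have n: "norm ((x, v) - p) \<le> t * (L + 1)"
    using norm_Pair_le_add[of "x - x0" "v - v0"] nx nv by (simp add: p_eq norm_minus_commute algebra_simps)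
  then have "(0, - u) \<bullet> ((x, v) - p) \<le> \<epsilon> * norm ((x, v) - p)"
    using p(4)[of "(x, v)"] x(1) tL by (auto simp: \<Omega>_def dist_norm)
  also have "\<dots> \<le> \<epsilon> * (t * (L + 1))" using n \<open>\<epsilon> > 0\<close> by (intro mult_left_mono) auto
  also have "\<dots> \<le> (norm u / (2 * (L + 1))) * (t * (L + 1))"
    using t UW by (intro mult_right_mono) (auto simp: \<epsilon>_def)
  also have "\<dots> = t * norm u / 2" using UW by (simp add: divide_simps)
  also have "(0, - u) \<bullet> ((x, v) - p) = t * norm u"
    using u0 by (simp add: p_eq v_def inner_Pair power2_norm_eq_inner[symmetric] power2_eq_square)
  finally show False using t u0 by simp
qed

text \<open>If the Aubin property fails at the scale \<open>m\<close>, minimising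
  \<open>norm (v - v2) + c * norm (x - x1)\<close> over the graph produces an approximate normal
  with unit second component; the penalty \<open>c\<close> is at least \<open>sqrt (norm (v1 - v2))\<close> in order to keep the
  minimiser close to \<open>x1\<close>.\<close>

lemma not_lipschitz_like_imp_unit_approx_normal:
  fixes S :: "'a::euclidean_space \<Rightarrow> 'b::euclidean_space set"
  defines "\<Omega> \<equiv> {(x, v). x \<in> S v}"
  assumes r: "r > 0" and cl: "closed (\<Omega> \<inter> cball (xbar, vbar) r)"
    and nlip: "\<not> lipschitz_like S vbar xbar" and e: "\<epsilon> > 0"
  obtains u p \<delta> where "norm u = 1" "p \<in> \<Omega>" "dist p (xbar, vbar) < \<epsilon>" "\<delta> > 0"
    "\<And>p'. \<lbrakk>p' \<in> \<Omega>; dist p' p < \<delta>\<rbrakk> \<Longrightarrow> (0, - u) \<bullet> (p' - p) \<le> \<epsilon> * norm (p' - p)"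
proof -
  define m where "m = min (min \<epsilon> r) 1"
  have m: "m > 0" "m \<le> \<epsilon>" "m \<le> r" "m \<le> 1" using e r by (auto simp: m_def)
  \<comment> \<open>Two points of \<open>ball vbar \<rho>\<close> are less than
    \<open>2 * \<rho>\<close>, that is (m/4)^2, apart, so the square root of their distance is at
    most \<open>m / 4\<close>.\<close>
  define \<rho> where "\<rho> = m * m / 32"
  have "m * m \<le> 1 * m" using m by (intro mult_right_mono) auto
  then have rho: "\<rho> > 0" "\<rho> \<le> m / 32" using m by (auto simp: \<rho>_def)
  define L where "L = 4 / m"
  have L: "L > 0" using m by (simp add: L_def)
  have "\<not> (\<forall>v1\<in>ball vbar \<rho>. \<forall>v2\<in>ball vbar \<rho>.
      S v1 \<inter> ball xbar \<rho> \<subseteq> S v2 + (\<lambda>b. (L * norm (v1 - v2)) *\<^sub>R b) ` cball 0 1)"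
    using nlip rho L unfolding lipschitz_like_def by (metis centre_in_ball open_ball)
  then obtain v1 v2 x1 where v: "v1 \<in> ball vbar \<rho>" "v2 \<in> ball vbar \<rho>" "x1 \<in> ball xbar \<rho>" "x1 \<in> S v1"
    and notin: "x1 \<notin> S v2 + (\<lambda>b. (L * norm (v1 - v2)) *\<^sub>R b) ` cball 0 1"
    by blast
  have far: "norm (x1 - x) > L * norm (v1 - v2)" if "x \<in> S v2" for x
  proof (rule ccontr)
    assume *: "\<not> ?thesis"
    define b where "b = (1 / (L * norm (v1 - v2))) *\<^sub>R (x1 - x)"
    have "x1 = x + (L * norm (v1 - v2)) *\<^sub>R b" using * L by (cases "v1 = v2") (auto simp: b_def)
    moreover have "norm b \<le> 1" using * L by (cases "v1 = v2") (auto simp: b_def)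
    ultimately have "x1 \<in> S v2 + (\<lambda>b. (L * norm (v1 - v2)) *\<^sub>R b) ` cball 0 1"
      using that by (auto simp: set_plus_def intro!: bexI[OF _ that] bexI[of _ b])
    then show False using notin by blast
  qed
  define \<delta>0 where "\<delta>0 = norm (v1 - v2)"
  have d0: "\<delta>0 > 0" using far[of x1] v(4) by (auto simp: \<delta>0_def)
  have d1: "\<delta>0 < 2 * \<rho>"
    using dist_triangle2[of v1 v2 vbar] v(1,2) by (simp add: \<delta>0_def dist_norm norm_minus_commute)
  have "sqrt \<delta>0 \<le> sqrt ((m / 4)\<^sup>2)" using d1 by (intro real_sqrt_le_mono) (simp add: \<rho>_def power2_eq_square)
  then have sq: "sqrt \<delta>0 \<le> m / 4" using m by simp
  \<comment> \<open>The part \<open>1 / L\<close>, equal to \<open>m / 4\<close>, keeps the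
    minimiser within \<open>L * \<delta>0\<close> of \<open>x1\<close>; by \<open>far\<close> its
    second component then differs from \<open>v2\<close>, where the norm would have a kink.\<close>
  define c where "c = max (1 / L) (sqrt \<delta>0)"
  have c: "c > 0" "c \<le> m / 4" using d0 sq m by (auto simp: c_def L_def less_max_iff_disj)
  define g where "g = (\<lambda>(x, v). norm (v - v2) + c * norm (x - x1))"
  define K where "K = \<Omega> \<inter> cball (xbar, vbar) r"
  have "compact K" unfolding K_def using cl by (metis compact_Int_closed compact_cball inf.right_idem inf_commute)
  moreover have inK: "(x1, v1) \<in> K"
  proof -
    have "dist (xbar, vbar) (x1, v1) \<le> dist xbar x1 + dist vbar v1"
      by (simp add: dist_Pair_Pair sqrt_sum_squares_le_sum)
    also have "\<dots> < r" using v rho m by simp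
    finally show ?thesis using v by (simp add: K_def \<Omega>_def)
  qed
  moreover have "continuous_on K g" unfolding g_def case_prod_unfold by (intro continuous_intros)
  ultimately obtain p where p: "p \<in> K" "\<And>y. y \<in> K \<Longrightarrow> g p \<le> g y"
    using continuous_attains_inf[of K g] by blast
  obtain x v where p_eq: "p = (x, v)" by force
  have gp: "norm (v - v2) + c * norm (x - x1) \<le> \<delta>0"
    using p(2)[OF inK] by (simp add: g_def p_eq \<delta>0_def)
  then have cx: "c * norm (x - x1) \<le> \<delta>0" and vd: "norm (v - v2) \<le> \<delta>0"
    using mult_nonneg_nonneg[OF less_imp_le[OF c(1)] norm_ge_zero[of "x - x1"]] norm_ge_zero[of "v - v2"]
    by linarith+
  have "(1 / L) * norm (x - x1) \<le> c * norm (x - x1)" by (intro mult_right_mono) (auto simp: c_def)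
  then have "(1 / L) * norm (x - x1) \<le> \<delta>0" using cx by (rule order_trans)
  then have xL: "norm (x - x1) \<le> L * \<delta>0" using L by (simp add: divide_simps mult.commute)
  have "sqrt \<delta>0 * norm (x - x1) \<le> c * norm (x - x1)" by (intro mult_right_mono) (auto simp: c_def)
  then have "sqrt \<delta>0 * norm (x - x1) \<le> sqrt \<delta>0 * sqrt \<delta>0" using cx d0 by simp
  then have "norm (x - x1) \<le> sqrt \<delta>0" by (rule mult_left_le_imp_le) (use d0 in simp)
  then have xs: "norm (x - x1) \<le> m / 4" using sq by simp
  have v_ne: "v \<noteq> v2"
  proof
    assume "v = v2"
    then have "x \<in> S v2" using p(1) by (simp add: K_def \<Omega>_def p_eq)
    from far[OF this] show False using xL norm_minus_commute[of x x1] by (simp add: \<delta>0_def)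
  qed
  have "dist p (xbar, vbar) \<le> dist x xbar + dist v vbar"
    by (simp add: p_eq dist_Pair_Pair sqrt_sum_squares_le_sum)
  also have "\<dots> \<le> (dist x x1 + dist x1 xbar) + (dist v v2 + dist v2 vbar)"
    by (intro add_mono dist_triangle)
  also have "\<dots> < m"
  proof -
    have "dist x x1 \<le> m / 4" "dist v v2 \<le> \<delta>0" using xs vd by (simp_all add: dist_norm)
    moreover have "dist x1 xbar < \<rho>" "dist v2 vbar < \<rho>" using v by (simp_all add: dist_commute)
    ultimately show ?thesis using d1 rho m(1) by linarith
  qed
  finally have near: "dist p (xbar, vbar) < m" .
  define u where "u = (v - v2) /\<^sub>R norm (v - v2)"
  \<comment> \<open>The bound \<open>m * norm (v - v2)\<close> makes the quadratic error of the
    linearized norm at most \<open>m / 2 * norm (p' - p)\<close>; with \<open>c \<le> m / 4\<close>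
    the total slope is at most three quarters of \<open>m\<close>.\<close>
  define \<delta> where "\<delta> = min (m - dist p (xbar, vbar)) (m * norm (v - v2))"
  have "\<delta> > 0" using near m v_ne by (simp add: \<delta>_def)
  moreover have "(0, - u) \<bullet> (p' - p) \<le> \<epsilon> * norm (p' - p)" if p': "p' \<in> \<Omega>" "dist p' p < \<delta>" for p'
  proof -
    obtain x' v' where p'_eq: "p' = (x', v')" by force
    have "dist (xbar, vbar) p' \<le> r"
      using dist_triangle[of p' "(xbar, vbar)" p] p' near m by (simp add: \<delta>_def dist_commute)
    then have "g p \<le> g p'" using p p' by (auto simp: K_def)
    moreover have "norm (x' - x1) \<le> norm (x' - x) + norm (x - x1)"
      using norm_triangle_ineq[of "x' - x" "x - x1"] by simp
    then have "c * norm (x' - x1) \<le> c * (norm (x' - x) + norm (x - x1))" using c by (intro mult_left_mono) auto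
    ultimately have 1: "norm (v - v2) \<le> norm (v' - v2) + c * norm (x' - x)"
      by (simp add: g_def p_eq p'_eq distrib_left)
    have 2: "norm (v' - v2) \<le> norm (v - v2) + u \<bullet> (v' - v) + norm (v' - v) * norm (v' - v) / (2 * norm (v - v2))"
      using norm_le_linearization[of "v - v2" "v' - v"] v_ne by (simp add: u_def inverse_eq_divide)
    have nv: "norm (v' - v) \<le> norm (p' - p)" and nx: "norm (x' - x) \<le> norm (p' - p)"
      using norm_snd_le[of "v' - v" "x' - x"] norm_fst_le[of "x' - x" "v' - v"] by (auto simp: p_eq p'_eq)
    have "norm (v' - v) \<le> m * norm (v - v2)"
      using nv p'(2) by (simp add: \<delta>_def dist_norm)
    then have "norm (v' - v) * norm (v' - v) \<le> (m * norm (v - v2)) * norm (p' - p)"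
      using nv m(1) by (intro mult_mono) auto
    then have 3: "norm (v' - v) * norm (v' - v) / (2 * norm (v - v2)) \<le> m / 2 * norm (p' - p)"
      using v_ne by (simp add: pos_divide_le_eq algebra_simps)
    have "c * norm (x' - x) \<le> m / 4 * norm (p' - p)" using c nx by (intro mult_mono) auto
    then have "- (u \<bullet> (v' - v)) \<le> m / 4 * norm (p' - p) + m / 2 * norm (p' - p)" using 1 2 3 by linarith
    also have "\<dots> = (3 / 4 * m) * norm (p' - p)" by simp
    also have "\<dots> \<le> \<epsilon> * norm (p' - p)" using m by (intro mult_right_mono) auto
    finally show ?thesis by (simp add: p_eq p'_eq)
  qed
  moreover have "norm u = 1" using v_ne by (simp add: u_def)
  moreover have "p \<in> \<Omega>" using p by (simp add: K_def)
  ultimately show thesis using that[of u p \<delta>] near m by simp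
qed

text \<open>If the property fails, unit approximate normals exist at every scale. Compactness of the
  sphere gives a limit direction, and replacing a direction by the limit costs only a small
  slope.\<close>

lemma lipschitz_like_iff_approx_normal_trivial:
  fixes S :: "'a::euclidean_space \<Rightarrow> 'b::euclidean_space set"
  defines "\<Omega> \<equiv> {(x, v). x \<in> S v}"
  assumes r: "r > 0" and cl: "closed (\<Omega> \<inter> cball (xbar, vbar) r)"
  shows "lipschitz_like S vbar xbar \<longleftrightarrow>
    (\<forall>u. (0, - u) \<in> approx_normal_cone \<Omega> (xbar, vbar) \<longrightarrow> u = 0)"
proof
  assume "lipschitz_like S vbar xbar"
  then show "\<forall>u. (0, - u) \<in> approx_normal_cone \<Omega> (xbar, vbar) \<longrightarrow> u = 0"
    using lipschitz_like_imp_approx_normal_trivial unfolding \<Omega>_def by blast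
next
  assume triv: "\<forall>u. (0, - u) \<in> approx_normal_cone \<Omega> (xbar, vbar) \<longrightarrow> u = 0"
  show "lipschitz_like S vbar xbar"
  proof (rule ccontr)
    assume nlip: "\<not> lipschitz_like S vbar xbar"
    have "\<exists>u. norm u = 1 \<and> (\<exists>p\<in>\<Omega>. dist p (xbar, vbar) < \<epsilon> \<and>
        (\<exists>\<delta>>0. \<forall>p'\<in>\<Omega>. dist p' p < \<delta> \<longrightarrow> (0, - u) \<bullet> (p' - p) \<le> \<epsilon> * norm (p' - p)))"
      if "\<epsilon> > 0" for \<epsilon>
      using not_lipschitz_like_imp_unit_approx_normal[OF r cl[unfolded \<Omega>_def] nlip that]
      unfolding \<Omega>_def by metis
    then have "\<forall>k. \<exists>u. norm u = 1 \<and> (\<exists>p\<in>\<Omega>. dist p (xbar, vbar) < inverse (real (Suc k)) \<and>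
        (\<exists>\<delta>>0. \<forall>p'\<in>\<Omega>. dist p' p < \<delta> \<longrightarrow> (0, - u) \<bullet> (p' - p) \<le> inverse (real (Suc k)) * norm (p' - p)))"
      by simp
    then obtain u where u: "\<And>k. norm (u k) = 1"
      and up: "\<And>k. \<exists>p\<in>\<Omega>. dist p (xbar, vbar) < inverse (real (Suc k)) \<and>
        (\<exists>\<delta>>0. \<forall>p'\<in>\<Omega>. dist p' p < \<delta> \<longrightarrow> (0, - u k) \<bullet> (p' - p) \<le> inverse (real (Suc k)) * norm (p' - p))"
      by metis
    have "\<forall>k. u k \<in> sphere 0 1" using u by simp
    then obtain l s where l: "l \<in> sphere 0 1" "strict_mono s" "(u \<circ> s) \<longlonglongrightarrow> l"
      using compact_sphere[of 0 1] unfolding compact_def by metis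
    have "(0, - l) \<in> approx_normal_cone \<Omega> (xbar, vbar)"
      unfolding approx_normal_cone_def
    proof (intro CollectI allI impI)
      fix \<epsilon> :: real assume e: "\<epsilon> > 0"
      have s0: "((\<lambda>k. inverse (real (Suc k))) \<circ> s) \<longlonglongrightarrow> 0"
        by (intro LIMSEQ_subseq_LIMSEQ LIMSEQ_inverse_real_of_nat l(2))
      have "\<forall>\<^sub>F k in sequentially. dist (((\<lambda>k. inverse (real (Suc k))) \<circ> s) k) 0 < \<epsilon> / 2 \<and> dist ((u \<circ> s) k) l < \<epsilon> / 2"
        using e by (intro eventually_conj tendstoD[OF s0] tendstoD[OF l(3)]) (rule half_gt_zero, assumption)+
      then obtain j where j: "inverse (real (Suc (s j))) < \<epsilon> / 2" "dist (u (s j)) l < \<epsilon> / 2"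
        by (auto simp: eventually_sequentially)
      define k where "k = s j"
      obtain p \<delta> where p: "p \<in> \<Omega>" "dist p (xbar, vbar) < inverse (real (Suc k))" "\<delta> > 0"
        "\<And>p'. \<lbrakk>p' \<in> \<Omega>; dist p' p < \<delta>\<rbrakk> \<Longrightarrow> (0, - u k) \<bullet> (p' - p) \<le> inverse (real (Suc k)) * norm (p' - p)"
        using up[of k] by blast
      have "(0, - l) \<bullet> (p' - p) \<le> \<epsilon> * norm (p' - p)" if "p' \<in> \<Omega>" "dist p' p < \<delta>" for p'
      proof -
        have "(0, - l) \<bullet> (p' - p) = (0, - u k) \<bullet> (p' - p) + (u k - l) \<bullet> snd (p' - p)"
          by (cases "p' - p") (simp add: inner_diff_left)
        also have "(u k - l) \<bullet> snd (p' - p) \<le> norm (u k - l) * norm (snd (p' - p))"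
          by (rule norm_cauchy_schwarz)
        also have "\<dots> \<le> \<epsilon> / 2 * norm (p' - p)"
        proof (rule mult_mono)
          show "norm (snd (p' - p)) \<le> norm (p' - p)" by (metis norm_snd_le prod.collapse)
        qed (use j(2) e in \<open>auto simp: k_def dist_norm\<close>)
        also have "(0, - u k) \<bullet> (p' - p) \<le> \<epsilon> / 2 * norm (p' - p)"
          using p(4)[OF that] j(1) mult_right_mono[of "inverse (real (Suc k))" "\<epsilon> / 2" "norm (p' - p)"]
          by (simp add: k_def)
        finally show ?thesis by simp
      qed
      then show "\<exists>p\<in>\<Omega>. dist p (xbar, vbar) < \<epsilon> \<and>
          (\<exists>\<delta>>0. \<forall>p'\<in>\<Omega>. dist p' p < \<delta> \<longrightarrow> (0, - l) \<bullet> (p' - p) \<le> \<epsilon> * norm (p' - p))"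
        using p(1-3) j(1) e by (intro bexI[of _ p]) (auto simp: k_def)
    qed
    then have "l = 0" using triv by blast
    then show False using l(1) by simp
  qed
qed

section \<open>Maps that are transversal to a subspace\<close>

text \<open>\<open>inj\<close> is nondegeneracy in dual form: the range of \<open>A\<close> and the
  orthogonal complement of \<open>S\<close> together span the space. The locale is used at
  \<open>xbar\<close> and, for the first-order chain rule, at all nearby points.\<close>

locale transversal =
  fixes \<phi> :: "'a::euclidean_space \<Rightarrow> 'b::euclidean_space" and A xbar S
  assumes strict: "strict_derivative \<phi> A xbar"
    and S: "subspace S"
    and inj: "\<And>y. \<lbrakk>y \<in> S; adjoint A y = 0\<rbrakk> \<Longrightarrow> y = 0"
begin

lemma linear_A: "linear A"
  using strict_derivative_bounded_linear[OF strict] by (rule bounded_linear.linear)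

lemma adjoint_A: "x \<bullet> adjoint A y = A x \<bullet> y"
  by (rule adjoint_works[OF linear_A])

lemma adjoint_A': "adjoint A y \<bullet> x = y \<bullet> A x"
  by (metis adjoint_A inner_commute)

lemma left_inverse:
  obtains L where "linear L" "range L \<subseteq> S" "\<And>y. y \<in> S \<Longrightarrow> L (adjoint A y) = y"
proof -
  have lin: "linear (adjoint A)" by (rule adjoint_linear[OF linear_A])
  have "inj_on (adjoint A) S"
  proof (rule inj_onI)
    fix y y' assume y: "y \<in> S" "y' \<in> S" and eq: "adjoint A y = adjoint A y'"
    have "y - y' = 0"
      by (rule inj) (simp_all add: subspace_diff[OF S y] linear_diff[OF lin] eq)
    then show "y = y'" by simp
  qed
  then show thesis using linear_exists_left_inverse_on[OF lin S] that by metis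
qed

lemma adjoint_lower_bound:
  obtains c where "c > 0" "\<And>y. y \<in> S \<Longrightarrow> norm y \<le> c * norm (adjoint A y)"
proof -
  obtain L where L: "linear L" "range L \<subseteq> S" "\<And>y. y \<in> S \<Longrightarrow> L (adjoint A y) = y"
    by (rule left_inverse) (rule that)
  obtain c where "c > 0" "\<And>x. norm (L x) \<le> c * norm x" using linear_bounded_pos[OF L(1)] by blast
  then show thesis using that L(3) by metis
qed

text \<open>A Lyusternik--Graves theorem modulo \<open>S\<^sup>\<bottom>\<close>, by a simplified Newton iteration with
  a fixed right inverse \<open>R\<close> of \<open>A\<close>.\<close>

lemma open_mapping_modulo:
  obtains C r where "C > 0" "r > 0"
    "\<And>x z. \<lbrakk>x \<in> ball xbar r; norm (z - \<phi> x) < r\<rbrakk>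
       \<Longrightarrow> \<exists>x'. z - \<phi> x' \<in> orthogonal_comp S \<and> norm (x' - x) \<le> C * norm (z - \<phi> x)"
proof -
  obtain L where L: "linear L" "range L \<subseteq> S" "\<And>y. y \<in> S \<Longrightarrow> L (adjoint A y) = y"
    by (rule left_inverse) (rule that)
  \<comment> \<open>As \<open>L\<close> maps into \<open>S\<close> and inverts
    \<open>adjoint A\<close> there, \<open>R\<close> vanishes exactly on the orthogonal complement
    of \<open>S\<close>, and \<open>R A R = R\<close>.\<close>
  define R where "R = adjoint L"
  have R: "h \<bullet> R s = L h \<bullet> s" for h s unfolding R_def by (rule adjoint_works[OF L(1)])
  have lR: "linear R" unfolding R_def by (rule adjoint_linear[OF L(1)])
  have R0: "R w = 0 \<longleftrightarrow> w \<in> orthogonal_comp S" for w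
  proof
    assume w: "R w = 0"
    have "y \<bullet> w = 0" if "y \<in> S" for y using R[of "adjoint A y" w] L(3)[OF that] w by simp
    then show "w \<in> orthogonal_comp S" by (simp add: orthogonal_comp_def orthogonal_def)
  next
    assume "w \<in> orthogonal_comp S"
    then have "L h \<bullet> w = 0" for h using L(2) by (auto simp: orthogonal_comp_def orthogonal_def)
    then have "R w \<bullet> R w = 0" using R by metis
    then show "R w = 0" by simp
  qed
  have RAR: "R (A (R s)) = R s" for s
  proof -
    have "y \<bullet> (s - A (R s)) = 0" if "y \<in> S" for y
      using R[of "adjoint A y" s] L(3)[OF that] adjoint_A'[of y "R s"] by (simp add: inner_diff_right)
    then have "R (s - A (R s)) = 0" unfolding R0 by (simp add: orthogonal_comp_def orthogonal_def)
    then show ?thesis by (simp add: linear_diff[OF lR])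
  qed
  obtain K where K: "K > 0" "\<And>w. norm (R w) \<le> K * norm w" using linear_bounded_pos[OF lR] by blast
  obtain r1 where r1: "r1 > 0" "\<And>x x'. \<lbrakk>x \<in> ball xbar r1; x' \<in> ball xbar r1\<rbrakk>
      \<Longrightarrow> norm (\<phi> x - \<phi> x' - A (x - x')) \<le> (1 / (2 * K)) * norm (x - x')"
    using strict_derivativeD[OF strict, of "1 / (2 * K)"] K(1) by auto
  \<comment> \<open>Iterates move by at most \<open>2 * K * r\<close> from a point of
    \<open>ball xbar r\<close>, so they remain in \<open>ball xbar r1\<close>.\<close>
  define r where "r = r1 / (2 * K + 1)"
  have r: "r > 0" "2 * K * r + r = r1"
    using K(1) r1(1) by (auto simp: r_def divide_simps) (auto simp: algebra_simps)
  show thesis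
  proof (rule that[of "2 * K" r])
    fix x z assume x: "x \<in> ball xbar r" and z: "norm (z - \<phi> x) < r"
    define \<eta> where "\<eta> = K * norm (z - \<phi> x)"
    \<comment> \<open>On \<open>x + range R\<close> the operator \<open>R A\<close> reproduces
      differences of points, so the iteration contracts. The radius is twice the bound \<eta> on the
      first step because the contraction factor is 1/2.\<close>
    define X where "X = (\<lambda>h. x + h) ` range R \<inter> cball x (2 * \<eta>)"
    have eta: "\<eta> \<ge> 0" using K(1) by (simp add: \<eta>_def)
    have eta_r: "2 * \<eta> \<le> 2 * K * r" using z K(1) by (simp add: \<eta>_def)
    have Xb: "X \<subseteq> ball xbar r1"
    proof
      fix x' assume "x' \<in> X"
      then have "dist x x' \<le> 2 * \<eta>" by (simp add: X_def)
      then show "x' \<in> ball xbar r1"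
        using x eta_r r(2) dist_triangle[of xbar x' x] by simp
    qed
    have clX: "complete X"
      unfolding X_def complete_eq_closed
      by (intro closed_Int closed_translation closed_subspace closed_cball)
         (use linear_subspace_image[OF lR subspace_UNIV] in simp)
    have "0 \<in> range R" using linear_0[OF lR] by (metis rangeI)
    then have xX: "x \<in> X" using eta by (auto simp: X_def image_iff)
    \<comment> \<open>Its fixed points are the points at which \<open>z - \<phi> x'\<close> is
      orthogonal to \<open>S\<close>.\<close>
    define T where "T = (\<lambda>x'. x' + R (z - \<phi> x'))"
    have contr: "dist (T a) (T b) \<le> 1 / 2 * dist a b" if ab: "a \<in> X" "b \<in> X" for a b
    proof -
      obtain s1 s2 where "a = x + R s1" "b = x + R s2" using ab by (auto simp: X_def)
      then have "a - b = R (s1 - s2)" by (simp add: linear_diff[OF lR])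
      then have "R (A (a - b)) = a - b" using RAR by metis
      then have "T a - T b = R (- (\<phi> a - \<phi> b - A (a - b)))"
        by (simp add: T_def linear_diff[OF lR] linear_neg[OF lR] linear_add[OF lR])
      then have "norm (T a - T b) \<le> K * norm (\<phi> a - \<phi> b - A (a - b))"
        using K(2)[of "- (\<phi> a - \<phi> b - A (a - b))"] by (simp only: norm_minus_cancel)
      also have "\<dots> \<le> K * ((1 / (2 * K)) * norm (a - b))"
        by (intro mult_left_mono r1(2) subsetD[OF Xb] ab) (use K(1) in simp)
      finally show ?thesis using K(1) by (simp add: dist_norm)
    qed
    have Tx: "dist x (T x) \<le> \<eta>" using K(2)[of "z - \<phi> x"] by (simp add: T_def \<eta>_def dist_norm)
    have "T ` X \<subseteq> X"
    proof
      fix y assume "y \<in> T ` X"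
      then obtain a where a: "a \<in> X" "y = T a" by blast
      then obtain s where "a = x + R s" by (auto simp: X_def)
      then have "y = x + R (s + (z - \<phi> a))" by (simp only: a T_def linear_add[OF lR] add.assoc)
      moreover have "dist x y \<le> 2 * \<eta>"
      proof -
        have "dist x y \<le> dist x (T x) + dist (T x) (T a)" unfolding a by (rule dist_triangle)
        also have "dist (T x) (T a) \<le> 1 / 2 * (2 * \<eta>)"
          using contr[OF xX a(1)] a(1) by (simp add: X_def)
        finally show ?thesis using Tx by simp
      qed
      ultimately show "y \<in> X" by (auto simp: X_def)
    qed
    then obtain x' where x': "x' \<in> X" "T x' = x'"
      using Banach_fix[OF clX _ _ _ _ contr] xX by auto
    then have "z - \<phi> x' \<in> orthogonal_comp S" using R0[of "z - \<phi> x'"] by (simp add: T_def)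
    moreover have "norm (x' - x) \<le> 2 * K * norm (z - \<phi> x)"
      using x'(1) by (simp add: X_def dist_norm norm_minus_commute \<eta>_def)
    ultimately show "\<exists>x'. z - \<phi> x' \<in> orthogonal_comp S \<and> norm (x' - x) \<le> 2 * K * norm (z - \<phi> x)"
      by blast
  qed (use K(1) r(1) in auto)
qed

text \<open>The component \<open>b\<close> of \<open>w\<close> orthogonal to the image of
  \<open>S\<close> under \<open>adjoint A\<close> is mapped by \<open>A\<close> into the orthogonal
  complement of \<open>S\<close>. By hypothesis \<open>w\<close> annihilates it, so it is 0.\<close>

lemma in_adjoint_image:
  assumes "\<And>h. A h \<in> orthogonal_comp S \<Longrightarrow> w \<bullet> h = 0"
  obtains q where "q \<in> S" "adjoint A q = w"
proof -
  have lin: "linear (adjoint A)" by (rule adjoint_linear[OF linear_A])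
  have sub: "subspace (adjoint A ` S)" by (rule linear_subspace_image[OF lin S])
  obtain a b where ab: "a \<in> span (adjoint A ` S)" "\<And>c. c \<in> span (adjoint A ` S) \<Longrightarrow> orthogonal b c" "w = a + b"
    using orthogonal_subspace_decomp_exists[of "adjoint A ` S" w] by metis
  have "A b \<in> orthogonal_comp S"
    unfolding orthogonal_comp_def orthogonal_def
  proof (intro CollectI ballI)
    fix y assume "y \<in> S"
    then have "b \<bullet> adjoint A y = 0" using ab(2)[of "adjoint A y"] by (simp add: span_base orthogonal_def)
    then show "y \<bullet> A b = 0" by (simp add: adjoint_A inner_commute)
  qed
  then have "w \<bullet> b = 0" by (rule assms)
  moreover have "a \<bullet> b = 0" using ab(2)[OF ab(1)] by (simp add: orthogonal_def inner_commute)
  ultimately have "b = 0" by (simp add: ab(3) inner_add_left)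
  then have "w \<in> adjoint A ` S" using ab sub by (simp add: span_eq_iff[THEN iffD2])
  then show thesis using that by blast
qed

text \<open>The source of multipliers. If \<open>A h\<close> is orthogonal to \<open>S\<close>, the
  open mapping theorem corrects \<open>x0 + t *\<^sub>R h\<close> to a point of the fibre of
  \<open>x0\<close> at a cost of order \<open>e * t\<close>. So \<open>w\<close> is nonpositive on
  the subspace of such \<open>h\<close>, hence zero there.\<close>

lemma fibrewise_approx_zero_imp_adjoint_image:
  assumes w: "\<And>\<epsilon>. \<epsilon> > 0 \<Longrightarrow> \<exists>x0. dist x0 xbar < \<epsilon> \<and> (\<exists>\<delta>>0. \<forall>x. dist x x0 < \<delta> \<and>
      \<phi> x - \<phi> x0 \<in> orthogonal_comp S \<longrightarrow> w \<bullet> (x - x0) \<le> \<epsilon> * norm (x - x0))"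
  obtains q where "q \<in> S" "adjoint A q = w"
proof -
  obtain C r where C: "C > 0" and r: "r > 0"
    and open_map: "\<And>x z. \<lbrakk>x \<in> ball xbar r; norm (z - \<phi> x) < r\<rbrakk>
       \<Longrightarrow> \<exists>x'. z - \<phi> x' \<in> orthogonal_comp S \<and> norm (x' - x) \<le> C * norm (z - \<phi> x)"
    using open_mapping_modulo by blast
  have nonpos: "w \<bullet> h \<le> 0" if h: "A h \<in> orthogonal_comp S" for h
  proof (rule ccontr)
    assume "\<not> w \<bullet> h \<le> 0"
    then have wh: "w \<bullet> h > 0" by simp
    then have h0: "norm h > 0" by auto
    \<comment> \<open>Collects the errors of order \<open>e * t\<close>: the slope over a step of
      length at most \<open>t * M\<close>, and \<open>w\<close> applied to the correction.\<close>
    define K where "K = norm h * (norm w * C + (1 + C))"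
    have K: "K > 0" using h0 C by (simp add: K_def add_nonneg_pos)
    define e where "e = min 1 (w \<bullet> h / (2 * K))"
    have e: "e > 0" "e \<le> 1" using wh K by (auto simp: e_def)
    have eK: "e * K < w \<bullet> h"
    proof -
      have "e * K \<le> w \<bullet> h / (2 * K) * K" using K by (intro mult_right_mono) (auto simp: e_def)
      also have "\<dots> < w \<bullet> h" using K wh by simp
      finally show ?thesis .
    qed
    obtain r2 where r2: "r2 > 0" "\<And>x x'. \<lbrakk>x \<in> ball xbar r2; x' \<in> ball xbar r2\<rbrakk>
      \<Longrightarrow> norm (\<phi> x - \<phi> x' - A (x - x')) \<le> e * norm (x - x')"
      using strict_derivativeD[OF strict e(1)] by blast
    define m where "m = min e (min r r2 / 2)"
    have m: "m > 0" "m \<le> e" using e r r2 by (auto simp: m_def)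
    obtain x0 \<delta> where x0: "dist x0 xbar < m" and d: "\<delta> > 0"
      and le: "\<And>x. \<lbrakk>dist x x0 < \<delta>; \<phi> x - \<phi> x0 \<in> orthogonal_comp S\<rbrakk> \<Longrightarrow> w \<bullet> (x - x0) \<le> m * norm (x - x0)"
      using w[OF m(1)] by blast
    define M where "M = (1 + C) * norm h"
    have M: "M > 0" "norm h \<le> M" using C h0 by (auto simp: M_def add_pos_pos)
    define t where "t = min (\<delta> / (2 * M)) (min (r / 2) (r2 / 2) / M)"
    have t: "t > 0" using d r r2 M by (simp add: t_def)
    have "t \<le> \<delta> / (2 * M)" "t \<le> min (r / 2) (r2 / 2) / M"
      unfolding t_def by (rule min.cobounded1, rule min.cobounded2)
    then have "t * M \<le> \<delta> / 2" "t * M \<le> min (r / 2) (r2 / 2)" using M(1) by (simp_all add: pos_le_divide_eq)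
    then have tM: "t * M < \<delta>" "t * M \<le> r / 2" "t * M \<le> r2 / 2" using d by simp_all
    have th: "t * norm h \<le> t * M" using M t by (intro mult_left_mono) auto
    define x1 where "x1 = x0 + t *\<^sub>R h"
    have n1: "norm (x1 - x0) = t * norm h" using t by (simp add: x1_def)
    have x1: "dist xbar x1 < m + t * norm h"
      using dist_triangle[of xbar x1 x0] x0 n1 by (simp add: dist_commute dist_norm norm_minus_commute)
    then have b1: "x1 \<in> ball xbar r" "x1 \<in> ball xbar r2" "x0 \<in> ball xbar r2"
      using th tM x0 r r2 by (auto simp: m_def dist_commute)
    \<comment> \<open>\<open>z\<close> differs from \<open>\<phi> x0\<close> by a vector orthogonal
      to \<open>S\<close>, and from \<open>\<phi> x1\<close> by the linearization error
      only.\<close>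
    define z where "z = \<phi> x0 + A (x1 - x0)"
    have zn: "norm (z - \<phi> x1) \<le> e * (t * norm h)"
    proof -
      have "norm (z - \<phi> x1) = norm (\<phi> x1 - \<phi> x0 - A (x1 - x0))"
        unfolding z_def by (subst norm_minus_commute) (simp add: algebra_simps)
      then show ?thesis using r2(2)[OF b1(2,3)] n1 by simp
    qed
    also have "\<dots> \<le> 1 * (t * norm h)" using e t by (intro mult_right_mono) auto
    also have "\<dots> < r" using th tM(2) r by simp
    finally obtain x' where x': "z - \<phi> x' \<in> orthogonal_comp S" "norm (x' - x1) \<le> C * norm (z - \<phi> x1)"
      using open_map[OF b1(1)] by blast
    have x'1: "norm (x' - x1) \<le> C * (e * (t * norm h))"
      by (rule order_trans[OF x'(2)], rule mult_left_mono[OF zn]) (use C in simp)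
    also have "\<dots> \<le> C * (1 * (t * norm h))" using e t C by (intro mult_left_mono mult_right_mono) auto
    finally have "norm (x' - x1) \<le> C * (t * norm h)" by simp
    then have x'0: "norm (x' - x0) \<le> t * M"
      using norm_triangle_ineq[of "x' - x1" "x1 - x0"] n1 by (simp add: M_def algebra_simps)
    have "\<phi> x' - \<phi> x0 = t *\<^sub>R A h - (z - \<phi> x')"
      by (simp add: z_def x1_def linear_scale[OF linear_A])
    then have "\<phi> x' - \<phi> x0 \<in> orthogonal_comp S"
      by (simp only: subspace_diff[OF subspace_orthogonal_comp subspace_scale[OF subspace_orthogonal_comp h] x'(1)])
    moreover have "dist x' x0 < \<delta>" using x'0 tM(1) unfolding dist_norm by linarith
    ultimately have "w \<bullet> (x' - x0) \<le> m * norm (x' - x0)" by (intro le)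
    also have "\<dots> \<le> e * (t * M)" using x'0 m by (intro mult_mono) auto
    finally have u: "w \<bullet> (x' - x0) \<le> e * (t * M)" .
    have "w \<bullet> (x' - x0) = t * (w \<bullet> h) + w \<bullet> (x' - x1)" by (simp add: x1_def inner_diff_right inner_add_right)
    moreover have "\<bar>w \<bullet> (x' - x1)\<bar> \<le> norm w * (C * (e * (t * norm h)))"
      using Cauchy_Schwarz_ineq2[of w "x' - x1"] mult_left_mono[OF x'1, of "norm w"] by simp
    ultimately have "t * (w \<bullet> h) \<le> e * (t * M) + norm w * (C * (e * (t * norm h)))" using u by linarith
    also have "\<dots> = t * (e * K)" by (simp add: K_def M_def algebra_simps)
    finally have "t * (w \<bullet> h) \<le> t * (e * K)" .
    then have "w \<bullet> h \<le> e * K" using t by (rule mult_left_le_imp_le)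
    then show False using eK by simp
  qed
  show thesis
  proof (rule in_adjoint_image[of w])
    fix h assume h: "A h \<in> orthogonal_comp S"
    then have "A (- h) \<in> orthogonal_comp S"
      using subspace_neg[OF subspace_orthogonal_comp h] by (simp add: linear_neg[OF linear_A])
    from nonpos[OF this] nonpos[OF h] show "w \<bullet> h = 0" by simp
  qed (rule that)
qed

end

section \<open>Normals to the preimage of an invariant set\<close>

context transversal
begin

lemma orthogonal_S: "\<lbrakk>q \<in> S; z \<in> orthogonal_comp S\<rbrakk> \<Longrightarrow> q \<bullet> z = 0"
  by (simp add: orthogonal_comp_def orthogonal_def)

lemma linearization_error:
  assumes "norm (\<phi> x - \<phi> x' - A (x - x')) \<le> \<epsilon> * norm (x - x')"
  shows "\<bar>q \<bullet> (\<phi> x - \<phi> x') - adjoint A q \<bullet> (x - x')\<bar> \<le> norm q * (\<epsilon> * norm (x - x'))"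
proof -
  have "q \<bullet> (\<phi> x - \<phi> x') - adjoint A q \<bullet> (x - x') = q \<bullet> (\<phi> x - \<phi> x' - A (x - x'))"
    by (simp add: adjoint_A' inner_diff_right linear_diff[OF linear_A])
  also have "\<bar>\<dots>\<bar> \<le> norm q * norm (\<phi> x - \<phi> x' - A (x - x'))" by (rule Cauchy_Schwarz_ineq2)
  also have "\<dots> \<le> norm q * (\<epsilon> * norm (x - x'))" using assms by (intro mult_left_mono) auto
  finally show ?thesis .
qed

text \<open>Forward, \<open>inv\<close> allows \<open>y\<close> to be frozen while \<open>x\<close>
  moves in a fibre, which produces \<open>q\<close>; points of \<open>\<Gamma>\<close> are then
  tested by lifting them through the open mapping theorem. Backward, increments of
  \<open>\<phi>\<close> are copied at a point \<open>z0\<close> of the base, and \<open>inv\<close>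
  puts the copies into \<open>\<Gamma>\<close>; this works for every \<open>q\<close>, in
  \<open>S\<close> or not.\<close>

lemma approx_normal_cone_preimage:
  fixes \<Gamma> :: "('b \<times> 'c::euclidean_space) set"
  assumes r: "r > 0"
    and inv: "\<And>z z' y. \<lbrakk>(z, y) \<in> \<Gamma>; z \<in> ball (\<phi> xbar) r; z' \<in> ball (\<phi> xbar) r; z - z' \<in> orthogonal_comp S\<rbrakk>
       \<Longrightarrow> (z', y) \<in> \<Gamma>"
  shows "(w, p) \<in> approx_normal_cone {(x, y). (\<phi> x, y) \<in> \<Gamma>} (xbar, ybar) \<longleftrightarrow>
    (\<exists>q. adjoint A q = w \<and> (q, p) \<in> approx_normal_cone \<Gamma> (\<phi> xbar, ybar))"
    (is "_ \<in> approx_normal_cone ?\<Lambda> _ \<longleftrightarrow> ?R")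
proof -
  obtain r1 L where r1: "r1 > 0" and L: "L > 0"
    and lip: "\<And>x x'. \<lbrakk>x \<in> ball xbar r1; x' \<in> ball xbar r1\<rbrakk> \<Longrightarrow> norm (\<phi> x - \<phi> x') \<le> L * norm (x - x')"
    by (rule strict_derivative_lipschitz[OF strict]) (rule that)
  obtain C r3 where C: "C > 0" and r3: "r3 > 0"
    and open_map: "\<And>x z. \<lbrakk>x \<in> ball xbar r3; norm (z - \<phi> x) < r3\<rbrakk>
       \<Longrightarrow> \<exists>x'. z - \<phi> x' \<in> orthogonal_comp S \<and> norm (x' - x) \<le> C * norm (z - \<phi> x)"
    by (rule open_mapping_modulo) (rule that)
  define R where "R = min (min r1 r3) (r / L)"
  have R: "R > 0" "R \<le> r1" "R \<le> r3" using r r1 r3 L by (auto simp: R_def)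
  have "R \<le> r / L" by (simp add: R_def)
  then have RL: "L * R \<le> r" using L by (simp add: pos_le_divide_eq mult.commute)
  have \<phi>_ball: "\<phi> x \<in> ball (\<phi> xbar) r" if "x \<in> ball xbar R" for x
  proof -
    have "norm (\<phi> x - \<phi> xbar) \<le> L * norm (x - xbar)" using that R r1 by (intro lip) auto
    also have "\<dots> < L * R" using that L by (simp add: dist_norm norm_minus_commute)
    finally show ?thesis using RL by (simp add: dist_norm norm_minus_commute)
  qed
  have orth_neg: "b - a \<in> orthogonal_comp S" if "a - b \<in> orthogonal_comp S" for a b
    using subspace_neg[OF subspace_orthogonal_comp that] by simp
  show ?thesis
  proof
    assume n: "(w, p) \<in> approx_normal_cone ?\<Lambda> (xbar, ybar)"
    have lift: "\<exists>x0 y0. dist x0 xbar < \<epsilon> \<and> dist y0 ybar < \<epsilon> \<and> (\<phi> x0, y0) \<in> \<Gamma> \<and>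
        (\<exists>\<delta>>0. \<forall>x y. (\<phi> x, y) \<in> \<Gamma> \<longrightarrow> norm (x - x0) + norm (y - y0) < \<delta> \<longrightarrow>
           w \<bullet> (x - x0) + p \<bullet> (y - y0) \<le> \<epsilon> * (norm (x - x0) + norm (y - y0)))" if e: "\<epsilon> > 0" for \<epsilon>
    proof -
      obtain p0 \<delta> where p0: "p0 \<in> ?\<Lambda>" "dist p0 (xbar, ybar) < \<epsilon>" "\<delta> > 0"
        "\<And>p'. \<lbrakk>p' \<in> ?\<Lambda>; dist p' p0 < \<delta>\<rbrakk> \<Longrightarrow> (w, p) \<bullet> (p' - p0) \<le> \<epsilon> * norm (p' - p0)"
        by (rule approx_normal_coneD[OF n e]) (rule that)
      obtain x0 y0 where eq: "p0 = (x0, y0)" by force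
      have "w \<bullet> (x - x0) + p \<bullet> (y - y0) \<le> \<epsilon> * (norm (x - x0) + norm (y - y0))"
        if xy: "(\<phi> x, y) \<in> \<Gamma>" "norm (x - x0) + norm (y - y0) < \<delta>" for x y
      proof -
        have nn: "norm ((x, y) - p0) \<le> norm (x - x0) + norm (y - y0)"
          using norm_Pair_le_add[of "x - x0" "y - y0"] by (simp add: eq)
        then have "(w, p) \<bullet> ((x, y) - p0) \<le> \<epsilon> * norm ((x, y) - p0)"
          using xy by (intro p0(4)) (auto simp: dist_norm)
        also have "\<dots> \<le> \<epsilon> * (norm (x - x0) + norm (y - y0))" using nn e by (intro mult_left_mono) auto
        finally show ?thesis by (simp add: eq)
      qed
      moreover have "dist x0 xbar < \<epsilon>" "dist y0 ybar < \<epsilon>"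
        using p0(2) dist_fst_le[of p0 "(xbar, ybar)"] dist_snd_le[of p0 "(xbar, ybar)"] by (simp_all add: eq)
      ultimately show ?thesis using p0(1,3) by (auto simp: eq)
    qed
    obtain q where q: "q \<in> S" "adjoint A q = w"
    proof (rule fibrewise_approx_zero_imp_adjoint_image)
      fix \<epsilon> :: real assume e: "\<epsilon> > 0"
      have m: "min \<epsilon> (R / 2) > 0" using e R by simp
      obtain x0 y0 \<delta> where x0: "dist x0 xbar < min \<epsilon> (R / 2)" "(\<phi> x0, y0) \<in> \<Gamma>" "\<delta> > 0"
        and le: "\<And>x y. \<lbrakk>(\<phi> x, y) \<in> \<Gamma>; norm (x - x0) + norm (y - y0) < \<delta>\<rbrakk> \<Longrightarrow>
           w \<bullet> (x - x0) + p \<bullet> (y - y0) \<le> min \<epsilon> (R / 2) * (norm (x - x0) + norm (y - y0))"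
        using lift[OF m] by blast
      have "w \<bullet> (x - x0) \<le> \<epsilon> * norm (x - x0)"
        if x: "dist x x0 < min \<delta> (R / 2)" "\<phi> x - \<phi> x0 \<in> orthogonal_comp S" for x
      proof -
        have "dist x xbar < R" using dist_triangle[of x xbar x0] x(1) x0(1) by simp
        then have "x \<in> ball xbar R" "x0 \<in> ball xbar R" using x0(1) R(1) by (simp_all add: dist_commute)
        then have "(\<phi> x, y0) \<in> \<Gamma>" using inv[OF x0(2)] \<phi>_ball orth_neg[OF x(2)] by blast
        then have "w \<bullet> (x - x0) \<le> min \<epsilon> (R / 2) * norm (x - x0)"
          using le[of x y0] x(1) by (simp add: dist_norm)
        also have "\<dots> \<le> \<epsilon> * norm (x - x0)" by (intro mult_right_mono) auto
        finally show ?thesis .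
      qed
      moreover have "min \<delta> (R / 2) > 0" using x0(3) R by simp
      ultimately show "\<exists>x0. dist x0 xbar < \<epsilon> \<and> (\<exists>\<delta>>0. \<forall>x. dist x x0 < \<delta> \<and>
          \<phi> x - \<phi> x0 \<in> orthogonal_comp S \<longrightarrow> w \<bullet> (x - x0) \<le> \<epsilon> * norm (x - x0))"
        using x0(1) by (metis min_less_iff_conj)
    qed (rule that)
    have "(q, p) \<in> approx_normal_cone \<Gamma> (\<phi> xbar, ybar)"
      unfolding approx_normal_cone_def
    proof (intro CollectI allI impI)
      fix e :: real assume e: "e > 0"
      \<comment> \<open>\<open>C + 1\<close> bounds the step to the lifted point relative to the
        step in \<open>\<Gamma>\<close>; \<open>norm q * C\<close> accounts for the linearization
        error.\<close>
      define K where "K = (1 + norm q) * C + 1"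
      have K: "K > 0" using C by (simp add: K_def add_nonneg_pos)
      define \<epsilon>1 where "\<epsilon>1 = e / K"
      have e1: "\<epsilon>1 > 0" "\<epsilon>1 * K = e" using e K by (simp_all add: \<epsilon>1_def)
      obtain r2 where r2: "r2 > 0" and str: "\<And>x x'. \<lbrakk>x \<in> ball xbar r2; x' \<in> ball xbar r2\<rbrakk>
          \<Longrightarrow> norm (\<phi> x - \<phi> x' - A (x - x')) \<le> \<epsilon>1 * norm (x - x')"
        by (rule strict_derivativeD[OF strict e1(1)]) (rule that)
      define \<rho> where "\<rho> = min R r2"
      have \<rho>: "\<rho> > 0" "\<rho> \<le> R" "\<rho> \<le> r2" using R r2 by (auto simp: \<rho>_def)
      define \<eta> where "\<eta> = min (min \<epsilon>1 (\<rho> / 2)) (e / (L + 1))"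
      have eta: "\<eta> > 0" "\<eta> \<le> \<epsilon>1" "\<eta> \<le> \<rho> / 2" using e1(1) e \<rho> L by (auto simp: \<eta>_def simp del: le_divide_eq_numeral1)
      have "\<eta> \<le> e / (L + 1)" by (simp add: \<eta>_def)
      then have Leta: "L * \<eta> + \<eta> \<le> e" using L by (simp add: pos_le_divide_eq algebra_simps)
      obtain x0 y0 \<delta> where x0: "dist x0 xbar < \<eta>" "dist y0 ybar < \<eta>" "(\<phi> x0, y0) \<in> \<Gamma>" "\<delta> > 0"
        and le: "\<And>x y. \<lbrakk>(\<phi> x, y) \<in> \<Gamma>; norm (x - x0) + norm (y - y0) < \<delta>\<rbrakk> \<Longrightarrow>
           w \<bullet> (x - x0) + p \<bullet> (y - y0) \<le> \<eta> * (norm (x - x0) + norm (y - y0))"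
        using lift[OF eta(1)] by blast
      have x0b: "x0 \<in> ball xbar (\<rho> / 2)" using x0(1) eta by (simp add: dist_commute)
      have "norm (\<phi> x0 - \<phi> xbar) \<le> L * norm (x0 - xbar)" using x0b \<rho> R r1 by (intro lip) auto
      also have "\<dots> < L * \<eta>" using x0(1) L by (simp add: dist_norm)
      finally have "norm (\<phi> x0 - \<phi> xbar) < L * \<eta>" .
      then have near: "dist (\<phi> x0, y0) (\<phi> xbar, ybar) < e"
        using norm_Pair_le_add[of "\<phi> x0 - \<phi> xbar" "y0 - ybar"] x0(2) Leta by (simp add: dist_norm)
      define \<delta>' where "\<delta>' = min (min R (r - dist (\<phi> xbar) (\<phi> x0))) (min \<delta> (\<rho> / 2) / (C + 1))"
      have "x0 \<in> ball xbar R" using x0b \<rho> R by simp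
      then have "\<phi> x0 \<in> ball (\<phi> xbar) r" by (rule \<phi>_ball)
      then have \<delta>': "\<delta>' > 0" using \<rho> R x0(4) C by (simp add: \<delta>'_def)
      have "(q, p) \<bullet> (g - (\<phi> x0, y0)) \<le> e * norm (g - (\<phi> x0, y0))"
        if g: "g \<in> \<Gamma>" "dist g (\<phi> x0, y0) < \<delta>'" for g
      proof -
        obtain z y where g_eq: "g = (z, y)" by force
        define N where "N = norm (g - (\<phi> x0, y0))"
        have N: "norm (z - \<phi> x0) \<le> N" "norm (y - y0) \<le> N"
          using norm_fst_le[of "z - \<phi> x0" "y - y0"] norm_snd_le[of "y - y0" "z - \<phi> x0"]
          by (simp_all add: N_def g_eq)
        have Nd: "N < \<delta>'" using g(2) by (simp add: N_def dist_norm)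
        then have Nd1: "N < R" "N < r - dist (\<phi> xbar) (\<phi> x0)" "N < min \<delta> (\<rho> / 2) / (C + 1)"
          by (simp_all add: \<delta>'_def)
        have "N * (C + 1) < min \<delta> (\<rho> / 2)" using Nd1(3) C by (simp add: pos_less_divide_eq)
        then have NC: "C * N + N < \<delta>" "C * N + N < \<rho> / 2" by (simp_all add: algebra_simps)
        have "norm (z - \<phi> x0) < r3" using N(1) Nd1(1) R(3) by linarith
        moreover have "x0 \<in> ball xbar r3" using x0b \<rho> R by simp
        ultimately obtain x where x: "z - \<phi> x \<in> orthogonal_comp S" "norm (x - x0) \<le> C * norm (z - \<phi> x0)"
          using open_map by blast
        have xN: "norm (x - x0) \<le> C * N" using x(2) mult_left_mono[OF N(1) less_imp_le[OF C]] by linarith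
        have N0: "N \<ge> 0" by (simp add: N_def)
        have "dist x xbar < \<rho>"
          using dist_triangle[of x xbar x0] xN NC(2) N0 x0b by (simp add: dist_norm norm_minus_commute)
        then have xb: "x \<in> ball xbar R" "x \<in> ball xbar r2" "x0 \<in> ball xbar r2"
          using \<rho> x0b by (simp_all add: dist_commute)
        have "z \<in> ball (\<phi> xbar) r"
          using dist_triangle[of "\<phi> xbar" z "\<phi> x0"] N(1) Nd1(2) by (simp add: dist_norm norm_minus_commute)
        then have "(\<phi> x, y) \<in> \<Gamma>" using inv[of z y "\<phi> x"] g(1) \<phi>_ball[OF xb(1)] x(1) by (simp add: g_eq)
        then have "w \<bullet> (x - x0) + p \<bullet> (y - y0) \<le> \<eta> * (norm (x - x0) + norm (y - y0))"
          using xN N(2) NC(1) by (intro le) auto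
        also have "\<dots> \<le> \<epsilon>1 * (C * N + N)" using xN N(2) eta e1 by (intro mult_mono add_mono) auto
        finally have 1: "w \<bullet> (x - x0) + p \<bullet> (y - y0) \<le> \<epsilon>1 * (C * N + N)" .
        \<comment> \<open>The lifted point reaches \<open>z\<close> only modulo the orthogonal
          complement of \<open>S\<close>; a multiplier in \<open>S\<close> does not see the
          difference.\<close>
        have "q \<bullet> (z - \<phi> x0) = q \<bullet> (\<phi> x - \<phi> x0)"
          using orthogonal_S[OF q(1) x(1)] by (simp add: inner_diff_right)
        also have "\<dots> \<le> w \<bullet> (x - x0) + norm q * (\<epsilon>1 * norm (x - x0))"
          using linearization_error[OF str[OF xb(2,3)], of q] unfolding q(2) by linarith
        also have "norm q * (\<epsilon>1 * norm (x - x0)) \<le> norm q * (\<epsilon>1 * (C * N))"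
          using xN e1 by (intro mult_left_mono) auto
        finally have "q \<bullet> (z - \<phi> x0) + p \<bullet> (y - y0) \<le> \<epsilon>1 * (C * N + N) + norm q * (\<epsilon>1 * (C * N))"
          using 1 by linarith
        also have "\<dots> = (\<epsilon>1 * K) * N" by (simp add: K_def algebra_simps)
        finally show ?thesis by (simp add: g_eq e1 N_def)
      qed
      then show "\<exists>p0\<in>\<Gamma>. dist p0 (\<phi> xbar, ybar) < e \<and>
          (\<exists>\<delta>>0. \<forall>p'\<in>\<Gamma>. dist p' p0 < \<delta> \<longrightarrow> (q, p) \<bullet> (p' - p0) \<le> e * norm (p' - p0))"
        using x0(3) near \<delta>' by blast
    qed
    then show ?R using q(2) by blast
  next
    assume ?R
    then obtain q where q: "adjoint A q = w" and n: "(q, p) \<in> approx_normal_cone \<Gamma> (\<phi> xbar, ybar)" by blast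
    show "(w, p) \<in> approx_normal_cone ?\<Lambda> (xbar, ybar)"
      unfolding approx_normal_cone_def
    proof (intro CollectI allI impI)
      fix e :: real assume e: "e > 0"
      define K where "K = L + 1 + norm q"
      have K: "K > 0" using L by (simp add: K_def add_pos_nonneg)
      define \<epsilon>1 where "\<epsilon>1 = e / K"
      have e1: "\<epsilon>1 > 0" "\<epsilon>1 * K = e" using e K by (simp_all add: \<epsilon>1_def)
      obtain r2 where r2: "r2 > 0" and str: "\<And>x x'. \<lbrakk>x \<in> ball xbar r2; x' \<in> ball xbar r2\<rbrakk>
          \<Longrightarrow> norm (\<phi> x - \<phi> x' - A (x - x')) \<le> \<epsilon>1 * norm (x - x')"
        by (rule strict_derivativeD[OF strict e1(1)]) (rule that)
      define \<rho> where "\<rho> = min R r2"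
      have \<rho>: "\<rho> > 0" "\<rho> \<le> R" "\<rho> \<le> r2" using R r2 by (auto simp: \<rho>_def)
      define \<eta> where "\<eta> = min (min \<epsilon>1 (min r3 (r / 2))) (min e (\<rho> / 2) / (C + 1))"
      have eta: "\<eta> > 0" "\<eta> \<le> \<epsilon>1" "\<eta> \<le> r3" "\<eta> \<le> r / 2" using e1(1) e \<rho> r r3 C by (auto simp: \<eta>_def simp del: le_divide_eq_numeral1)
      have "\<eta> \<le> min e (\<rho> / 2) / (C + 1)" by (simp add: \<eta>_def)
      then have "\<eta> * (C + 1) \<le> min e (\<rho> / 2)" using C by (simp add: pos_le_divide_eq)
      then have Ceta: "C * \<eta> + \<eta> \<le> e" "C * \<eta> + \<eta> \<le> \<rho> / 2" by (simp_all add: algebra_simps)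
      obtain p0 \<delta> where p0: "p0 \<in> \<Gamma>" "dist p0 (\<phi> xbar, ybar) < \<eta>" "\<delta> > 0"
        "\<And>p'. \<lbrakk>p' \<in> \<Gamma>; dist p' p0 < \<delta>\<rbrakk> \<Longrightarrow> (q, p) \<bullet> (p' - p0) \<le> \<eta> * norm (p' - p0)"
        by (rule approx_normal_coneD[OF n eta(1)]) (rule that)
      obtain z0 y0 where eq: "p0 = (z0, y0)" by force
      have d0: "dist z0 (\<phi> xbar) < \<eta>" "dist y0 ybar < \<eta>"
        using p0(2) dist_fst_le[of p0 "(\<phi> xbar, ybar)"] dist_snd_le[of p0 "(\<phi> xbar, ybar)"] by (simp_all add: eq)
      have "norm (z0 - \<phi> xbar) < r3" using d0(1) eta by (simp add: dist_norm)
      then obtain x0 where x0: "z0 - \<phi> x0 \<in> orthogonal_comp S" "norm (x0 - xbar) \<le> C * norm (z0 - \<phi> xbar)"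
        using open_map[of xbar z0] r3 by auto
      note x0(2)
      also have "C * norm (z0 - \<phi> xbar) < C * \<eta>" using d0(1) C by (simp add: dist_norm)
      finally have x0C: "norm (x0 - xbar) < C * \<eta>" .
      then have x0b: "x0 \<in> ball xbar (\<rho> / 2)" using Ceta eta(1) by (simp add: dist_norm norm_minus_commute)
      have z0b: "z0 \<in> ball (\<phi> xbar) (r / 2)" using d0(1) eta by (simp add: dist_commute)
      have "x0 \<in> ball xbar R" using x0b \<rho> by simp
      then have x0\<Gamma>: "(\<phi> x0, y0) \<in> \<Gamma>"
        using inv[of z0 y0 "\<phi> x0"] p0(1) z0b r \<phi>_ball x0(1) by (simp add: eq)
      have near: "dist (x0, y0) (xbar, ybar) < e"
        using norm_Pair_le_add[of "x0 - xbar" "y0 - ybar"] x0C d0(2) Ceta by (simp add: dist_norm)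
      define \<delta>' where "\<delta>' = min (\<rho> / 2) (min \<delta> (r / 2) / (L + 1))"
      have \<delta>': "\<delta>' > 0" using \<rho> r p0(3) L by (simp add: \<delta>'_def)
      have "(w, p) \<bullet> (g - (x0, y0)) \<le> e * norm (g - (x0, y0))"
        if g: "g \<in> ?\<Lambda>" "dist g (x0, y0) < \<delta>'" for g
      proof -
        obtain x y where g_eq: "g = (x, y)" by force
        define N where "N = norm (g - (x0, y0))"
        have N: "norm (x - x0) \<le> N" "norm (y - y0) \<le> N"
          using norm_fst_le[of "x - x0" "y - y0"] norm_snd_le[of "y - y0" "x - x0"]
          by (simp_all add: N_def g_eq)
        have N0: "N \<ge> 0" by (simp add: N_def)
        have "N < \<delta>'" using g(2) by (simp add: N_def dist_norm)
        then have Nd1: "N < \<rho> / 2" "N < min \<delta> (r / 2) / (L + 1)" by (simp_all add: \<delta>'_def)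
        have "N * (L + 1) < min \<delta> (r / 2)" using Nd1(2) L by (simp add: pos_less_divide_eq)
        then have NL: "L * N + N < \<delta>" "L * N + N < r / 2" by (simp_all add: algebra_simps)
        have "dist x xbar < \<rho>"
          using dist_triangle[of x xbar x0] N(1) Nd1(1) x0b by (simp add: dist_norm norm_minus_commute)
        then have xb: "x \<in> ball xbar R" "x \<in> ball xbar r2" "x0 \<in> ball xbar r2" "x \<in> ball xbar r1" "x0 \<in> ball xbar r1"
          using \<rho> x0b R by (simp_all add: dist_commute)
        have "norm (\<phi> x - \<phi> x0) \<le> L * norm (x - x0)" by (rule lip[OF xb(4,5)])
        also have "\<dots> \<le> L * N" using N(1) L by (intro mult_left_mono) auto
        finally have \<phi>N: "norm (\<phi> x - \<phi> x0) \<le> L * N" .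
        \<comment> \<open>The increment is added to \<open>z0\<close> and not to
          \<open>\<phi> x0\<close>, since the normal inequality is available at \<open>p0\<close>
          only. The difference of \<open>\<phi> x\<close> and \<open>z\<close> is the fixed vector
          \<open>\<phi> x0 - z0\<close>, orthogonal to \<open>S\<close>.\<close>
        define z where "z = z0 + (\<phi> x - \<phi> x0)"
        have "dist (\<phi> xbar) z < r"
          using dist_triangle[of "\<phi> xbar" z z0] z0b \<phi>N NL(2) N0 by (simp add: z_def dist_norm norm_minus_commute[of "\<phi> x0"])
        moreover have "\<phi> x - z \<in> orthogonal_comp S"
          using orth_neg[OF x0(1)] by (simp add: z_def)
        ultimately have z\<Gamma>: "(z, y) \<in> \<Gamma>"
          using inv[of "\<phi> x" y z] g(1) \<phi>_ball[OF xb(1)] by (simp add: g_eq)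
        have zn: "norm ((z, y) - p0) \<le> L * N + N"
          using norm_Pair_le_add[of "z - z0" "y - y0"] \<phi>N N(2) by (simp add: eq z_def)
        then have "(q, p) \<bullet> ((z, y) - p0) \<le> \<eta> * norm ((z, y) - p0)"
          using NL(1) by (intro p0(4)[OF z\<Gamma>]) (simp add: dist_norm)
        also have "\<dots> \<le> \<epsilon>1 * (L * N + N)" using zn eta e1 by (intro mult_mono) auto
        finally have 1: "q \<bullet> (\<phi> x - \<phi> x0) + p \<bullet> (y - y0) \<le> \<epsilon>1 * (L * N + N)" by (simp add: eq z_def)
        have "w \<bullet> (x - x0) \<le> q \<bullet> (\<phi> x - \<phi> x0) + norm q * (\<epsilon>1 * norm (x - x0))"
          using linearization_error[OF str[OF xb(2,3)], of q] unfolding q by linarith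
        also have "norm q * (\<epsilon>1 * norm (x - x0)) \<le> norm q * (\<epsilon>1 * N)"
          using N(1) e1 by (intro mult_left_mono) auto
        finally have "w \<bullet> (x - x0) + p \<bullet> (y - y0) \<le> \<epsilon>1 * (L * N + N) + norm q * (\<epsilon>1 * N)" using 1 by linarith
        also have "\<dots> = (\<epsilon>1 * K) * N" by (simp add: K_def algebra_simps)
        finally show ?thesis by (simp add: g_eq e1 N_def)
      qed
      moreover have "(x0, y0) \<in> ?\<Lambda>" using x0\<Gamma> by simp
      ultimately show "\<exists>p0\<in>?\<Lambda>. dist p0 (xbar, ybar) < e \<and>
          (\<exists>\<delta>>0. \<forall>p'\<in>?\<Lambda>. dist p' p0 < \<delta> \<longrightarrow> (w, p) \<bullet> (p' - p0) \<le> e * norm (p' - p0))"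
        using near \<delta>' by blast
    qed
  qed
qed

end

section \<open>Convex piecewise linear functions\<close>

locale piecewise_linear =
  fixes \<theta> :: "'b::euclidean_space \<Rightarrow> ereal" and I J :: "nat set" and a \<alpha> d \<beta>
  assumes finite_I: "finite I" and I_ne: "I \<noteq> {}" and finite_J: "finite J"
    and dom: "edom \<theta> = {z. \<forall>i\<in>J. d i \<bullet> z \<le> \<beta> i}"
    and val: "\<And>z. z \<in> edom \<theta> \<Longrightarrow> \<theta> z = ereal (Max ((\<lambda>i. a i \<bullet> z - \<alpha> i) ` I))"
    and out: "\<And>z. z \<notin> edom \<theta> \<Longrightarrow> \<theta> z = \<infinity>"
begin

definition max_affine where "max_affine z = Max ((\<lambda>i. a i \<bullet> z - \<alpha> i) ` I)"

lemma \<theta>_eq: "z \<in> edom \<theta> \<Longrightarrow> \<theta> z = ereal (max_affine z)"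
  by (simp add: val max_affine_def)

lemma max_affine_ge: "i \<in> I \<Longrightarrow> a i \<bullet> z - \<alpha> i \<le> max_affine z"
  unfolding max_affine_def using finite_I by (intro Max_ge) auto

lemma max_affine_attained: obtains i where "i \<in> I" "max_affine z = a i \<bullet> z - \<alpha> i"
proof -
  have "max_affine z \<in> (\<lambda>i. a i \<bullet> z - \<alpha> i) ` I"
    unfolding max_affine_def using finite_I I_ne by (intro Max_in) auto
  then show thesis using that by blast
qed

lemma max_affine_le: "(\<And>i. i \<in> I \<Longrightarrow> a i \<bullet> z - \<alpha> i \<le> c) \<Longrightarrow> max_affine z \<le> c"
  by (metis max_affine_attained)

lemma not_MInfty: "\<theta> z \<noteq> -\<infinity>"
  using \<theta>_eq out by (cases "z \<in> edom \<theta>") auto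

lemma finite_iff: "\<bar>\<theta> z\<bar> \<noteq> \<infinity> \<longleftrightarrow> z \<in> edom \<theta>"
  using \<theta>_eq out by (cases "z \<in> edom \<theta>") auto

lemma segment:
  assumes "z \<in> edom \<theta>" "z' \<in> edom \<theta>" "0 \<le> t" "t \<le> 1"
  shows "z + t *\<^sub>R (z' - z) \<in> edom \<theta>" "max_affine (z + t *\<^sub>R (z' - z)) \<le> (1 - t) * max_affine z + t * max_affine z'"
proof -
  have eq: "c \<bullet> (z + t *\<^sub>R (z' - z)) = (1 - t) * (c \<bullet> z) + t * (c \<bullet> z')" for c
    by (simp add: inner_add_right inner_diff_right algebra_simps)
  show "z + t *\<^sub>R (z' - z) \<in> edom \<theta>"
    unfolding dom
  proof (intro CollectI ballI)
    fix i assume i: "i \<in> J"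
    have "(1 - t) * (d i \<bullet> z) + t * (d i \<bullet> z') \<le> (1 - t) * \<beta> i + t * \<beta> i"
      using assms i by (intro add_mono mult_left_mono) (auto simp: dom)
    then show "d i \<bullet> (z + t *\<^sub>R (z' - z)) \<le> \<beta> i" by (simp add: eq algebra_simps)
  qed
  show "max_affine (z + t *\<^sub>R (z' - z)) \<le> (1 - t) * max_affine z + t * max_affine z'"
  proof (rule max_affine_le)
    fix i assume i: "i \<in> I"
    have "(1 - t) * (a i \<bullet> z - \<alpha> i) + t * (a i \<bullet> z' - \<alpha> i) \<le> (1 - t) * max_affine z + t * max_affine z'"
      using assms max_affine_ge[OF i] by (intro add_mono mult_left_mono) auto
    then show "a i \<bullet> (z + t *\<^sub>R (z' - z)) - \<alpha> i \<le> (1 - t) * max_affine z + t * max_affine z'"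
      by (simp add: eq algebra_simps)
  qed
qed

text \<open>Along the segment to \<open>z'\<close> the increments of the minorant scale linearly in
  \<open>t\<close>, while convexity bounds \<theta> by the chord. This removes the radius \<delta>,
  which in the chain rule depends on a moving base point and may shrink to 0.\<close>

lemma local_minorant_global:
  assumes z: "\<theta> z = ereal t0" and \<delta>: "\<delta> > 0"
    and le: "\<And>z'. dist z' z < \<delta> \<Longrightarrow> ereal (t0 + y \<bullet> (z' - z) - \<epsilon> * norm (z' - z)) \<le> \<theta> z'"
  shows "ereal (t0 + y \<bullet> (z' - z) - \<epsilon> * norm (z' - z)) \<le> \<theta> z'"
proof (cases "z' \<in> edom \<theta>")
  case False then show ?thesis by (simp add: out)
next
  case z': True
  have zd: "z \<in> edom \<theta>" using z finite_iff[of z] by simp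
  then have t0: "t0 = max_affine z" using z \<theta>_eq by simp
  define t where "t = min 1 (\<delta> / (2 * (norm (z' - z) + 1)))"
  have n: "norm (z' - z) + 1 > 0" by (simp add: add_nonneg_pos)
  have t: "0 < t" "t \<le> 1" using \<delta> n by (auto simp: t_def)
  have "t * norm (z' - z) < t * (norm (z' - z) + 1)" using t by simp
  also have "\<dots> \<le> \<delta> / (2 * (norm (z' - z) + 1)) * (norm (z' - z) + 1)"
    using n by (intro mult_right_mono) (auto simp: t_def)
  also have "\<dots> = \<delta> / 2" using n by (simp add: field_simps)
  finally have "dist (z + t *\<^sub>R (z' - z)) z < \<delta>" using t \<delta> by (simp add: dist_norm)
  from le[OF this] have "t0 + t * (y \<bullet> (z' - z)) - \<epsilon> * (t * norm (z' - z)) \<le> max_affine (z + t *\<^sub>R (z' - z))"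
    using segment(1)[OF zd z' less_imp_le[OF t(1)] t(2)] t by (simp add: \<theta>_eq)
  also have "\<dots> \<le> (1 - t) * max_affine z + t * max_affine z'"
    using segment(2)[OF zd z' less_imp_le[OF t(1)] t(2)] .
  finally have "t * (t0 + y \<bullet> (z' - z) - \<epsilon> * norm (z' - z)) \<le> t * max_affine z'"
    by (simp add: t0 algebra_simps)
  then have "t0 + y \<bullet> (z' - z) - \<epsilon> * norm (z' - z) \<le> max_affine z'" using t(1) by (rule mult_left_le_imp_le)
  then show ?thesis using z' by (simp add: \<theta>_eq)
qed

lemma convex_subdiff_iff:
  "y \<in> convex_subdiff \<theta> z \<longleftrightarrow> z \<in> edom \<theta> \<and> (\<forall>z'\<in>edom \<theta>. max_affine z + y \<bullet> (z' - z) \<le> max_affine z')"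
proof (cases "z \<in> edom \<theta>")
  case False then show ?thesis using finite_iff[of z] by (simp add: convex_subdiff_def)
next
  case True
  have "ereal (max_affine z) + ereal (y \<bullet> (z' - z)) \<le> \<theta> z' \<longleftrightarrow> (z' \<in> edom \<theta> \<longrightarrow> max_affine z + y \<bullet> (z' - z) \<le> max_affine z')" for z'
    by (cases "z' \<in> edom \<theta>") (auto simp: \<theta>_eq out)
  then show ?thesis using True by (auto simp: convex_subdiff_def \<theta>_eq)
qed

text \<open>Splitting the maximum at the variable point \<open>z\<close> into its pieces presents
  the graph as an intersection of closed sets, one for each constraint and one for each pair of a
  domain point \<open>z'\<close> and a piece.\<close>

lemma closed_graph_convex_subdiff: "closed (graph_of (convex_subdiff \<theta>))"
proof -
  have "y \<in> convex_subdiff \<theta> z \<longleftrightarrow> (\<forall>i\<in>J. d i \<bullet> z \<le> \<beta> i) \<and>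
      (\<forall>z'\<in>edom \<theta>. \<forall>i\<in>I. a i \<bullet> z - \<alpha> i + y \<bullet> (z' - z) \<le> max_affine z')" for z y
  proof -
    have "max_affine z + y \<bullet> (z' - z) \<le> max_affine z' \<longleftrightarrow> (\<forall>i\<in>I. a i \<bullet> z - \<alpha> i + y \<bullet> (z' - z) \<le> max_affine z')" for z'
    proof
      assume "max_affine z + y \<bullet> (z' - z) \<le> max_affine z'"
      then show "\<forall>i\<in>I. a i \<bullet> z - \<alpha> i + y \<bullet> (z' - z) \<le> max_affine z'"
        using max_affine_ge[of _ z] by (meson add_le_cancel_right order_trans)
    next
      assume "\<forall>i\<in>I. a i \<bullet> z - \<alpha> i + y \<bullet> (z' - z) \<le> max_affine z'"
      then show "max_affine z + y \<bullet> (z' - z) \<le> max_affine z'" by (metis max_affine_attained)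
    qed
    then show ?thesis by (simp add: convex_subdiff_iff dom)
  qed
  then have "graph_of (convex_subdiff \<theta>) = (\<Inter>i\<in>J. {p. d i \<bullet> fst p \<le> \<beta> i}) \<inter>
      (\<Inter>z'\<in>edom \<theta>. \<Inter>i\<in>I. {p. a i \<bullet> fst p - \<alpha> i + snd p \<bullet> (z' - fst p) \<le> max_affine z'})"
    by (auto simp: graph_of_def)
  then show ?thesis
    by (simp only:) (intro closed_Int closed_INT ballI closed_Collect_le continuous_intros)
qed

text \<open>Near \<open>z\<close> only the pieces and constraints active at \<open>z\<close> matter,
  and their vectors lie in \<open>S\<close>: an active \<open>a i\<close> is a subgradient, and
  adding an active \<open>d i\<close> to a subgradient gives another one.\<close>

lemma locally_invariant:
  assumes z: "z \<in> edom \<theta>" and y: "y \<in> convex_subdiff \<theta> z"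
    and S: "subspace S" "convex_subdiff \<theta> z \<subseteq> S"
  obtains r where "r > 0" "\<And>z1 z2. \<lbrakk>z1 \<in> ball z r; z2 \<in> ball z r; z1 - z2 \<in> orthogonal_comp S\<rbrakk> \<Longrightarrow> \<theta> z1 = \<theta> z2"
proof -
  obtain j where j: "j \<in> I" "max_affine z = a j \<bullet> z - \<alpha> j" by (rule max_affine_attained)
  have active_a: "a i \<in> S" if i: "i \<in> I" "a i \<bullet> z - \<alpha> i = max_affine z" for i
  proof -
    have "a i \<in> convex_subdiff \<theta> z"
      unfolding convex_subdiff_iff
    proof (intro conjI ballI z)
      fix z' show "max_affine z + a i \<bullet> (z' - z) \<le> max_affine z'"
        using max_affine_ge[OF i(1), of z'] i(2) by (simp add: inner_diff_right)
    qed
    then show ?thesis using S(2) by blast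
  qed
  have active_d: "d i \<in> S" if i: "i \<in> J" "d i \<bullet> z = \<beta> i" for i
  proof -
    have "y + d i \<in> convex_subdiff \<theta> z"
      unfolding convex_subdiff_iff
    proof (intro conjI ballI z)
      fix z' assume z': "z' \<in> edom \<theta>"
      then have "d i \<bullet> (z' - z) \<le> 0" using i by (simp add: dom inner_diff_right)
      moreover have "max_affine z + y \<bullet> (z' - z) \<le> max_affine z'" using y z' by (simp add: convex_subdiff_iff)
      ultimately show "max_affine z + (y + d i) \<bullet> (z' - z) \<le> max_affine z'" by (simp add: inner_add_left)
    qed
    then have "(y + d i) - y \<in> S" using S y by (intro subspace_diff) auto
    then show ?thesis by simp
  qed
  have "\<forall>\<^sub>F z' in nhds z. \<forall>i\<in>J. d i \<bullet> z < \<beta> i \<longrightarrow> d i \<bullet> z' < \<beta> i"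
    unfolding eventually_ball_finite_distrib[OF finite_J]
  proof
    fix i assume "i \<in> J"
    have "((\<lambda>z'. d i \<bullet> z') \<longlongrightarrow> d i \<bullet> z) (nhds z)"
      by (intro tendsto_intros filterlim_ident)
    then show "\<forall>\<^sub>F z' in nhds z. d i \<bullet> z < \<beta> i \<longrightarrow> d i \<bullet> z' < \<beta> i"
      by (cases "d i \<bullet> z < \<beta> i") (auto dest: order_tendstoD)
  qed
  \<comment> \<open>Comparison with one fixed active piece \<open>j\<close>, instead of the maximum,
    keeps both sides affine.\<close>
  moreover have "\<forall>\<^sub>F z' in nhds z. \<forall>i\<in>I. a i \<bullet> z - \<alpha> i < max_affine z \<longrightarrow> a i \<bullet> z' - \<alpha> i < a j \<bullet> z' - \<alpha> j"
    unfolding eventually_ball_finite_distrib[OF finite_I]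
  proof
    fix i assume "i \<in> I"
    have "((\<lambda>z'. (a j \<bullet> z' - \<alpha> j) - (a i \<bullet> z' - \<alpha> i)) \<longlongrightarrow> (a j \<bullet> z - \<alpha> j) - (a i \<bullet> z - \<alpha> i)) (nhds z)"
      by (intro tendsto_intros filterlim_ident)
    then have "\<forall>\<^sub>F z' in nhds z. 0 < (a j \<bullet> z' - \<alpha> j) - (a i \<bullet> z' - \<alpha> i)" if "a i \<bullet> z - \<alpha> i < max_affine z"
      using that j(2) by (intro order_tendstoD(1)) auto
    then show "\<forall>\<^sub>F z' in nhds z. a i \<bullet> z - \<alpha> i < max_affine z \<longrightarrow> a i \<bullet> z' - \<alpha> i < a j \<bullet> z' - \<alpha> j"
      by (cases "a i \<bullet> z - \<alpha> i < max_affine z") (auto elim: eventually_mono)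
  qed
  ultimately have "\<forall>\<^sub>F z' in nhds z. (\<forall>i\<in>J. d i \<bullet> z < \<beta> i \<longrightarrow> d i \<bullet> z' < \<beta> i)
      \<and> (\<forall>i\<in>I. a i \<bullet> z - \<alpha> i < max_affine z \<longrightarrow> a i \<bullet> z' - \<alpha> i < a j \<bullet> z' - \<alpha> j)"
    by (rule eventually_conj)
  then obtain r where r: "r > 0"
    and rd: "\<And>z' i. \<lbrakk>dist z' z < r; i \<in> J; d i \<bullet> z < \<beta> i\<rbrakk> \<Longrightarrow> d i \<bullet> z' < \<beta> i"
    and ra: "\<And>z' i. \<lbrakk>dist z' z < r; i \<in> I; a i \<bullet> z - \<alpha> i < max_affine z\<rbrakk> \<Longrightarrow> a i \<bullet> z' - \<alpha> i < a j \<bullet> z' - \<alpha> j"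
    unfolding eventually_nhds_metric by blast
  have S_eq: "c \<bullet> z1 = c \<bullet> z2" if "c \<in> S" "z1 - z2 \<in> orthogonal_comp S" for c z1 z2
    using that by (auto simp: orthogonal_comp_def orthogonal_def inner_diff_right)
  have dom_imp: "z2 \<in> edom \<theta>"
    if "dist z1 z < r" "dist z2 z < r" "z1 - z2 \<in> orthogonal_comp S" "z1 \<in> edom \<theta>" for z1 z2
    unfolding dom
  proof (intro CollectI ballI)
    fix i assume i: "i \<in> J"
    show "d i \<bullet> z2 \<le> \<beta> i"
    proof (cases "d i \<bullet> z = \<beta> i")
      case True
      then have "d i \<bullet> z1 = d i \<bullet> z2" using S_eq[OF active_d[OF i]] that(3) by blast
      then show ?thesis using that(4) i by (auto simp: dom)
    next
      case False
      then have "d i \<bullet> z < \<beta> i" using z i by (force simp: dom)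
      then show ?thesis using rd[OF that(2) i] by simp
    qed
  qed
  have h_imp: "max_affine z1 \<le> max_affine z2"
    if "dist z1 z < r" "dist z2 z < r" "z1 - z2 \<in> orthogonal_comp S" for z1 z2
  proof (rule max_affine_le)
    fix i assume i: "i \<in> I"
    show "a i \<bullet> z1 - \<alpha> i \<le> max_affine z2"
    proof (cases "a i \<bullet> z - \<alpha> i = max_affine z")
      case True
      then have "a i \<bullet> z1 = a i \<bullet> z2" using S_eq[OF active_a[OF i]] that(3) by blast
      then show ?thesis using max_affine_ge[OF i, of z2] by simp
    next
      case False
      then have "a i \<bullet> z - \<alpha> i < max_affine z" using max_affine_ge[OF i, of z] by simp
      then have "a i \<bullet> z1 - \<alpha> i < a j \<bullet> z1 - \<alpha> j" using ra[OF that(1) i] by simp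
      also have "a j \<bullet> z1 = a j \<bullet> z2" using S_eq[OF active_a[OF j(1)]] j(2) that(3) by simp
      finally show ?thesis using max_affine_ge[OF j(1), of z2] by simp
    qed
  qed
  have "\<theta> z1 = \<theta> z2"
    if z12: "z1 \<in> ball z r" "z2 \<in> ball z r" "z1 - z2 \<in> orthogonal_comp S" for z1 z2
  proof -
    have 1: "dist z1 z < r" "dist z2 z < r" using z12 by (simp_all add: dist_commute)
    have "- (z1 - z2) \<in> orthogonal_comp S" using subspace_neg[OF subspace_orthogonal_comp z12(3)] .
    then have 2: "z2 - z1 \<in> orthogonal_comp S" by simp
    have "z1 \<in> edom \<theta> \<longleftrightarrow> z2 \<in> edom \<theta>" using dom_imp[OF 1 z12(3)] dom_imp[OF 1(2,1) 2] by blast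
    moreover have "max_affine z1 = max_affine z2" using h_imp[OF 1 z12(3)] h_imp[OF 1(2,1) 2] by simp
    ultimately show ?thesis using \<theta>_eq out by (cases "z1 \<in> edom \<theta>") auto
  qed
  then show thesis using that r by blast
qed

end

lemma convex_piecewise_linear_imp_locale:
  assumes "convex_piecewise_linear \<theta>"
  obtains I J a \<alpha> d \<beta> where "piecewise_linear \<theta> I J a \<alpha> d \<beta>"
proof -
  obtain l p :: nat and a \<alpha> d \<beta> where
    "l \<ge> 1" "edom \<theta> = {z. \<forall>i\<in>{1..p}. d i \<bullet> z \<le> \<beta> i}"
    "\<forall>z\<in>edom \<theta>. \<theta> z = ereal (Max ((\<lambda>i. a i \<bullet> z - \<alpha> i) ` {1..l}))" "\<forall>z. z \<notin> edom \<theta> \<longrightarrow> \<theta> z = \<infinity>"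
    using assms unfolding convex_piecewise_linear_def by blast
  then have "piecewise_linear \<theta> {1..l} {1..p} a \<alpha> d \<beta>" by unfold_locales auto
  then show thesis by (rule that)
qed

text \<open>Let \<open>s\<close> be the component of \<open>y\<close> orthogonal to
  \<open>S\<close>. A short move from \<open>z1\<close> along \<open>s\<close> leaves \<theta>
  unchanged, whereas the subgradient inequality demands growth by
  \<open>t * (s \<bullet> s)\<close>; so \<open>s = 0\<close>. With \<open>y\<close> in
  \<open>S\<close> the inequality is the same at \<open>z1\<close> and \<open>z2\<close>.\<close>

lemma convex_subdiff_invariant:
  fixes \<theta> :: "'b::euclidean_space \<Rightarrow> ereal"
  assumes inv: "\<And>z1 z2. \<lbrakk>z1 \<in> ball z r; z2 \<in> ball z r; z1 - z2 \<in> orthogonal_comp S\<rbrakk> \<Longrightarrow> \<theta> z1 = \<theta> z2"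
    and S: "subspace S" and z1: "z1 \<in> ball z r" and y: "y \<in> convex_subdiff \<theta> z1"
  shows convex_subdiff_subspace: "y \<in> S"
    and "\<lbrakk>z2 \<in> ball z r; z1 - z2 \<in> orthogonal_comp S\<rbrakk> \<Longrightarrow> y \<in> convex_subdiff \<theta> z2"
proof -
  have fin: "\<bar>\<theta> z1\<bar> \<noteq> \<infinity>" and le: "\<And>z'. \<theta> z1 + ereal (y \<bullet> (z' - z1)) \<le> \<theta> z'"
    using y by (auto simp: convex_subdiff_def)
  obtain p s where ps: "p \<in> span S" "\<And>w. w \<in> span S \<Longrightarrow> orthogonal s w" "y = p + s"
    using orthogonal_subspace_decomp_exists[of S y] by metis
  have sp: "span S = S" using S by simp
  have s: "s \<in> orthogonal_comp S" using ps(2) sp by (auto simp: orthogonal_comp_def orthogonal_commute)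
  define t where "t = (r - dist z z1) / (2 * (norm s + 1))"
  have n: "norm s + 1 > 0" by (simp add: add_nonneg_pos)
  have t: "t > 0" using z1 n by (simp add: t_def)
  have "t * norm s < t * (norm s + 1)" using t by simp
  also have "\<dots> = (r - dist z z1) / 2" using n by (simp add: t_def field_simps)
  finally have ts: "t * norm s < r - dist z z1" using z1 by simp
  have "z1 + t *\<^sub>R s \<in> ball z r"
    using dist_triangle[of z "z1 + t *\<^sub>R s" z1] ts t by (simp add: dist_norm)
  moreover have "z1 - (z1 + t *\<^sub>R s) \<in> orthogonal_comp S"
    using subspace_scale[OF subspace_orthogonal_comp s, of "- t"] by simp
  ultimately have "\<theta> z1 = \<theta> (z1 + t *\<^sub>R s)" using inv z1 by blast
  then have "\<theta> z1 + ereal (t * (y \<bullet> s)) \<le> \<theta> z1" using le[of "z1 + t *\<^sub>R s"] by simp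
  then have "t * (y \<bullet> s) \<le> 0" using fin by (cases "\<theta> z1") auto
  moreover have "y \<bullet> s = s \<bullet> s"
    using ps(2)[OF ps(1)] by (simp add: ps(3) inner_add_left orthogonal_def inner_commute[of p s])
  ultimately have "s = 0" using t inner_ge_zero[of s] by (simp add: mult_le_0_iff)
  then show yS: "y \<in> S" using ps sp by simp
  assume z2: "z2 \<in> ball z r" "z1 - z2 \<in> orthogonal_comp S"
  then have eq: "\<theta> z1 = \<theta> z2" using inv z1 by blast
  have "y \<bullet> (z1 - z2) = 0" using z2(2) yS by (simp add: orthogonal_comp_def orthogonal_def)
  then have "y \<bullet> (z' - z1) = y \<bullet> (z' - z2)" for z' by (simp add: inner_diff_right)
  then show "y \<in> convex_subdiff \<theta> z2" using fin le unfolding eq convex_subdiff_def by simp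
qed

section \<open>The chain rule for first-order subdifferentials\<close>

context transversal
begin

text \<open>A limiting subgradient \<open>v\<close> gives \<epsilon>-minorants at nearby points. The
  fibres yield \<open>q\<close> with \<open>adjoint A q = v\<close>, and lifting carries each
  minorant over to \<theta> near \<open>\<phi> x0\<close>. Made global by convexity, it can be
  evaluated at a fixed \<open>z'\<close> while \<epsilon> tends to 0. Conversely, a convex
  subgradient gives even a regular normal.\<close>

lemma limiting_subdiff_compose:
  assumes pl: "piecewise_linear \<theta> I J a \<alpha> d \<beta>" and r: "r > 0"
    and inv: "\<And>z1 z2. \<lbrakk>z1 \<in> ball (\<phi> xbar) r; z2 \<in> ball (\<phi> xbar) r; z1 - z2 \<in> orthogonal_comp S\<rbrakk> \<Longrightarrow> \<theta> z1 = \<theta> z2"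
  shows "limiting_subdiff (\<lambda>x. \<theta> (\<phi> x)) xbar = adjoint A ` convex_subdiff \<theta> (\<phi> xbar)"
proof -
  interpret pl: piecewise_linear \<theta> I J a \<alpha> d \<beta> by (rule pl)
  obtain r1 L where r1: "r1 > 0" and L: "L > 0"
    and lip: "\<And>x x'. \<lbrakk>x \<in> ball xbar r1; x' \<in> ball xbar r1\<rbrakk> \<Longrightarrow> norm (\<phi> x - \<phi> x') \<le> L * norm (x - x')"
    by (rule strict_derivative_lipschitz[OF strict]) (rule that)
  obtain C r3 where C: "C > 0" and r3: "r3 > 0"
    and open_map: "\<And>x z. \<lbrakk>x \<in> ball xbar r3; norm (z - \<phi> x) < r3\<rbrakk>
       \<Longrightarrow> \<exists>x'. z - \<phi> x' \<in> orthogonal_comp S \<and> norm (x' - x) \<le> C * norm (z - \<phi> x)"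
    by (rule open_mapping_modulo) (rule that)
  define R where "R = min (min r1 r3) (r / L)"
  have R: "R > 0" "R \<le> r1" "R \<le> r3" using r r1 r3 L by (auto simp: R_def)
  have "R \<le> r / L" by (simp add: R_def)
  then have RL: "L * R \<le> r" using L by (simp add: pos_le_divide_eq mult.commute)
  have \<phi>_dist: "norm (\<phi> x - \<phi> xbar) \<le> L * norm (x - xbar)" if "x \<in> ball xbar R" for x
    using that R r1 by (intro lip) auto
  have \<phi>_ball: "\<phi> x \<in> ball (\<phi> xbar) r" if "x \<in> ball xbar R" for x
  proof -
    have "L * norm (x - xbar) < L * R" using that L by (simp add: dist_norm norm_minus_commute)
    then show ?thesis using \<phi>_dist[OF that] RL by (simp add: dist_norm norm_minus_commute)
  qed
  show ?thesis
  proof (intro equalityI subsetI)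
    fix v assume "v \<in> limiting_subdiff (\<lambda>x. \<theta> (\<phi> x)) xbar"
    then have fin: "\<bar>\<theta> (\<phi> xbar)\<bar> \<noteq> \<infinity>"
      and v: "(v, -1) \<in> limiting_normal_cone (epi (\<lambda>x. \<theta> (\<phi> x))) (xbar, real_of_ereal (\<theta> (\<phi> xbar)))"
      by (simp_all add: limiting_subdiff_def)
    define tb where "tb = real_of_ereal (\<theta> (\<phi> xbar))"
    have tb: "\<theta> (\<phi> xbar) = ereal tb" using fin by (simp add: tb_def ereal_real)
    have v': "(v, -1) \<in> approx_normal_cone (epi (\<lambda>x. \<theta> (\<phi> x))) (xbar, tb)"
      using v limiting_subset_approx_normal_cone unfolding tb_def by blast
    have sub: "\<exists>x0 t0 \<delta>. \<theta> (\<phi> x0) = ereal t0 \<and> dist x0 xbar < \<epsilon> \<and> \<bar>t0 - tb\<bar> < \<epsilon> \<and> \<delta> > 0 \<and>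
        (\<forall>x'. dist x' x0 < \<delta> \<longrightarrow> ereal (t0 + v \<bullet> (x' - x0) - \<epsilon> * norm (x' - x0)) \<le> \<theta> (\<phi> x'))"
      if e: "\<epsilon> > 0" for \<epsilon>
      by (rule approx_normal_epi_subgradient[OF v' e pl.not_MInfty]) blast
    obtain q where q: "q \<in> S" "adjoint A q = v"
    proof (rule fibrewise_approx_zero_imp_adjoint_image)
      fix \<epsilon> :: real assume e: "\<epsilon> > 0"
      have m: "min \<epsilon> (R / 2) > 0" using e R by simp
      obtain x0 t0 \<delta> where x0: "\<theta> (\<phi> x0) = ereal t0" "dist x0 xbar < min \<epsilon> (R / 2)" "\<delta> > 0"
        and le: "\<And>x'. dist x' x0 < \<delta> \<Longrightarrow> ereal (t0 + v \<bullet> (x' - x0) - min \<epsilon> (R / 2) * norm (x' - x0)) \<le> \<theta> (\<phi> x')"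
        using sub[OF m] by blast
      have "v \<bullet> (x - x0) \<le> \<epsilon> * norm (x - x0)"
        if x: "dist x x0 < min \<delta> (R / 2)" "\<phi> x - \<phi> x0 \<in> orthogonal_comp S" for x
      proof -
        have "dist x xbar < R" using dist_triangle[of x xbar x0] x(1) x0(2) by simp
        then have "x \<in> ball xbar R" "x0 \<in> ball xbar R" using x0(2) R(1) by (simp_all add: dist_commute)
        then have "\<theta> (\<phi> x) = ereal t0" using inv[OF \<phi>_ball \<phi>_ball x(2)] x0(1) by simp
        then have "v \<bullet> (x - x0) \<le> min \<epsilon> (R / 2) * norm (x - x0)" using le[of x] x(1) by simp
        also have "\<dots> \<le> \<epsilon> * norm (x - x0)" by (intro mult_right_mono) auto
        finally show ?thesis .
      qed
      moreover have "min \<delta> (R / 2) > 0" using x0(3) R by simp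
      ultimately show "\<exists>x0. dist x0 xbar < \<epsilon> \<and> (\<exists>\<delta>>0. \<forall>x. dist x x0 < \<delta> \<and>
          \<phi> x - \<phi> x0 \<in> orthogonal_comp S \<longrightarrow> v \<bullet> (x - x0) \<le> \<epsilon> * norm (x - x0))"
        using x0(2) by (metis min_less_iff_conj)
    qed (rule that)
    have "ereal (tb + q \<bullet> (z' - \<phi> xbar)) \<le> \<theta> z'" for z'
    proof (cases "\<theta> z'")
      case PInf then show ?thesis by simp
    next
      case MInf then show ?thesis using pl.not_MInfty by blast
    next
      case (real t')
      define K where "K = (1 + norm q) * C"
      have K: "K > 0" using C by (simp add: K_def add_pos_nonneg)
      \<comment> \<open>All errors in units of \<open>\<epsilon>1\<close>: the value of \<theta>,
        the displacement of the base point, and the slope of the minorant over a distance of at most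
        \<open>norm (z' - \<phi> xbar) + L\<close>.\<close>
      define P where "P = 1 + norm q * L + K * (norm (z' - \<phi> xbar) + L)"
      have P: "P > 0" unfolding P_def using K L by (intro add_pos_nonneg) auto
      have "tb + q \<bullet> (z' - \<phi> xbar) \<le> t' + e" if e: "e > 0" for e
      proof -
        define \<epsilon>1 where "\<epsilon>1 = min 1 (e / P)"
        have e1: "\<epsilon>1 > 0" "\<epsilon>1 \<le> 1" "\<epsilon>1 \<le> e / P" using e P by (auto simp: \<epsilon>1_def)
        have e1P: "\<epsilon>1 * P \<le> e" using e1(3) P by (simp add: pos_le_divide_eq)
        obtain r2 where r2: "r2 > 0" and str: "\<And>x x'. \<lbrakk>x \<in> ball xbar r2; x' \<in> ball xbar r2\<rbrakk>
            \<Longrightarrow> norm (\<phi> x - \<phi> x' - A (x - x')) \<le> \<epsilon>1 * norm (x - x')"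
          by (rule strict_derivativeD[OF strict e1(1)]) (rule that)
        define \<rho> where "\<rho> = min R r2"
        have \<rho>: "\<rho> > 0" "\<rho> \<le> R" "\<rho> \<le> r2" using R r2 by (auto simp: \<rho>_def)
        define \<eta> where "\<eta> = min \<epsilon>1 (\<rho> / 2)"
        have eta: "\<eta> > 0" "\<eta> \<le> \<epsilon>1" "\<eta> \<le> \<rho> / 2"
          using e1(1) \<rho> by (auto simp: \<eta>_def simp del: le_divide_eq_numeral1)
        obtain x0 t0 \<delta> where x0: "\<theta> (\<phi> x0) = ereal t0" "dist x0 xbar < \<eta>" "\<bar>t0 - tb\<bar> < \<eta>" "\<delta> > 0"
          and le: "\<And>x'. dist x' x0 < \<delta> \<Longrightarrow> ereal (t0 + v \<bullet> (x' - x0) - \<eta> * norm (x' - x0)) \<le> \<theta> (\<phi> x')"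
          using sub[OF eta(1)] by blast
        have x0b: "x0 \<in> ball xbar (\<rho> / 2)" using x0(2) eta by (simp add: dist_commute)
        then have x0R: "x0 \<in> ball xbar R" using \<rho> by simp
        define \<delta>' where "\<delta>' = min (min R (r - dist (\<phi> xbar) (\<phi> x0))) (min \<delta> (\<rho> / 2) / C)"
        have \<delta>': "\<delta>' > 0" using \<rho> R x0(4) C \<phi>_ball[OF x0R] by (simp add: \<delta>'_def)
        have "ereal (t0 + q \<bullet> (z - \<phi> x0) - (\<epsilon>1 * K) * norm (z - \<phi> x0)) \<le> \<theta> z"
          if z: "dist z (\<phi> x0) < \<delta>'" for z
        proof -
          define N where "N = norm (z - \<phi> x0)"
          have N0: "N \<ge> 0" by (simp add: N_def)
          have Nd: "N < R" "N < r - dist (\<phi> xbar) (\<phi> x0)" "N < min \<delta> (\<rho> / 2) / C"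
            using z by (simp_all add: \<delta>'_def N_def dist_norm)
          have "N * C < min \<delta> (\<rho> / 2)" using Nd(3) C by (simp add: pos_less_divide_eq)
          then have NC: "C * N < \<delta>" "C * N < \<rho> / 2" by (simp_all add: mult.commute)
          have "norm (z - \<phi> x0) < r3" using Nd(1) R(3) unfolding N_def by linarith
          moreover have "x0 \<in> ball xbar r3" using x0R R by simp
          ultimately obtain x where x: "z - \<phi> x \<in> orthogonal_comp S" "norm (x - x0) \<le> C * N"
            using open_map unfolding N_def by blast
          have "dist x xbar < \<rho>"
            using dist_triangle[of x xbar x0] x(2) NC(2) x0b by (simp add: dist_norm norm_minus_commute)
          then have xb: "x \<in> ball xbar R" "x \<in> ball xbar r2" "x0 \<in> ball xbar r2"
            using \<rho> x0b by (simp_all add: dist_commute)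
          have "z \<in> ball (\<phi> xbar) r"
            using dist_triangle[of "\<phi> xbar" z "\<phi> x0"] Nd(2) by (simp add: dist_norm norm_minus_commute N_def)
          then have eq: "\<theta> z = \<theta> (\<phi> x)" using inv[OF _ \<phi>_ball[OF xb(1)] x(1)] by simp
          have 1: "ereal (t0 + v \<bullet> (x - x0) - \<eta> * norm (x - x0)) \<le> \<theta> z"
            unfolding eq using x(2) NC(1) by (intro le) (simp add: dist_norm)
          have "q \<bullet> (z - \<phi> x0) = q \<bullet> (\<phi> x - \<phi> x0)"
            using orthogonal_S[OF q(1) x(1)] by (simp add: inner_diff_right)
          also have "\<dots> \<le> v \<bullet> (x - x0) + norm q * (\<epsilon>1 * norm (x - x0))"
            using linearization_error[OF str[OF xb(2,3)], of q] unfolding q(2) by linarith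
          finally have 2: "q \<bullet> (z - \<phi> x0) \<le> v \<bullet> (x - x0) + norm q * (\<epsilon>1 * norm (x - x0))" .
          have "\<eta> * norm (x - x0) + norm q * (\<epsilon>1 * norm (x - x0)) \<le> \<epsilon>1 * (C * N) + norm q * (\<epsilon>1 * (C * N))"
            using x(2) eta e1 by (intro add_mono mult_mono) auto
          also have "\<dots> = (\<epsilon>1 * K) * N" by (simp add: K_def algebra_simps)
          finally have "t0 + q \<bullet> (z - \<phi> x0) - (\<epsilon>1 * K) * N \<le> t0 + v \<bullet> (x - x0) - \<eta> * norm (x - x0)"
            using 2 by linarith
          then show ?thesis using 1 unfolding N_def by (meson ereal_less_eq(3) order_trans)
        qed
        from pl.local_minorant_global[OF x0(1) \<delta>' this, of z']
        have "t0 + q \<bullet> (z' - \<phi> x0) - (\<epsilon>1 * K) * norm (z' - \<phi> x0) \<le> t'" by (simp add: real)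
        moreover have dz: "norm (\<phi> x0 - \<phi> xbar) \<le> L * \<epsilon>1"
          by (rule order_trans[OF \<phi>_dist[OF x0R]], rule mult_left_mono)
             (use x0(2) eta L in \<open>auto simp: dist_norm\<close>)
        have "\<bar>q \<bullet> (\<phi> x0 - \<phi> xbar)\<bar> \<le> norm q * (L * \<epsilon>1)"
          using Cauchy_Schwarz_ineq2[of q "\<phi> x0 - \<phi> xbar"] mult_left_mono[OF dz, of "norm q"] by simp
        moreover have "q \<bullet> (z' - \<phi> xbar) = q \<bullet> (z' - \<phi> x0) + q \<bullet> (\<phi> x0 - \<phi> xbar)"
          by (simp add: inner_diff_right)
        moreover have "(\<epsilon>1 * K) * norm (z' - \<phi> x0) \<le> (\<epsilon>1 * K) * (norm (z' - \<phi> xbar) + L)"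
        proof (rule mult_left_mono)
          have "L * \<epsilon>1 \<le> L * 1" using e1 L by (intro mult_left_mono) auto
          then show "norm (z' - \<phi> x0) \<le> norm (z' - \<phi> xbar) + L"
            using norm_triangle_ineq4[of "z' - \<phi> xbar" "\<phi> x0 - \<phi> xbar"] dz by simp
        qed (use e1 K in simp)
        moreover have "tb \<le> t0 + \<epsilon>1" using x0(3) eta by linarith
        ultimately have "tb + q \<bullet> (z' - \<phi> xbar) \<le>
            t' + (\<epsilon>1 + norm q * (L * \<epsilon>1) + (\<epsilon>1 * K) * (norm (z' - \<phi> xbar) + L))"
          by linarith
        also have "\<dots> = t' + \<epsilon>1 * P" by (simp add: P_def algebra_simps)
        finally show ?thesis using e1P by simp
      qed
      then have "tb + q \<bullet> (z' - \<phi> xbar) \<le> t'" by (rule field_le_epsilon)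
      then show ?thesis by (simp add: real)
    qed
    then have "q \<in> convex_subdiff \<theta> (\<phi> xbar)" using tb by (simp add: convex_subdiff_def)
    then show "v \<in> adjoint A ` convex_subdiff \<theta> (\<phi> xbar)" using q(2) by blast
  next
    fix v assume "v \<in> adjoint A ` convex_subdiff \<theta> (\<phi> xbar)"
    then obtain y where y: "y \<in> convex_subdiff \<theta> (\<phi> xbar)" "v = adjoint A y" by blast
    then have fin: "\<bar>\<theta> (\<phi> xbar)\<bar> \<noteq> \<infinity>" and le: "\<And>z'. \<theta> (\<phi> xbar) + ereal (y \<bullet> (z' - \<phi> xbar)) \<le> \<theta> z'"
      by (auto simp: convex_subdiff_def)
    define tb where "tb = real_of_ereal (\<theta> (\<phi> xbar))"
    have tb: "\<theta> (\<phi> xbar) = ereal tb" using fin by (simp add: tb_def ereal_real)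
    have "(v, -1) \<in> regular_normal_cone (epi (\<lambda>x. \<theta> (\<phi> x))) (xbar, tb)"
      unfolding regular_normal_cone_iff
    proof (intro allI impI)
      fix \<epsilon> :: real assume e: "\<epsilon> > 0"
      have ny: "norm y + 1 > 0" by (simp add: add_nonneg_pos)
      define \<epsilon>1 where "\<epsilon>1 = \<epsilon> / (norm y + 1)"
      have e1: "\<epsilon>1 > 0" "\<epsilon>1 * (norm y + 1) = \<epsilon>" using e ny by (simp_all add: \<epsilon>1_def)
      obtain r2 where r2: "r2 > 0" and str: "\<And>x x'. \<lbrakk>x \<in> ball xbar r2; x' \<in> ball xbar r2\<rbrakk>
          \<Longrightarrow> norm (\<phi> x - \<phi> x' - A (x - x')) \<le> \<epsilon>1 * norm (x - x')"
        by (rule strict_derivativeD[OF strict e1(1)]) (rule that)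
      have "(v, -1) \<bullet> (p - (xbar, tb)) \<le> \<epsilon> * norm (p - (xbar, tb))"
        if p: "p \<in> epi (\<lambda>x. \<theta> (\<phi> x))" "dist p (xbar, tb) < r2" for p
      proof -
        obtain x t where eq: "p = (x, t)" by force
        have x: "x \<in> ball xbar r2" "xbar \<in> ball xbar r2"
          using p(2) dist_fst_le[of p "(xbar, tb)"] r2 by (simp_all add: eq dist_commute)
        have "ereal tb + ereal (y \<bullet> (\<phi> x - \<phi> xbar)) \<le> ereal t"
          using order_trans[OF le[of "\<phi> x"], of "ereal t"] p(1) unfolding tb eq by (simp add: epi_def)
        then have "tb + y \<bullet> (\<phi> x - \<phi> xbar) \<le> t" by simp
        moreover have "v \<bullet> (x - xbar) \<le> y \<bullet> (\<phi> x - \<phi> xbar) + norm y * (\<epsilon>1 * norm (x - xbar))"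
          using linearization_error[OF str[OF x], of y] unfolding y(2) by linarith
        ultimately have "v \<bullet> (x - xbar) - (t - tb) \<le> (\<epsilon>1 * norm y) * norm (x - xbar)"
          by (simp add: algebra_simps)
        also have "\<dots> \<le> \<epsilon> * norm (p - (xbar, tb))"
        proof (rule mult_mono)
          show "\<epsilon>1 * norm y \<le> \<epsilon>" using e1 by (simp add: algebra_simps)
          show "norm (x - xbar) \<le> norm (p - (xbar, tb))"
            using norm_fst_le[of "x - xbar" "t - tb"] by (simp add: eq)
        qed (use e in auto)
        finally show ?thesis by (simp add: eq)
      qed
      then show "\<exists>\<delta>>0. \<forall>q'\<in>epi (\<lambda>x. \<theta> (\<phi> x)). dist q' (xbar, tb) < \<delta> \<longrightarrow>
          (v, -1) \<bullet> (q' - (xbar, tb)) \<le> \<epsilon> * norm (q' - (xbar, tb))"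
        using r2 by blast
    qed
    moreover have "(xbar, tb) \<in> epi (\<lambda>x. \<theta> (\<phi> x))" by (simp add: epi_def tb)
    \<comment> \<open>The normal is regular at the point itself, so constant sequences
      serve.\<close>
    ultimately have "(v, -1) \<in> limiting_normal_cone (epi (\<lambda>x. \<theta> (\<phi> x))) (xbar, tb)"
      unfolding limiting_normal_cone_def
      by (intro CollectI conjI exI[of _ "\<lambda>_. (xbar, tb)"] exI[of _ "\<lambda>_. (v, -1)"]) auto
    then show "v \<in> limiting_subdiff (\<lambda>x. \<theta> (\<phi> x)) xbar"
      using fin by (simp add: limiting_subdiff_def tb_def)
  qed
qed

end

section \<open>The solution map\<close>

locale composite = pl: piecewise_linear \<theta> I J a \<alpha> d \<beta>
  for \<theta> :: "'b::euclidean_space \<Rightarrow> ereal" and I J a \<alpha> d \<beta> +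
  fixes \<phi> :: "'a::euclidean_space \<Rightarrow> 'b" and D :: "'a \<Rightarrow> 'a \<Rightarrow>\<^sub>L 'b" and H f and f' :: "'a \<Rightarrow> 'a"
    and xbar ybar \<rho> S
  assumes \<rho>: "\<rho> > 0" and strict_\<phi>: "\<And>x. x \<in> ball xbar \<rho> \<Longrightarrow> strict_derivative \<phi> (blinfun_apply (D x)) x"
    and strict_D: "strict_derivative D H xbar"
    and H_sym: "\<And>h k. blinfun_apply (H h) k = blinfun_apply (H k) h"
    and strict_f: "strict_derivative f f' xbar"
    and S: "subspace S" and subdiff_S: "convex_subdiff \<theta> (\<phi> xbar) \<subseteq> S"
    and inj: "\<And>y. \<lbrakk>y \<in> S; adjoint (blinfun_apply (D xbar)) y = 0\<rbrakk> \<Longrightarrow> y = 0"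
    and ybar: "ybar \<in> convex_subdiff \<theta> (\<phi> xbar)"
begin

abbreviation \<Gamma> where "\<Gamma> \<equiv> graph_of (convex_subdiff \<theta>)"

definition F where "F x y = f x + adjoint (blinfun_apply (D x)) y"

text \<open>With \<open>x\<close> as first component, the normals in Mordukhovich's criterion have
  the form \<open>(0, - u)\<close>.\<close>

definition M where "M = {(x, v). v \<in> f x +o limiting_subdiff (\<lambda>x. \<theta> (\<phi> x)) x}"

sublocale transversal \<phi> "blinfun_apply (D xbar)" xbar S
  using strict_\<phi>[of xbar] \<rho> S inj by unfold_locales auto

lemma \<Gamma>_iff: "(z, y) \<in> \<Gamma> \<longleftrightarrow> y \<in> convex_subdiff \<theta> z"
  by (simp add: graph_of_def)

lemma invariance_radius:
  obtains r where "r > 0"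
    "\<And>z1 z2. \<lbrakk>z1 \<in> ball (\<phi> xbar) r; z2 \<in> ball (\<phi> xbar) r; z1 - z2 \<in> orthogonal_comp S\<rbrakk> \<Longrightarrow> \<theta> z1 = \<theta> z2"
proof (rule pl.locally_invariant[OF _ ybar S subdiff_S])
  show "\<phi> xbar \<in> edom \<theta>" using ybar by (simp add: pl.convex_subdiff_iff)
qed (rule that)

text \<open>The lower bound for the adjoint on \<open>S\<close> survives small changes of
  \<open>x\<close>, so the chain rule holds at every nearby \<open>x\<close>, and the multiplier is
  controlled by \<open>x\<close> and \<open>F x y\<close>. Only \<open>y'\<close> is assumed
  bounded: with \<open>y' = ybar\<close> the estimate itself bounds an arbitrary multiplier
  \<open>y\<close>.\<close>

lemma local_description:
  obtains R K where "R > 0" "K > 0"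
    "continuous_on (cball xbar R) \<phi>" "continuous_on (cball xbar R) f" "continuous_on (cball xbar R) D"
    "\<And>x v. x \<in> cball xbar R \<Longrightarrow> (x, v) \<in> M \<longleftrightarrow> (\<exists>y. (\<phi> x, y) \<in> \<Gamma> \<and> v = F x y)"
    "\<And>x x' y y'. \<lbrakk>x \<in> cball xbar R; x' \<in> cball xbar R; (\<phi> x, y) \<in> \<Gamma>; (\<phi> x', y') \<in> \<Gamma>; norm y' \<le> norm ybar + 1\<rbrakk>
       \<Longrightarrow> norm (y - y') \<le> K * (norm (F x y - F x' y') + norm (x - x'))"
proof -
  interpret adj: bounded_bilinear "\<lambda>(X :: 'a \<Rightarrow>\<^sub>L 'b) y. adjoint (blinfun_apply X) y"
    by (rule bounded_bilinear_adjoint)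
  obtain r where r: "r > 0"
    and inv: "\<And>z1 z2. \<lbrakk>z1 \<in> ball (\<phi> xbar) r; z2 \<in> ball (\<phi> xbar) r; z1 - z2 \<in> orthogonal_comp S\<rbrakk> \<Longrightarrow> \<theta> z1 = \<theta> z2"
    by (rule invariance_radius) (rule that)
  obtain r1 L where r1: "r1 > 0" and L: "L > 0"
    and lip: "\<And>x x'. \<lbrakk>x \<in> ball xbar r1; x' \<in> ball xbar r1\<rbrakk> \<Longrightarrow> norm (\<phi> x - \<phi> x') \<le> L * norm (x - x')"
    by (rule strict_derivative_lipschitz[OF strict]) (rule that)
  obtain r2 Lf where r2: "r2 > 0" and Lf: "Lf > 0"
    and lipf: "\<And>x x'. \<lbrakk>x \<in> ball xbar r2; x' \<in> ball xbar r2\<rbrakk> \<Longrightarrow> norm (f x - f x') \<le> Lf * norm (x - x')"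
    by (rule strict_derivative_lipschitz[OF strict_f]) (rule that)
  obtain r3 LD where r3: "r3 > 0" and LD: "LD > 0"
    and lipD: "\<And>x x'. \<lbrakk>x \<in> ball xbar r3; x' \<in> ball xbar r3\<rbrakk> \<Longrightarrow> norm (D x - D x') \<le> LD * norm (x - x')"
    by (rule strict_derivative_lipschitz[OF strict_D]) (rule that)
  obtain c where c: "c > 0" and lower: "\<And>y. y \<in> S \<Longrightarrow> norm y \<le> c * norm (adjoint (blinfun_apply (D xbar)) y)"
    by (rule adjoint_lower_bound) (rule that)
  \<comment> \<open>\<open>r / (2 * L)\<close> keeps \<open>\<phi> x\<close> in the half ball of
    invariance; \<open>1 / (2 * c * LD)\<close> lets the change of \<open>D\<close> consume at most
    half of the lower bound, whence the constant \<open>2 * c\<close>.\<close>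
  define R0 where "R0 = min (min (min \<rho> r1) (min r2 r3)) (min (r / (2 * L)) (1 / (2 * c * LD)))"
  have R0: "R0 > 0" "R0 \<le> \<rho>" "R0 \<le> r1" "R0 \<le> r2" "R0 \<le> r3" "R0 \<le> r / (2 * L)" "R0 \<le> 1 / (2 * c * LD)"
    unfolding R0_def using \<rho> r1 r2 r3 r L c LD by simp_all
  have R0': "L * R0 \<le> r / 2" "c * (LD * R0) \<le> 1 / 2"
    using R0(6,7) L c LD by (simp_all add: pos_le_divide_eq algebra_simps)
  have balls: "x \<in> ball xbar \<rho>" "x \<in> ball xbar r1" "x \<in> ball xbar r2" "x \<in> ball xbar r3" if "x \<in> ball xbar R0" for x
    using that R0 by simp_all
  have \<phi>_ball: "\<phi> x \<in> ball (\<phi> xbar) (r / 2)" if x: "x \<in> ball xbar R0" for x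
  proof -
    have "norm (\<phi> x - \<phi> xbar) \<le> L * norm (x - xbar)" using balls(2)[OF x] r1 by (intro lip) auto
    also have "\<dots> < L * R0" using x L by (simp add: dist_norm norm_minus_commute)
    finally show ?thesis using R0'(1) by (simp add: dist_norm norm_minus_commute)
  qed
  have lower_x: "norm y \<le> 2 * c * norm (adjoint (blinfun_apply (D x)) y)" if x: "x \<in> ball xbar R0" and y: "y \<in> S" for x y
  proof -
    have "norm (adjoint (blinfun_apply (D xbar - D x)) y) \<le> norm (D xbar - D x) * norm y"
      by (rule norm_adjoint_blinfun_le)
    also have "norm (D xbar - D x) \<le> LD * norm (xbar - x)" using balls(4)[OF x] r3 by (intro lipD) auto
    also have "\<dots> \<le> LD * R0" using x LD by (intro mult_left_mono) (auto simp: dist_norm)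
    finally have "norm (adjoint (blinfun_apply (D xbar - D x)) y) \<le> (LD * R0) * norm y" by (simp add: mult_right_mono)
    moreover have "adjoint (blinfun_apply (D xbar)) y = adjoint (blinfun_apply (D x)) y + adjoint (blinfun_apply (D xbar - D x)) y"
      by (simp add: adj.diff_left)
    ultimately have "norm (adjoint (blinfun_apply (D xbar)) y) \<le> norm (adjoint (blinfun_apply (D x)) y) + (LD * R0) * norm y"
      using norm_triangle_ineq[of "adjoint (blinfun_apply (D x)) y" "adjoint (blinfun_apply (D xbar - D x)) y"] by simp
    then have "c * norm (adjoint (blinfun_apply (D xbar)) y) \<le> c * norm (adjoint (blinfun_apply (D x)) y) + (c * (LD * R0)) * norm y"
      using mult_left_mono[of _ _ c] c by (fastforce simp: algebra_simps)
    also have "(c * (LD * R0)) * norm y \<le> 1 / 2 * norm y" using R0'(2) by (intro mult_right_mono) auto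
    finally show ?thesis using lower[OF y] by simp
  qed
  have in_S: "y \<in> S" if "x \<in> ball xbar R0" "(\<phi> x, y) \<in> \<Gamma>" for x y
    by (rule convex_subdiff_subspace[of "\<phi> xbar" r S \<theta> "\<phi> x" y, OF inv S]) (use \<phi>_ball[OF that(1)] that(2) r in \<open>auto simp: \<Gamma>_iff\<close>)
  have chain: "limiting_subdiff (\<lambda>x. \<theta> (\<phi> x)) x = adjoint (blinfun_apply (D x)) ` convex_subdiff \<theta> (\<phi> x)"
    if x: "x \<in> ball xbar R0" for x
  proof -
    interpret x: transversal \<phi> "blinfun_apply (D x)" x S
    proof
      show "strict_derivative \<phi> (blinfun_apply (D x)) x" by (rule strict_\<phi>[OF balls(1)[OF x]])
      show "y = 0" if "y \<in> S" "adjoint (blinfun_apply (D x)) y = 0" for y using lower_x[OF x that(1)] that(2) by simp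
    qed (rule S)
    \<comment> \<open>The chain rule at \<open>x\<close> needs an invariance ball centred at
      \<open>\<phi> x\<close>; half the radius fits it into the one at
      \<open>\<phi> xbar\<close>.\<close>
    have sub: "z \<in> ball (\<phi> xbar) r" if "z \<in> ball (\<phi> x) (r / 2)" for z
      using that \<phi>_ball[OF x] dist_triangle[of "\<phi> xbar" z "\<phi> x"] by simp
    show ?thesis
      by (rule x.limiting_subdiff_compose[OF pl.piecewise_linear_axioms half_gt_zero[OF r]]) (intro inv sub)
  qed
  define R where "R = R0 / 2"
  have R: "R > 0" "cball xbar R \<subseteq> ball xbar R0" using R0(1) by (auto simp: R_def)
  have lc: "continuous_on (cball xbar R) g"
    if "l > 0" "\<And>x x'. \<lbrakk>x \<in> ball xbar R0; x' \<in> ball xbar R0\<rbrakk> \<Longrightarrow> norm (g x - g x') \<le> l * norm (x - x')"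
    for g :: "'a \<Rightarrow> 'e::real_normed_vector" and l
  proof -
    have "l-lipschitz_on (cball xbar R) g"
      using that R(2) by (intro lipschitz_onI) (auto simp: dist_norm subset_iff)
    then show ?thesis by (rule lipschitz_on_continuous_on)
  qed
  define K where "K = 2 * c * (1 + Lf + LD * (norm ybar + 1))"
  have K: "K > 0" unfolding K_def using c Lf LD by (intro mult_pos_pos add_pos_nonneg) auto
  show thesis
  proof (rule that[OF R(1) K])
    show "continuous_on (cball xbar R) \<phi>" by (rule lc[OF L]) (intro lip balls)
    show "continuous_on (cball xbar R) f" by (rule lc[OF Lf]) (intro lipf balls)
    show "continuous_on (cball xbar R) D" by (rule lc[OF LD]) (intro lipD balls)
    fix x v assume "x \<in> cball xbar R"
    then have x: "x \<in> ball xbar R0" using R(2) by blast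
    show "(x, v) \<in> M \<longleftrightarrow> (\<exists>y. (\<phi> x, y) \<in> \<Gamma> \<and> v = F x y)"
      by (auto simp: M_def chain[OF x] elt_set_plus_def \<Gamma>_iff F_def)
  next
    fix x x' y y' assume "x \<in> cball xbar R" "x' \<in> cball xbar R" and y: "(\<phi> x, y) \<in> \<Gamma>" "(\<phi> x', y') \<in> \<Gamma>"
      and y': "norm y' \<le> norm ybar + 1"
    then have x: "x \<in> ball xbar R0" "x' \<in> ball xbar R0" using R(2) by blast+
    \<comment> \<open>With \<open>D x\<close> kept in front of \<open>y - y'\<close>, the change of
      \<open>D\<close> acts on the bounded multiplier \<open>y'\<close> only.\<close>
    have "adjoint (blinfun_apply (D x)) (y - y') =
        (F x y - F x' y') - (f x - f x') - adjoint (blinfun_apply (D x - D x')) y'"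
      by (simp add: F_def adj.diff_left adj.diff_right)
    then have "norm (adjoint (blinfun_apply (D x)) (y - y')) \<le>
        norm (F x y - F x' y') + norm (f x - f x') + norm (adjoint (blinfun_apply (D x - D x')) y')"
      by (smt (verit) norm_triangle_ineq4)
    also have "norm (f x - f x') \<le> Lf * norm (x - x')" by (intro lipf balls x)
    also have "norm (adjoint (blinfun_apply (D x - D x')) y') \<le> norm (D x - D x') * norm y'"
      by (rule norm_adjoint_blinfun_le)
    also have "\<dots> \<le> (LD * norm (x - x')) * (norm ybar + 1)"
      using y' LD by (intro mult_mono lipD balls x) auto
    finally have "norm (adjoint (blinfun_apply (D x)) (y - y')) \<le>
        norm (F x y - F x' y') + (Lf + LD * (norm ybar + 1)) * norm (x - x')" by (simp add: algebra_simps)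
    also have "\<dots> \<le> (1 + Lf + LD * (norm ybar + 1)) * norm (F x y - F x' y') + (1 + Lf + LD * (norm ybar + 1)) * norm (x - x')"
      using Lf LD by (intro add_mono mult_right_mono) (auto simp: mult_le_cancel_right1 add_nonneg_nonneg)
    finally have *: "norm (adjoint (blinfun_apply (D x)) (y - y')) \<le>
        (1 + Lf + LD * (norm ybar + 1)) * (norm (F x y - F x' y') + norm (x - x'))" by (simp add: distrib_left)
    have "norm (y - y') \<le> 2 * c * norm (adjoint (blinfun_apply (D x)) (y - y'))"
      by (intro lower_x x subspace_diff[OF S] in_S[OF x(1) y(1)] in_S[OF x(2) y(2)])
    also have "\<dots> \<le> 2 * c * ((1 + Lf + LD * (norm ybar + 1)) * (norm (F x y - F x' y') + norm (x - x')))"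
      using * c by (intro mult_left_mono) auto
    finally show "norm (y - y') \<le> K * (norm (F x y - F x' y') + norm (x - x'))" by (simp add: K_def mult.assoc)
  qed
qed

section \<open>The coderivative of the solution map\<close>

definition \<Psi> where "\<Psi> p = (fst p, F (fst p) (snd p))"

text \<open>The derivative at \<open>xbar\<close> of \<open>F\<close> in its first argument, with
  the multiplier \<open>ybar\<close> frozen.\<close>

definition f_xy' where "f_xy' h = f' h + adjoint (blinfun_apply (H h)) ybar"

lemma strict_derivative_\<Psi>:
  "strict_derivative \<Psi> (\<lambda>h. (fst h, f_xy' (fst h) + adjoint (blinfun_apply (D xbar)) (snd h))) (xbar, ybar)"
proof -
  have 1: "strict_derivative (\<lambda>p :: 'a \<times> 'b. f (fst p)) (\<lambda>h. f' (fst h)) (xbar, ybar)"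
    by (rule strict_derivative_affine_compose[of f f' fst]) (auto simp: strict_f bounded_linear_fst)
  have 2: "strict_derivative (\<lambda>p :: 'a \<times> 'b. D (fst p)) (\<lambda>h. H (fst h)) (xbar, ybar)"
    by (rule strict_derivative_affine_compose[of D H fst]) (auto simp: strict_D bounded_linear_fst)
  have 3: "strict_derivative (snd :: 'a \<times> 'b \<Rightarrow> 'b) snd (xbar, ybar)"
    by (rule strict_derivative_of_linear[OF bounded_linear_snd])
  have 4: "strict_derivative (fst :: 'a \<times> 'b \<Rightarrow> 'a) fst (xbar, ybar)"
    by (rule strict_derivative_of_linear[OF bounded_linear_fst])
  show ?thesis
    using strict_derivative_Pair[OF 4 strict_derivative_add[OF 1 strict_derivative_bilinear[OF bounded_bilinear_adjoint 2 3]]]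
    by (simp add: \<Psi>_def[abs_def] F_def f_xy'_def add_ac)
qed

lemma linear_f_xy': "linear f_xy'"
  using bounded_linear.linear[OF strict_derivative_bounded_linear[OF strict_f]]
    bounded_linear.linear[OF bounded_linear_compose[OF bounded_bilinear.bounded_linear_left[OF bounded_bilinear_adjoint, of ybar]
        strict_derivative_bounded_linear[OF strict_D]]]
  unfolding f_xy'_def by (rule linear_compose_add)

text \<open>Moving \<open>u\<close> across the inner product gives \<open>H h u\<close>; symmetry of
  the second derivative exchanges \<open>h\<close> and \<open>u\<close>, so the Hessian term is
  self-adjoint.\<close>

lemma adjoint_f_xy': "adjoint f_xy' u = adjoint f' u + adjoint (blinfun_apply (H u)) ybar"
proof (rule vector_eq_ldot[THEN iffD1], rule allI)
  fix h
  have l: "linear (blinfun_apply X)" for X :: "'a \<Rightarrow>\<^sub>L 'b"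
    by (simp add: blinfun.bounded_linear_right bounded_linear.linear)
  have lf: "linear f'" by (rule bounded_linear.linear[OF strict_derivative_bounded_linear[OF strict_f]])
  have "h \<bullet> adjoint f_xy' u = f' h \<bullet> u + adjoint (blinfun_apply (H h)) ybar \<bullet> u"
    by (simp add: adjoint_works[OF linear_f_xy'] f_xy'_def inner_add_left)
  also have "adjoint (blinfun_apply (H h)) ybar \<bullet> u = H h u \<bullet> ybar"
    by (metis adjoint_works[OF l] inner_commute)
  also have "\<dots> = h \<bullet> adjoint (blinfun_apply (H u)) ybar" by (simp add: adjoint_works[OF l] H_sym[of h u])
  finally show "h \<bullet> adjoint f_xy' u = h \<bullet> (adjoint f' u + adjoint (blinfun_apply (H u)) ybar)"
    by (simp add: inner_add_right adjoint_works[OF lf])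
qed

text \<open>The adjoint of the derivative of \<open>\<Psi>\<close> sends \<open>(0, - u)\<close> to
  \<open>(- adjoint f_xy' u, - D xbar u)\<close>, to be tested on the pullback
  \<open>\<Lambda>\<close>; the preimage rule then solves the first component for \<open>q\<close>.
  Closedness of \<open>\<Gamma>\<close> turns approximate into limiting normals.\<close>

lemma approx_normal_cone_M_iff:
  "(0, - u) \<in> approx_normal_cone M (xbar, F xbar ybar) \<longleftrightarrow>
    (\<exists>q. adjoint (blinfun_apply (D xbar)) q = - adjoint f_xy' u \<and>
      (q, - D xbar u) \<in> limiting_normal_cone \<Gamma> (\<phi> xbar, ybar))"
proof -
  obtain R K where R: "R > 0" and K: "K > 0"
    and mem: "\<And>x v. x \<in> cball xbar R \<Longrightarrow> (x, v) \<in> M \<longleftrightarrow> (\<exists>y. (\<phi> x, y) \<in> \<Gamma> \<and> v = F x y)"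
    and low: "\<And>x x' y y'. \<lbrakk>x \<in> cball xbar R; x' \<in> cball xbar R; (\<phi> x, y) \<in> \<Gamma>; (\<phi> x', y') \<in> \<Gamma>; norm y' \<le> norm ybar + 1\<rbrakk>
       \<Longrightarrow> norm (y - y') \<le> K * (norm (F x y - F x' y') + norm (x - x'))"
    by (rule local_description) (rule that)
  define \<Lambda> where "\<Lambda> = {(x, y). (\<phi> x, y) \<in> \<Gamma>}"
  define T where "T = (\<lambda>h. (fst h, f_xy' (fst h) + adjoint (blinfun_apply (D xbar)) (snd h)))"
  \<comment> \<open>The cap 1 yields \<open>norm y' \<le> norm ybar + 1\<close>, as the multiplier
    estimate requires.\<close>
  define r where "r = min R 1"
  have r: "r > 0" "r \<le> R" "r \<le> 1" using R by (auto simp: r_def)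
  \<comment> \<open>A point of \<open>M\<close> within \<open>s\<close> of the image has a
    multiplier within \<open>2 * K * s\<close> of \<open>ybar\<close>; the choice makes
    \<open>s + 2 * K * s = r\<close>.\<close>
  define s where "s = r / (1 + 2 * K)"
  have "s * (1 + 2 * K) = r" using K by (simp add: s_def)
  then have s: "s > 0" "s + 2 * K * s = r" using r K by (simp add: s_def, simp add: algebra_simps)
  have "0 \<le> 2 * K * s" using K s(1) by simp
  then have sr: "s \<le> r" using s(2) by linarith
  have ybar\<Gamma>: "(\<phi> xbar, ybar) \<in> \<Gamma>" using ybar by (simp add: \<Gamma>_iff)
  have p0: "(xbar, ybar) \<in> \<Lambda>" using ybar\<Gamma> by (simp add: \<Lambda>_def)
  have fst_near: "fst p \<in> cball xbar R" "dist (snd p) ybar < r" if "dist p (xbar, ybar) < r" for p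
    using that dist_fst_le[of p "(xbar, ybar)"] dist_snd_le[of p "(xbar, ybar)"] r by (auto simp: dist_commute)
  have "(0, - u) \<in> approx_normal_cone M (\<Psi> (xbar, ybar)) \<longleftrightarrow> adjoint T (0, - u) \<in> approx_normal_cone \<Lambda> (xbar, ybar)"
  proof (rule approx_normal_cone_image[where r = r and s = s and c = "1 + 2 * K"])
    show "strict_derivative \<Psi> T (xbar, ybar)" unfolding T_def by (rule strict_derivative_\<Psi>)
    show "\<Psi> p \<in> M" if "p \<in> \<Lambda>" "dist p (xbar, ybar) < r" for p
      using that(1) fst_near[OF that(2)] by (auto simp: \<Lambda>_def \<Psi>_def mem)
    show "\<exists>p\<in>\<Lambda>. dist p (xbar, ybar) < r \<and> \<Psi> p = q" if q: "q \<in> M" "dist q (\<Psi> (xbar, ybar)) < s" for q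
    proof -
      obtain x v where eq: "q = (x, v)" by force
      have d: "dist x xbar < s" "dist v (F xbar ybar) < s"
        using q(2) dist_fst_le[of q "\<Psi> (xbar, ybar)"] dist_snd_le[of q "\<Psi> (xbar, ybar)"] by (simp_all add: eq \<Psi>_def)
      have x: "x \<in> cball xbar R" using d(1) sr r by (simp add: dist_commute)
      then obtain y where y: "(\<phi> x, y) \<in> \<Gamma>" "v = F x y" using q(1) mem by (auto simp: eq)
      have "norm (y - ybar) \<le> K * (norm (F x y - F xbar ybar) + norm (x - xbar))"
        using R by (intro low x y ybar\<Gamma>) auto
      also have "\<dots> \<le> K * (s + s)" using d y(2) K by (intro mult_left_mono add_mono) (auto simp: dist_norm)
      finally have "norm (x - xbar) + norm (y - ybar) < r" using d(1) s by (simp add: dist_norm)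
      then have "dist (x, y) (xbar, ybar) < r"
        using norm_Pair_le_add[of "x - xbar" "y - ybar"] by (simp add: dist_norm)
      then show ?thesis using y by (intro bexI[of _ "(x, y)"]) (auto simp: \<Lambda>_def \<Psi>_def eq)
    qed
    show "dist p p' \<le> (1 + 2 * K) * dist (\<Psi> p) (\<Psi> p')"
      if p: "p \<in> \<Lambda>" "p' \<in> \<Lambda>" "dist p (xbar, ybar) < r" "dist p' (xbar, ybar) < r" for p p'
    proof -
      obtain x y x' y' where eq: "p = (x, y)" "p' = (x', y')" by (cases p, cases p')
      have "norm y' \<le> norm ybar + norm (y' - ybar)" using norm_triangle_ineq[of ybar "y' - ybar"] by simp
      also have "norm (y' - ybar) \<le> 1" using fst_near(2)[OF p(4)] r by (simp add: eq dist_norm)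
      finally have "norm y' \<le> norm ybar + 1" by simp
      then have "norm (y - y') \<le> K * (norm (F x y - F x' y') + norm (x - x'))"
        using p fst_near(1)[OF p(3)] fst_near(1)[OF p(4)] by (intro low) (auto simp: eq \<Lambda>_def)
      moreover define N where "N = norm (\<Psi> p - \<Psi> p')"
      have N: "norm (x - x') \<le> N" "norm (F x y - F x' y') \<le> N"
        using norm_fst_le[of "x - x'" "F x y - F x' y'"] norm_snd_le[of "F x y - F x' y'" "x - x'"]
        by (simp_all add: N_def \<Psi>_def eq)
      then have "K * (norm (F x y - F x' y') + norm (x - x')) \<le> K * (N + N)"
        using K by (intro mult_left_mono) auto
      ultimately have "norm (p - p') \<le> N + K * (N + N)"
        using norm_Pair_le_add[of "x - x'" "y - y'"] N(1) by (simp add: eq)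
      then show ?thesis by (simp add: dist_norm N_def algebra_simps)
    qed
  qed (use r s K p0 in auto)
  moreover have "adjoint T = (\<lambda>p. (fst p + adjoint f_xy' (snd p), D xbar (snd p)))"
  proof (rule adjoint_unique, intro allI)
    fix h p :: "'a \<times> 'a" fix g :: "'a \<times> 'b"
    show "T g \<bullet> p = g \<bullet> (fst p + adjoint f_xy' (snd p), D xbar (snd p))"
      by (cases g, cases p)
        (simp add: T_def inner_add_left inner_add_right adjoint_works[OF linear_f_xy'] adjoint_A' adjoint_A inner_commute)
  qed
  ultimately have 1: "(0, - u) \<in> approx_normal_cone M (xbar, F xbar ybar) \<longleftrightarrow>
      (- adjoint f_xy' u, - D xbar u) \<in> approx_normal_cone \<Lambda> (xbar, ybar)"
    by (simp add: \<Psi>_def linear_neg[OF adjoint_linear[OF linear_f_xy']] blinfun.minus_right)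
  obtain ri where ri: "ri > 0"
    and inv: "\<And>z1 z2. \<lbrakk>z1 \<in> ball (\<phi> xbar) ri; z2 \<in> ball (\<phi> xbar) ri; z1 - z2 \<in> orthogonal_comp S\<rbrakk> \<Longrightarrow> \<theta> z1 = \<theta> z2"
    by (rule invariance_radius) (rule that)
  have 2: "(- adjoint f_xy' u, - D xbar u) \<in> approx_normal_cone \<Lambda> (xbar, ybar) \<longleftrightarrow>
      (\<exists>q. adjoint (blinfun_apply (D xbar)) q = - adjoint f_xy' u \<and>
        (q, - D xbar u) \<in> approx_normal_cone \<Gamma> (\<phi> xbar, ybar))"
    unfolding \<Lambda>_def
  proof (rule approx_normal_cone_preimage[OF ri])
    fix z z' y assume "(z, y) \<in> \<Gamma>" "z \<in> ball (\<phi> xbar) ri" "z' \<in> ball (\<phi> xbar) ri" "z - z' \<in> orthogonal_comp S"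
    then show "(z', y) \<in> \<Gamma>"
      unfolding \<Gamma>_iff using convex_subdiff_invariant(2)[of "\<phi> xbar" ri S \<theta>, OF inv S] by blast
  qed
  have "closed (\<Gamma> \<inter> cball (\<phi> xbar, ybar) 1)"
    using pl.closed_graph_convex_subdiff by (intro closed_Int) auto
  then have "approx_normal_cone \<Gamma> (\<phi> xbar, ybar) = limiting_normal_cone \<Gamma> (\<phi> xbar, ybar)"
    by (intro approx_eq_limiting_normal_cone[of 1] ybar\<Gamma>) auto
  then show ?thesis using 1 2 by simp
qed

text \<open>Near the reference point \<open>M\<close> is the image under the continuous
  \<open>\<Psi>\<close> of a compact part of the pullback; the multiplier estimate confines
  \<open>y\<close> to a ball.\<close>

lemma locally_closed_M:
  obtains r where "r > 0" "closed (M \<inter> cball (xbar, F xbar ybar) r)"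
proof -
  obtain R K where R: "R > 0" and K: "K > 0"
    and cont: "continuous_on (cball xbar R) \<phi>" "continuous_on (cball xbar R) f" "continuous_on (cball xbar R) D"
    and mem: "\<And>x v. x \<in> cball xbar R \<Longrightarrow> (x, v) \<in> M \<longleftrightarrow> (\<exists>y. (\<phi> x, y) \<in> \<Gamma> \<and> v = F x y)"
    and low: "\<And>x x' y y'. \<lbrakk>x \<in> cball xbar R; x' \<in> cball xbar R; (\<phi> x, y) \<in> \<Gamma>; (\<phi> x', y') \<in> \<Gamma>; norm y' \<le> norm ybar + 1\<rbrakk>
       \<Longrightarrow> norm (y - y') \<le> K * (norm (F x y - F x' y') + norm (x - x'))"
    by (rule local_description) (rule that)
  \<comment> \<open>For \<open>(x, v)\<close> within \<open>R\<close> of the reference point, the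
    estimate with \<open>y' = ybar\<close> gives the radius \<open>K * (R + R)\<close>.\<close>
  define C where "C = cball xbar R \<times> cball ybar (K * (R + R))"
  have C: "compact C" unfolding C_def by (intro compact_Times compact_cball)
  have fstC: "fst ` C \<subseteq> cball xbar R" by (auto simp: C_def)
  have c1: "continuous_on C (\<lambda>p. g (fst p))" if "continuous_on (cball xbar R) g" for g :: "'a \<Rightarrow> 'e::topological_space"
    by (rule continuous_on_compose2[OF that continuous_on_fst[OF continuous_on_id] fstC])
  have "closed (C \<inter> (\<lambda>p. (\<phi> (fst p), snd p)) -` \<Gamma>)"
    using pl.closed_graph_convex_subdiff compact_imp_closed[OF C]
    by (intro continuous_closed_preimage continuous_on_Pair c1[OF cont(1)] continuous_on_snd continuous_on_id)
  then have comp: "compact (C \<inter> (\<lambda>p. (\<phi> (fst p), snd p)) -` \<Gamma>)" (is "compact ?\<Lambda>")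
    using compact_Int_closed[OF C] by (metis inf.left_idem)
  have "continuous_on C \<Psi>"
    unfolding \<Psi>_def[abs_def] F_def
    by (intro continuous_on_Pair continuous_on_add c1[OF cont(2)] c1[OF cont(3)]
        bounded_bilinear.continuous_on[OF bounded_bilinear_adjoint] continuous_on_fst continuous_on_snd continuous_on_id)
  then have "continuous_on ?\<Lambda> \<Psi>" by (rule continuous_on_subset) auto
  then have cl: "closed (\<Psi> ` ?\<Lambda>)" using comp compact_continuous_image compact_imp_closed by blast
  have "M \<inter> cball (xbar, F xbar ybar) R = \<Psi> ` ?\<Lambda> \<inter> cball (xbar, F xbar ybar) R"
  proof (intro equalityI subsetI)
    fix q assume q: "q \<in> M \<inter> cball (xbar, F xbar ybar) R"
    obtain x v where eq: "q = (x, v)" by force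
    have d: "dist xbar x \<le> R" "dist (F xbar ybar) v \<le> R"
      using q dist_fst_le[of "(xbar, F xbar ybar)" q] dist_snd_le[of "(xbar, F xbar ybar)" q] by (simp_all add: eq)
    then obtain y where y: "(\<phi> x, y) \<in> \<Gamma>" "v = F x y" using q mem by (auto simp: eq)
    have "norm (y - ybar) \<le> K * (norm (F x y - F xbar ybar) + norm (x - xbar))"
      using R d ybar by (intro low y) (auto simp: \<Gamma>_iff)
    also have "\<dots> \<le> K * (R + R)"
      using d y(2) K by (intro mult_left_mono add_mono) (auto simp: dist_norm norm_minus_commute)
    finally have "(x, y) \<in> ?\<Lambda>" using d y(1) by (simp add: C_def dist_norm norm_minus_commute)
    then have "\<Psi> (x, y) \<in> \<Psi> ` ?\<Lambda>" by (rule imageI)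
    then show "q \<in> \<Psi> ` ?\<Lambda> \<inter> cball (xbar, F xbar ybar) R" using q y(2) by (simp add: \<Psi>_def eq)
  next
    fix q assume "q \<in> \<Psi> ` ?\<Lambda> \<inter> cball (xbar, F xbar ybar) R"
    then show "q \<in> M \<inter> cball (xbar, F xbar ybar) R" by (auto simp: \<Psi>_def C_def mem)
  qed
  then have "closed (M \<inter> cball (xbar, F xbar ybar) R)" using cl by (simp add: closed_Int)
  then show thesis using that R by blast
qed

lemma lipschitz_like_iff:
  "lipschitz_like (\<lambda>v. {x. v \<in> f x +o limiting_subdiff (\<lambda>x. \<theta> (\<phi> x)) x}) (F xbar ybar) xbar \<longleftrightarrow>
    (\<forall>u. (\<exists>q. adjoint (blinfun_apply (D xbar)) q = - adjoint f_xy' u \<and>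
      (q, - D xbar u) \<in> limiting_normal_cone \<Gamma> (\<phi> xbar, ybar)) \<longrightarrow> u = 0)"
proof -
  obtain r where r: "r > 0" "closed (M \<inter> cball (xbar, F xbar ybar) r)" by (rule locally_closed_M)
  have M: "{(x, v). x \<in> {x. v \<in> f x +o limiting_subdiff (\<lambda>x. \<theta> (\<phi> x)) x}} = M" by (simp add: M_def)
  show ?thesis
    using lipschitz_like_iff_approx_normal_trivial[OF r(1),
        of "\<lambda>v. {x. v \<in> f x +o limiting_subdiff (\<lambda>x. \<theta> (\<phi> x)) x}" xbar "F xbar ybar"] r(2)
    unfolding M approx_normal_cone_M_iff by blast
qed

end

section \<open>The Hessian and the direction space of the statement\<close>

lemma hessian_xx_inner:
  fixes \<Phi> :: "('a::euclidean_space \<times> 'c) \<Rightarrow> 'b::euclidean_space"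
  assumes \<rho>: "\<rho> > 0" and D: "\<And>x. x \<in> ball xbar \<rho> \<Longrightarrow> strict_derivative (\<lambda>x. \<Phi> (x, w)) (blinfun_apply (D x)) x"
    and H: "strict_derivative D H xbar"
  shows "hessian_xx (\<lambda>p. y \<bullet> \<Phi> p) xbar w u = adjoint (blinfun_apply (H u)) y"
proof -
  have lin: "linear (blinfun_apply X)" for X :: "'a \<Rightarrow>\<^sub>L 'b"
    by (simp add: blinfun.bounded_linear_right bounded_linear.linear)
  have grad: "gradient (\<lambda>x'. y \<bullet> \<Phi> (x', w)) x = adjoint (blinfun_apply (D x)) y" if x: "x \<in> ball xbar \<rho>" for x
  proof -
    have "((\<lambda>x'. y \<bullet> \<Phi> (x', w)) has_derivative (\<lambda>h. y \<bullet> D x h)) (at x)"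
      by (rule has_derivative_inner_right[OF strict_derivative_has_derivative[OF D[OF x]]])
    then have g: "GDERIV (\<lambda>x'. y \<bullet> \<Phi> (x', w)) x :> adjoint (blinfun_apply (D x)) y"
      by (simp add: gderiv_def adjoint_works[OF lin] inner_commute)
    show ?thesis
      unfolding gradient_def
    proof (rule the_equality, rule g)
      fix E assume "GDERIV (\<lambda>x'. y \<bullet> \<Phi> (x', w)) x :> E"
      then have "(\<lambda>h. h \<bullet> E) = (\<lambda>h. h \<bullet> adjoint (blinfun_apply (D x)) y)"
        using g unfolding gderiv_def by (rule has_derivative_unique)
      then show "E = adjoint (blinfun_apply (D x)) y" by (metis vector_eq_ldot)
    qed
  qed
  have "((\<lambda>x. adjoint (blinfun_apply (D x)) y) has_derivative (\<lambda>h. adjoint (blinfun_apply (H h)) y)) (at xbar)"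
    by (rule bounded_linear.has_derivative[OF bounded_bilinear.bounded_linear_left[OF bounded_bilinear_adjoint]
          strict_derivative_has_derivative[OF H]])
  \<comment> \<open>The gradient is identified on \<open>ball xbar \<rho>\<close> only, which
    determines its derivative at \<open>xbar\<close>.\<close>
  then have "(gradient (\<lambda>x'. y \<bullet> \<Phi> (x', w)) has_derivative (\<lambda>h. adjoint (blinfun_apply (H h)) y)) (at xbar)"
    by (rule has_derivative_transform_within_open[of _ _ _ _ "ball xbar \<rho>"]) (use \<rho> grad in auto)
  then show ?thesis
    unfolding hessian_xx_def by (metis frechet_derivative_at)
qed

text \<open>An affine set through 0 is a subspace parallel to itself. The standing assumption thus
  turns nondegeneracy into injectivity of the adjoint on the affine hull.\<close>

lemma direction_space_eq_affine_hull:
  assumes "0 \<in> affine hull A"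
  shows "direction_space A = affine hull A"
  unfolding direction_space_def
proof (rule the1_equality)
  show "\<exists>!L. subspace L \<and> affine_parallel (affine hull A) L"
    using assms by (intro affine_parallel_subspace affine_affine_hull) auto
  show "subspace (affine hull A) \<and> affine_parallel (affine hull A) (affine hull A)"
    using assms by (simp add: subspace_affine affine_parallel_reflex)
qed

theorem theorem4p3:
  fixes \<theta> :: "real ^ 'm \<Rightarrow> ereal"
    and \<Phi> :: "(real ^ 'n) \<times> (real ^ 'd) \<Rightarrow> real ^ 'm"
    and f :: "(real ^ 'n) \<times> (real ^ 'd) \<Rightarrow> real ^ 'n"
    and xbar vbar pbar :: "real ^ 'n"
    and wbar :: "real ^ 'd"
    and zbar ybar :: "real ^ 'm"
  assumes "convex_piecewise_linear \<theta>"
    and "C2_around \<Phi> (xbar, wbar)"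
    and "(vbar, xbar) \<in> graph_of (solution_map \<theta> \<Phi> f wbar)"
    and "strictly_differentiable_at (\<lambda>x. f (x, wbar)) xbar"
    and "zbar = \<Phi> (xbar, wbar)"
    and "zbar \<in> edom \<theta>"
    and "0 \<in> affine hull (convex_subdiff \<theta> zbar)"
    and "nondegenerate \<theta> \<Phi> xbar wbar"
    and "pbar = vbar - f (xbar, wbar)"
    and "ybar \<in> convex_subdiff \<theta> zbar"
    and "adjoint (partial_x \<Phi> xbar wbar) ybar = pbar"
  shows "lipschitz_like (solution_map \<theta> \<Phi> f wbar) vbar xbar \<longleftrightarrow>
    {u :: real ^ 'n.
       0 \<in> (adjoint (partial_x f xbar wbar) u
              + hessian_xx (\<lambda>p. ybar \<bullet> \<Phi> p) xbar wbar u)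
           +o adjoint (partial_x \<Phi> xbar wbar)
                ` second_subdiff \<theta> zbar ybar (partial_x \<Phi> xbar wbar u)} = {0}"
proof -
  obtain I J a \<alpha> d \<beta> where pl: "piecewise_linear \<theta> I J a \<alpha> d \<beta>"
    by (rule convex_piecewise_linear_imp_locale[OF assms(1)]) (rule that)
  obtain \<rho> D H where \<rho>: "\<rho> > 0"
    and D: "\<And>x. x \<in> ball xbar \<rho> \<Longrightarrow> strict_derivative (\<lambda>x. \<Phi> (x, wbar)) (blinfun_apply (D x)) x"
    and H: "strict_derivative D H xbar" "\<And>h k. blinfun_apply (H h) k = blinfun_apply (H k) h"
    by (rule C2_around_partial[OF assms(2)]) (rule that)
  obtain f' where f': "strict_derivative (\<lambda>x. f (x, wbar)) f' xbar"
    by (rule strictly_differentiable_at_imp[OF assms(4)]) (rule that)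
  have xb: "xbar \<in> ball xbar \<rho>" using \<rho> by simp
  have px: "partial_x \<Phi> xbar wbar = blinfun_apply (D xbar)" "partial_x f xbar wbar = f'"
    unfolding partial_x_def
    using frechet_derivative_at[OF strict_derivative_has_derivative[OF D[OF xb]]]
      frechet_derivative_at[OF strict_derivative_has_derivative[OF f']] by simp_all
  define S where "S = affine hull (convex_subdiff \<theta> zbar)"
  have S: "subspace S" "convex_subdiff \<theta> zbar \<subseteq> S"
    using assms(7) hull_subset[of "convex_subdiff \<theta> zbar" affine] by (simp_all add: S_def subspace_affine)
  have inj: "y = 0" if "y \<in> S" "adjoint (blinfun_apply (D xbar)) y = 0" for y
    using assms(8) that unfolding nondegenerate_def assms(5)[symmetric] px
    by (auto simp: S_def direction_space_eq_affine_hull[OF assms(7)])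
  interpret composite \<theta> I J a \<alpha> d \<beta> "\<lambda>x. \<Phi> (x, wbar)" D H "\<lambda>x. f (x, wbar)" f' xbar ybar \<rho> S
    using pl \<rho> D H f' S inj assms(5,10)
    by (intro composite.intro composite_axioms.intro) auto
  have vbar: "vbar = F xbar ybar" using assms(9,11) by (simp add: F_def px algebra_simps)
  have S_eq: "solution_map \<theta> \<Phi> f wbar =
      (\<lambda>v. {x. v \<in> f (x, wbar) +o limiting_subdiff (\<lambda>x. \<theta> (\<Phi> (x, wbar))) x})"
    by (simp add: solution_map_def[abs_def])
  have adj: "adjoint (partial_x f xbar wbar) u + hessian_xx (\<lambda>p. ybar \<bullet> \<Phi> p) xbar wbar u = adjoint f_xy' u" for u
    unfolding px adjoint_f_xy' by (subst hessian_xx_inner[OF \<rho> _ H(1)]) (auto intro: D)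
  let ?ker = "{u. 0 \<in> adjoint f_xy' u +o adjoint (blinfun_apply (D xbar)) `
      second_subdiff \<theta> zbar ybar (blinfun_apply (D xbar) u)}"
  have ker: "u \<in> ?ker \<longleftrightarrow> (\<exists>q. adjoint (blinfun_apply (D xbar)) q = - adjoint f_xy' u \<and>
      (q, - D xbar u) \<in> limiting_normal_cone \<Gamma> (\<Phi> (xbar, wbar), ybar))" for u
    by (auto simp: elt_set_plus_def second_subdiff_def assms(5) eq_neg_iff_add_eq_0 add.commute)
  \<comment> \<open>The zero vector is normal at every point of \<open>M\<close>, so the set in the
    statement contains 0 and equality with \<open>{0}\<close> reduces to the implication in the
    criterion.\<close>
  have "(0, - 0) \<in> approx_normal_cone M (xbar, F xbar ybar)"
  proof -
    have "vbar \<in> f (xbar, wbar) +o limiting_subdiff (\<lambda>x. \<theta> (\<Phi> (x, wbar))) xbar"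
      using assms(3) by (simp add: graph_of_def S_eq)
    then have "(xbar, F xbar ybar) \<in> M" by (simp add: M_def vbar)
    then show ?thesis by (force simp: approx_normal_cone_def zero_prod_def[symmetric])
  qed
  then have "0 \<in> ?ker" unfolding ker approx_normal_cone_M_iff .
  then have "?ker = {0} \<longleftrightarrow> (\<forall>u. u \<in> ?ker \<longrightarrow> u = 0)" by blast
  then show ?thesis
    unfolding S_eq vbar adj px(1) lipschitz_like_iff ker[symmetric] by simp
qed

end
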